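(* Let $N\ge 1$ be an integer, let $\boldsymbol f\in\mathbb H^{-1,2}_0(G)$, and assume that there is a non-random $\theta\in(0,1)$ such that $$\mathbb P\Big(|\boldsymbol f|_{-1,2}\le \frac{2\theta\nu^2}{\sqrt{|G|}}\Big)=1,$$ so that the Navier-Stokes system with forcing $\boldsymbol f$ has a unique solution $\boldsymbol u\in\widehat{\mathbb H}^{1,2}_0(G)$. Let $\boldsymbol v_N\in\mathcal P^N\big(\widehat{\mathbb H}^{1,2}_0(G)\big)$ be the unique solution of the Galerkin equation of order $N$ with forcing $\boldsymbol f$ satisfying, for some non-random $\varepsilon_N\in(0,1)$, $$\mathbb P\Big(|\boldsymbol v_N|_{1,2}\le\frac{2\nu(1-\varepsilon_N)}{\sqrt{|G|}}\Big)=1.$$ Then $$|\mathcal P^N\boldsymbol u-\boldsymbol v_N|_{\mathbb H^{1,2}_0}\le\frac{\theta+1-\varepsilon_N}{\varepsilon_N}\,|\boldsymbol u-\mathcal P^N\boldsymbol u|_{\mathbb H^{1,2}_0}$$ and $$|\boldsymbol u-\boldsymbol v_N|_{\mathbb H^{1,2}_0}\le\Big(1+\frac{\theta+1-\varepsilon_N}{\varepsilon_N}\Big)|\boldsymbol u-\mathcal P^N\boldsymbol u|_{\mathbb H^{1,2}_0}.$$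
   Context: $G\subset\mathbb R^2$ is a bounded domain with locally Lipschitz boundary and area $|G|$; $\nu>0$ is a constant. Function spaces. For a vector field $\mathbf g=(g^1,g^2)$, $|\mathbf g|_{1,2}^2=\sum_{i,j=1}^2\int_G|\partial g^i/\partial x_j|^2dx$, and $(\nabla\mathbf f,\nabla\mathbf g)_0=\sum_{i,j}\int_G\frac{\partial f^i}{\partial x_j}\frac{\partial g^i}{\partial x_j}dx$. $H^{1,2}_0(G)$ is the completion of $C_0^\infty(G)$ in the norm $(\int_G|\nabla g|^2dx)^{1/2}$; $\mathbf H^{1,2}_0(G)$ is the space of vector fields with both components in $H^{1,2}_0(G)$, with norm $|\cdot|_{1,2}$. $\mathcal D(G)$ is the set of divergence-free vector fields with components in $C_0^\infty(G)$, and $\widehat{\mathbf H}^{1,2}_0(G)$ is the completion of $\mathcal D(G)$ in $|\cdot|_{1,2}$. $\mathbf H^{-1,2}_0(G)$ is the dual of $\mathbf H^{1,2}_0(G)$, with norm $|\mathbf g|_{-1,2}=(|g^1|_{-1,2}^2+|g^2|_{-1,2}^2)^{1/2}$, where $|g|_{-1,2}$ for scalar $g$ is the dual norm to $(\int_G|\nabla \varphi|^2dx)^{1/2}$; the duality is written $\langle\cdot,\cdot\rangle_1$. Trilinear form: $\mathfrak a(\mathbf u,\mathbf v,\mathbf w)=\int_G\sum_{i,j=1}^2u^j\frac{\partial v^i}{\partial x_j}w^i\,dx$ for $\mathbf u,\mathbf v,\mathbf w\in\mathbf H^{1,2}_0(G)$. Randomness. $(\Omega,\mathcal F,\mathbb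 P)$ is a probability space such that $L_2(\Omega)$ is a separable Hilbert space with a complete orthogonal basis $\{\mathfrak P_n,\ n\ge0\}$ with the property that each product $\mathfrak P_m\mathfrak P_n$ is a finite linear combination of the $\mathfrak P_l$. $\mathbb H^{-1,2}_0(G)=L^2(\Omega;\mathbf H^{-1,2}_0(G))$, $\mathbb H^{1,2}_0(G)=L^2(\Omega;\mathbf H^{1,2}_0(G))$, $\widehat{\mathbb H}^{1,2}_0(G)=L^2(\Omega;\widehat{\mathbf H}^{1,2}_0(G))$, with norms $|\boldsymbol g|_{\mathbb H^{\pm1,2}_0}=(\mathbb E|\boldsymbol g|_{\pm1,2}^2)^{1/2}$. $\mathcal P^N$ is the orthogonal projection of $L_2(\Omega)$ onto the span of $\mathfrak P_0,\dots,\mathfrak P_N$, extended to Hilbert-space-valued random elements by $\mathcal P^N\boldsymbol g=\sum_{k=0}^N\frac{\mathbb E(\boldsymbol g\mathfrak P_k)}{\mathbb E\mathfrak P_k^2}\mathfrak P_k$; $\mathcal P^N(\widehat{\mathbb H}^{1,2}_0(G))$ is the set of all $\sum_{k=0}^N\mathbf v^k\mathfrak P_k$ with $\mathbf v^k\in\widehat{\mathbf H}^{1,2}_0(G)$. Solutions. $\boldsymbol u\in\widehat{\mathbb H}^{1,2}_0(G)$ is a solution of the Navier-Stokes system with forcing $\boldsymbol f$ (weak form of $\nu\Delta\boldsymbol u=(\boldsymbol u\cdot\nabla)\boldsymbol u+\nabla p+\boldsymbol f$, $\operatorname{div}\boldsymbol u=0$, $\boldsymbol u|_{\partial G}=0$)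 if for every $\boldsymbol\varphi\in\mathcal D(G)$, with probability one, $\nu(\nabla\boldsymbol u,\nabla\boldsymbol\varphi)_0+\mathfrak a(\boldsymbol u,\boldsymbol u,\boldsymbol\varphi)=-\langle\boldsymbol f,\boldsymbol\varphi\rangle_1$. $\boldsymbol v_N\in\mathcal P^N(\widehat{\mathbb H}^{1,2}_0(G))$ is a solution of the Galerkin equation of order $N$ with forcing $\boldsymbol f$ if for every $\boldsymbol\varphi\in\mathcal D(G)$, with probability one, $\nu(\nabla\boldsymbol v_N,\nabla\boldsymbol\varphi)_0+\mathcal P^N\mathfrak a(\boldsymbol v_N,\boldsymbol v_N,\boldsymbol\varphi)=-\langle\mathcal P^N\boldsymbol f,\boldsymbol\varphi\rangle_1$. Under the stated smallness hypothesis on $\boldsymbol f$, the solution $\boldsymbol u$ exists, is unique, and satisfies $|\boldsymbol u|_{1,2}\le 2\nu\theta/\sqrt{|G|}$ with probability one (known result). *)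

theory Defs
  imports "HOL-Probability.Probability"
begin

section \<open>The Hilbert space of square-integrable functions\<close>

definition square_integrable :: "'a measure \<Rightarrow> ('a \<Rightarrow> real) \<Rightarrow> bool" where
  "square_integrable M f \<longleftrightarrow> f \<in> borel_measurable M \<and> integrable M (\<lambda>x. (f x)\<^sup>2)"

lemma square_integrable_measurable [measurable_dest]:
  "square_integrable M f \<Longrightarrow> f \<in> borel_measurable M"
  by (simp add: square_integrable_def)

lemma square_integrable_mult:
  assumes "square_integrable M f" "square_integrable M g"
  shows "integrable M (\<lambda>x. f x * g x)"
proof (rule Bochner_Integration.integrable_bound)
  show "integrable M (\<lambda>x. (f x)\<^sup>2 + (g x)\<^sup>2)"
    using assms by (auto simp: square_integrable_def)
  show "(\<lambda>x. f x * g x) \<in> borel_measurable M"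
    using assms by (auto simp: square_integrable_def)
  show "AE x in M. norm (f x * g x) \<le> norm ((f x)\<^sup>2 + (g x)\<^sup>2)"
  proof (rule AE_I2)
    fix x
    have "2 * (\<bar>f x\<bar> * \<bar>g x\<bar>) \<le> (f x)\<^sup>2 + (g x)\<^sup>2"
      using sum_squares_bound[of "\<bar>f x\<bar>" "\<bar>g x\<bar>"] by simp
    moreover have "0 \<le> \<bar>f x\<bar> * \<bar>g x\<bar>" by simp
    ultimately show "norm (f x * g x) \<le> norm ((f x)\<^sup>2 + (g x)\<^sup>2)"
      unfolding real_norm_def abs_mult by linarith
  qed
qed

lemma square_integrable_add:
  assumes "square_integrable M f" "square_integrable M g"
  shows "square_integrable M (\<lambda>x. f x + g x)"
  using assms square_integrable_mult[OF assms]
  by (auto simp: square_integrable_def power2_sum mult.assoc)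

lemma square_integrable_scale:
  assumes "square_integrable M f"
  shows "square_integrable M (\<lambda>x. c * f x)"
  using assms by (auto simp: square_integrable_def power_mult_distrib)

lemma square_integrable_zero: "square_integrable M (\<lambda>x. 0)"
  by (simp add: square_integrable_def)

lemma square_integrable_diff:
  assumes "square_integrable M f" "square_integrable M g"
  shows "square_integrable M (\<lambda>x. f x - g x)"
  using square_integrable_add[OF assms(1) square_integrable_scale[OF assms(2), of "-1"]] by simp

definition L2_rel :: "('a::euclidean_space \<Rightarrow> real) \<Rightarrow> ('a \<Rightarrow> real) \<Rightarrow> bool" where
  "L2_rel f g \<longleftrightarrow> square_integrable lborel f \<and> square_integrable lborel g \<and> (AE x in lborel. f x = g x)"

quotient_type (overloaded) 'a L2 = "'a::euclidean_space \<Rightarrow> real" / partial: L2_rel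
proof (rule part_equivpI)
  show "\<exists>f. L2_rel f f" 
    by (rule exI[of _ "\<lambda>x. 0"]) (simp add: L2_rel_def square_integrable_zero)
  show "symp L2_rel" by (rule sympI) (auto simp: L2_rel_def)
  show "transp L2_rel"
    by (rule transpI) (auto simp: L2_rel_def elim: AE_mp)
qed

lemma L2_rel_refl: "L2_rel f f \<longleftrightarrow> square_integrable lborel f"
  by (auto simp: L2_rel_def)

lemma rep_L2_sq: "square_integrable lborel (rep_L2 u)"
  using Quotient_rep_reflp[OF Quotient_L2, of u] by (simp add: L2_rel_refl)

lemma rep_L2_measurable [measurable]: "rep_L2 u \<in> borel_measurable borel"
  using rep_L2_sq[of u] by (simp add: square_integrable_def)

lemma rep_abs_L2: "square_integrable lborel f \<Longrightarrow> AE x in lborel. rep_L2 (abs_L2 f) x = f x"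
  using Quotient_rep_abs[OF Quotient_L2, of f] by (simp add: L2_rel_refl) (simp add: L2_rel_def)

lemma abs_rep_L2: "abs_L2 (rep_L2 u) = u"
  by (rule Quotient_abs_rep[OF Quotient_L2])

lemma L2_eqI: "(AE x in lborel. rep_L2 u x = rep_L2 v x) \<Longrightarrow> u = v"
  using Quotient_rel_rep[OF Quotient_L2, of u v] by (simp add: L2_rel_def rep_L2_sq)

instantiation L2 :: (euclidean_space) real_vector
begin

lift_definition zero_L2 :: "'a L2" is "\<lambda>x. 0"
  by (simp add: L2_rel_def square_integrable_zero)

lift_definition plus_L2 :: "'a L2 \<Rightarrow> 'a L2 \<Rightarrow> 'a L2" is "\<lambda>f g x. f x + g x"
  by (auto simp: L2_rel_def square_integrable_add elim: AE_mp)

lift_definition minus_L2 :: "'a L2 \<Rightarrow> 'a L2 \<Rightarrow> 'a L2" is "\<lambda>f g x. f x - g x"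
  by (auto simp: L2_rel_def square_integrable_diff elim: AE_mp)

lift_definition uminus_L2 :: "'a L2 \<Rightarrow> 'a L2" is "\<lambda>f x. - f x"
  using square_integrable_scale[where c = "-1"] by (auto simp: L2_rel_def elim: AE_mp)

lift_definition scaleR_L2 :: "real \<Rightarrow> 'a L2 \<Rightarrow> 'a L2" is "\<lambda>c f x. c * f x"
  by (auto simp: L2_rel_def square_integrable_scale elim: AE_mp)

instance
proof
  fix a b c :: "'a L2" and r s :: real
  show "a + b + c = a + (b + c)"
    by transfer (auto simp: L2_rel_def add.assoc intro!: square_integrable_add)
  show "a + b = b + a"
    by transfer (auto simp: L2_rel_def add.commute intro!: square_integrable_add)
  show "0 + a = a"
    by transfer (auto simp: L2_rel_def)
  show "- a + a = 0"
    by transfer (auto simp: L2_rel_def square_integrable_zero)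
  show "a - b = a + - b"
    by transfer (auto simp: L2_rel_def intro!: square_integrable_diff)
  show "r *\<^sub>R (a + b) = r *\<^sub>R a + r *\<^sub>R b"
    by transfer (auto simp: L2_rel_def distrib_left intro!: square_integrable_add square_integrable_scale)
  show "(r + s) *\<^sub>R a = r *\<^sub>R a + s *\<^sub>R a"
    by transfer (auto simp: L2_rel_def distrib_right intro!: square_integrable_add square_integrable_scale)
  show "r *\<^sub>R s *\<^sub>R a = (r * s) *\<^sub>R a"
    by transfer (auto simp: L2_rel_def mult.assoc intro!: square_integrable_scale)
  show "1 *\<^sub>R a = a"
    by transfer (auto simp: L2_rel_def)
qed

end

instantiation L2 :: (euclidean_space) real_inner
begin

lift_definition inner_L2 :: "'a L2 \<Rightarrow> 'a L2 \<Rightarrow> real" is "\<lambda>f g. \<integral>x. f x * g x \<partial>lborel"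
  unfolding L2_rel_def square_integrable_def by (intro integral_cong_AE) auto

definition norm_L2 :: "'a L2 \<Rightarrow> real" where "norm_L2 u = sqrt (u \<bullet> u)"
definition dist_L2 :: "'a L2 \<Rightarrow> 'a L2 \<Rightarrow> real" where "dist_L2 u v = norm (u - v)"
definition sgn_L2 :: "'a L2 \<Rightarrow> 'a L2" where "sgn_L2 u = u /\<^sub>R norm u"
definition uniformity_L2 :: "('a L2 \<times> 'a L2) filter" where
  "uniformity_L2 = (INF e\<in>{0<..}. principal {(x, y). dist x y < e})"
definition open_L2 :: "'a L2 set \<Rightarrow> bool" where
  "open_L2 U \<longleftrightarrow> (\<forall>x\<in>U. eventually (\<lambda>(x', y). x' = x \<longrightarrow> y \<in> U) uniformity)"

instance
proof
  fix u v w :: "'a L2" and r :: real and U :: "'a L2 set"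
  show "dist u v = norm (u - v)" by (rule dist_L2_def)
  show "sgn u = u /\<^sub>R norm u" by (rule sgn_L2_def)
  show "uniformity = (INF e\<in>{0<..}. principal {(x::'a L2, y). dist x y < e})"
    by (rule uniformity_L2_def)
  show "open U \<longleftrightarrow> (\<forall>x\<in>U. eventually (\<lambda>(x', y). x' = x \<longrightarrow> y \<in> U) uniformity)"
    by (rule open_L2_def)
  show "norm u = sqrt (u \<bullet> u)" by (rule norm_L2_def)
  show "u \<bullet> v = v \<bullet> u" by transfer (simp add: mult.commute)
  show "(u + v) \<bullet> w = u \<bullet> w + v \<bullet> w"
    by transfer (simp add: distrib_right L2_rel_refl square_integrable_mult)
  show "(r *\<^sub>R u) \<bullet> v = r * (u \<bullet> v)"
    by transfer (simp add: mult.assoc)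
  show "0 \<le> u \<bullet> u" by transfer simp
  show "u \<bullet> u = 0 \<longleftrightarrow> u = 0"
  proof transfer
    fix f :: "'a \<Rightarrow> real" assume f: "L2_rel f f"
    then have "integrable lborel (\<lambda>x. f x * f x)"
      by (simp add: L2_rel_refl square_integrable_mult)
    then have "(\<integral>x. f x * f x \<partial>lborel) = 0 \<longleftrightarrow> (AE x in lborel. f x * f x = 0)"
      by (intro integral_nonneg_eq_0_iff_AE) auto
    then show "(\<integral>x. f x * f x \<partial>lborel) = 0 \<longleftrightarrow> L2_rel f (\<lambda>x. 0)"
      using f by (auto simp: L2_rel_def square_integrable_zero)
  qed
qed

end

lemma abs_L2_diff:
  assumes "square_integrable lborel f" "square_integrable lborel g"
  shows "abs_L2 f - abs_L2 g = abs_L2 (\<lambda>x. f x - g x)"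
  using assms by (intro minus_L2.abs_eq) (auto simp: L2_rel_refl)

lemma norm_abs_L2:
  assumes "square_integrable lborel f"
  shows "norm (abs_L2 f) = sqrt (\<integral>x. (f x)\<^sup>2 \<partial>lborel)"
  using inner_L2.abs_eq[of f f] assms by (simp add: L2_rel_refl norm_L2_def power2_eq_square)

lemma dist_abs_L2:
  assumes "square_integrable lborel f" "square_integrable lborel g"
  shows "dist (abs_L2 f) (abs_L2 g) = sqrt (\<integral>x. (f x - g x)\<^sup>2 \<partial>lborel)"
  using assms by (simp add: dist_norm abs_L2_diff norm_abs_L2 square_integrable_diff)

lemma dist_rep_L2: "dist u v = sqrt (\<integral>x. (rep_L2 u x - rep_L2 v x)\<^sup>2 \<partial>lborel)"
  using dist_abs_L2[OF rep_L2_sq rep_L2_sq, of u v] by (simp add: abs_rep_L2)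

instance L2 :: (euclidean_space) complete_space
proof
  fix X :: "nat \<Rightarrow> 'a L2" assume X: "Cauchy X"
  have "\<exists>N. \<forall>n m. n \<ge> N \<longrightarrow> m \<ge> N \<longrightarrow> dist (X m) (X n) < (1/4)^k" for k
    using metric_CauchyD[OF X, of "(1/4)^k"] by auto
  then obtain N where N: "dist (X m) (X n) < (1/4)^k" if "n \<ge> N k" "m \<ge> N k" for k m n
    by metis
  define r where "r k = (\<Sum>i\<le>k. N i) + k" for k
  have rN: "N k \<le> r k" for k
    unfolding r_def using member_le_sum[of k "{..k}" N] by auto
  have r_mono: "r k \<le> r (Suc k)" for k
    unfolding r_def by simp
  define h where "h k = rep_L2 (X (r k))" for k
  have h_sq: "square_integrable lborel (h k)" for k
    unfolding h_def by (rule rep_L2_sq)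
  have h_meas [measurable]: "h k \<in> borel_measurable borel" for k
    unfolding h_def by simp
  have dist_h: "dist (X n) (X (r k)) = sqrt (\<integral>x. (rep_L2 (X n) x - h k x)\<^sup>2 \<partial>lborel)" for n k
    unfolding h_def by (rule dist_rep_L2)
  have int_sq: "integrable lborel (\<lambda>x. (rep_L2 (X n) x - h k x)\<^sup>2)" for n k
    using square_integrable_diff[OF rep_L2_sq[of "X n"] h_sq[of k]] by (simp add: square_integrable_def)
  define A where "A k = {x \<in> space lborel. (1/2)^(2*k) \<le> (h (Suc k) x - h k x)\<^sup>2}" for k
  have A_sets [measurable]: "A k \<in> sets lborel" for k
    unfolding A_def by measurable
  have A_le: "emeasure lborel (A k) \<le> ennreal ((1/2)^(2*k))" for k
  proof -
    have "(\<integral>x. (h (Suc k) x - h k x)\<^sup>2 \<partial>lborel) = (dist (X (r (Suc k))) (X (r k)))\<^sup>2"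
      by (subst dist_h) (simp add: h_def)
    also have "\<dots> \<le> ((1/4)^k)\<^sup>2"
      using N[of k "r k" "r (Suc k)"] rN[of k] r_mono[of k] 
      by (intro power_mono) auto
    finally have *: "(\<integral>x. (h (Suc k) x - h k x)\<^sup>2 \<partial>lborel) \<le> ((1/4)^k)\<^sup>2" .
    have "emeasure lborel (A k) \<le> ennreal (1 / (1/2)^(2*k) * (\<integral>x. (h (Suc k) x - h k x)\<^sup>2 \<partial>lborel))"
      unfolding A_def 
      using int_sq[of "r (Suc k)" k] 
      by (intro integral_Markov_inequality) (auto simp: h_def)
    also have "\<dots> \<le> ennreal (1 / (1/2)^(2*k) * ((1/4)^k)\<^sup>2)"
      using * by (intro ennreal_leI mult_left_mono) auto
    also have "1 / (1/2)^(2*k) * ((1/4)^k)\<^sup>2 = ((1/2)^(2*k) :: real)"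
    proof -
      have "(1/4)^k = ((1/2)^(2*k) :: real)" by (simp add: power_mult power2_eq_square)
      then have "((1/4)^k)\<^sup>2 = ((1/2)^(2*k) :: real) * (1/2)^(2*k)"
        by (simp only: power2_eq_square)
      then show ?thesis by simp
    qed
    finally show ?thesis .
  qed
  have "AE x in lborel. eventually (\<lambda>k. x \<in> space lborel - A k) sequentially"
  proof (rule borel_cantelli_AE1)
    show "A k \<in> sets lborel" for k by (rule A_sets)
    show "emeasure lborel (A k) < \<infinity>" for k
      using A_le[of k] by (rule le_less_trans) simp
    show "summable (\<lambda>k. measure lborel (A k))"
    proof (rule summable_comparison_test')
      show "summable (\<lambda>k. (1/4 :: real)^k)" by (simp add: summable_geometric)
      show "norm (measure lborel (A k)) \<le> (1/4)^k" if "k \<ge> 0" for k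
      proof -
        have "(1/2)^(2*k) = ((1/4)^k :: real)" by (simp add: power_mult power2_eq_square)
        then have "enn2real (emeasure lborel (A k)) \<le> (1/4)^k"
          using A_le[of k] by (intro enn2real_leI) auto
        then show ?thesis by (simp add: measure_def)
      qed
    qed
  qed
  then have conv: "AE x in lborel. convergent (\<lambda>k. h k x)"
  proof (rule AE_mp, intro AE_I2 impI)
    fix x assume "eventually (\<lambda>k. x \<in> space lborel - A k) sequentially"
    then obtain K where K: "x \<notin> A k" if "k \<ge> K" for k
      unfolding eventually_sequentially by blast
    have "summable (\<lambda>k. h (Suc k) x - h k x)"
    proof (rule summable_comparison_test')
      show "summable (\<lambda>k. (1/2 :: real)^k)" by (simp add: summable_geometric)
      show "norm (h (Suc k) x - h k x) \<le> (1/2)^k" if "k \<ge> K" for k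
      proof -
        have "(h (Suc k) x - h k x)\<^sup>2 \<le> ((1/2)^k)\<^sup>2"
          using K[OF that] by (simp add: A_def power_mult[symmetric] mult.commute)
        then show ?thesis
          using power2_le_iff_abs_le[of "(1/2)^k" "h (Suc k) x - h k x"] by simp
      qed
    qed
    then have "convergent (\<lambda>n. \<Sum>k<n. h (Suc k) x - h k x)"
      by (simp add: summable_iff_convergent)
    then have "convergent (\<lambda>n. h n x - h 0 x)"
      using sum_lessThan_telescope[of "\<lambda>k. h k x"] by simp
    from convergent_add[OF this convergent_const[of "h 0 x"]] show "convergent (\<lambda>k. h k x)"
      by simp
  qed
  define g where "g x = lim (\<lambda>k. h k x)" for x
  have g_meas [measurable]: "g \<in> borel_measurable borel"
    unfolding g_def by measurable
  have lim: "AE x in lborel. (\<lambda>k. h k x) \<longlonglongrightarrow> g x"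
    using conv by (rule AE_mp) (simp add: g_def convergent_LIMSEQ_iff)
  have bound: "integrable lborel (\<lambda>x. (rep_L2 (X n) x - g x)\<^sup>2) \<and>
      (\<integral>x. (rep_L2 (X n) x - g x)\<^sup>2 \<partial>lborel) \<le> ((1/4)^k)\<^sup>2"
    if "n \<ge> N k" for n k
  proof -
    have "(\<integral>\<^sup>+x. ennreal ((rep_L2 (X n) x - g x)\<^sup>2) \<partial>lborel)
        = (\<integral>\<^sup>+x. liminf (\<lambda>j. ennreal ((rep_L2 (X n) x - h j x)\<^sup>2)) \<partial>lborel)"
    proof (rule nn_integral_cong_AE, use lim in \<open>rule AE_mp\<close>, intro AE_I2 impI)
      fix x assume "(\<lambda>k. h k x) \<longlonglongrightarrow> g x"
      then have "(\<lambda>j. ennreal ((rep_L2 (X n) x - h j x)\<^sup>2)) \<longlonglongrightarrow> ennreal ((rep_L2 (X n) x - g x)\<^sup>2)"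
        by (intro tendsto_ennrealI tendsto_intros)
      then show "ennreal ((rep_L2 (X n) x - g x)\<^sup>2) = liminf (\<lambda>j. ennreal ((rep_L2 (X n) x - h j x)\<^sup>2))"
        using lim_imp_Liminf[OF sequentially_bot] by metis
    qed
    also have "\<dots> \<le> liminf (\<lambda>j. \<integral>\<^sup>+x. ennreal ((rep_L2 (X n) x - h j x)\<^sup>2) \<partial>lborel)"
      by (intro nn_integral_liminf) measurable
    also have "\<dots> \<le> ennreal (((1/4)^k)\<^sup>2)"
    proof (rule Liminf_le[OF sequentially_bot])
      show "\<forall>\<^sub>F j in sequentially. (\<integral>\<^sup>+x. ennreal ((rep_L2 (X n) x - h j x)\<^sup>2) \<partial>lborel) \<le> ennreal (((1/4)^k)\<^sup>2)"
      proof (rule eventually_sequentiallyI[of k])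
        fix j assume "k \<le> j"
        have "r k \<le> r j" using \<open>k \<le> j\<close> r_mono by (rule lift_Suc_mono_le[rotated])
        then have "N k \<le> r j" using rN[of k] by simp
        then have "dist (X n) (X (r j)) \<le> (1/4)^k"
          using N[of k "r j" n] that by simp
        then have "(dist (X n) (X (r j)))\<^sup>2 \<le> ((1/4)^k)\<^sup>2"
          by (intro power_mono) auto
        then have "(\<integral>x. (rep_L2 (X n) x - h j x)\<^sup>2 \<partial>lborel) \<le> ((1/4)^k)\<^sup>2"
          by (simp add: dist_h)
        then show "(\<integral>\<^sup>+x. ennreal ((rep_L2 (X n) x - h j x)\<^sup>2) \<partial>lborel) \<le> ennreal (((1/4)^k)\<^sup>2)"
          by (subst nn_integral_eq_integral[OF int_sq]) (auto intro: ennreal_leI)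
      qed
    qed
    finally have *: "(\<integral>\<^sup>+x. ennreal ((rep_L2 (X n) x - g x)\<^sup>2) \<partial>lborel) \<le> ennreal (((1/4)^k)\<^sup>2)" .
    have int: "integrable lborel (\<lambda>x. (rep_L2 (X n) x - g x)\<^sup>2)"
      using le_less_trans[OF * ennreal_less_top] by (intro integrableI_nonneg) auto
    with * show ?thesis
      by (subst (asm) nn_integral_eq_integral) auto
  qed
  have "square_integrable lborel (\<lambda>x. rep_L2 (X (N 0)) x - g x)"
    using bound[of 0 "N 0"] by (simp add: square_integrable_def)
  from square_integrable_diff[OF rep_L2_sq[of "X (N 0)"] this]
  have g_sq: "square_integrable lborel g" by simp
  have "X \<longlonglongrightarrow> abs_L2 g"
  proof (rule metric_LIMSEQ_I)
    fix e :: real assume "0 < e"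
    then obtain k where k: "(1/4)^k < e"
      using real_arch_pow_inv[of e "1/4"] by auto
    have "dist (X n) (abs_L2 g) < e" if "n \<ge> N k" for n
    proof -
      have "dist (X n) (abs_L2 g) = sqrt (\<integral>x. (rep_L2 (X n) x - g x)\<^sup>2 \<partial>lborel)"
        using dist_abs_L2[OF rep_L2_sq g_sq, of "X n"] by (simp add: abs_rep_L2)
      also have "\<dots> \<le> sqrt (((1/4)^k)\<^sup>2)"
        using bound[OF that] by (intro real_sqrt_le_mono) auto
      finally show ?thesis using k by simp
    qed
    then show "\<exists>no. \<forall>n\<ge>no. dist (X n) (abs_L2 g) < e" by blast
  qed
  then show "convergent X" by (rule convergentI)
qed


instance L2 :: (euclidean_space) banach ..

lemma square_integrable_indicator:
  assumes "A \<in> sets borel" "emeasure lborel A < \<infinity>"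
  shows "square_integrable lborel (indicat_real A)"
proof -
  have "(\<lambda>x. (indicat_real A x)\<^sup>2) = indicat_real A" by (auto simp: indicator_def)
  then show ?thesis
    using assms integrable_real_indicator[of A lborel] by (simp add: square_integrable_def)
qed

lemma abs_L2_add:
  assumes "square_integrable lborel f" "square_integrable lborel g"
  shows "abs_L2 (\<lambda>x. f x + g x) = abs_L2 f + abs_L2 g"
  using assms by (intro plus_L2.abs_eq[symmetric]) (auto simp: L2_rel_refl)

lemma abs_L2_scale:
  assumes "square_integrable lborel f"
  shows "abs_L2 (\<lambda>x. c * f x) = c *\<^sub>R abs_L2 f"
  using assms by (intro scaleR_L2.abs_eq[symmetric]) (auto simp: L2_rel_refl)

lemma closure_span_scale:
  fixes C :: "'a::real_normed_vector set"
  assumes "x \<in> closure (span C)"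
  shows "c *\<^sub>R x \<in> closure (span C)"
proof -
  obtain f where "\<And>n::nat. f n \<in> span C" "f \<longlonglongrightarrow> x"
    using assms unfolding closure_sequential by blast
  then show ?thesis
    unfolding closure_sequential
    by (intro exI[of _ "\<lambda>n. c *\<^sub>R f n"]) (intro conjI allI span_scale tendsto_scaleR tendsto_const)
qed

lemma closure_span_add:
  fixes C :: "'a::real_normed_vector set"
  assumes "x \<in> closure (span C)" "y \<in> closure (span C)"
  shows "x + y \<in> closure (span C)"
proof -
  obtain f g where "\<And>n::nat. f n \<in> span C" "f \<longlonglongrightarrow> x" "\<And>n::nat. g n \<in> span C" "g \<longlonglongrightarrow> y"
    using assms unfolding closure_sequential by blast
  then show ?thesis
    unfolding closure_sequential
    by (intro exI[of _ "\<lambda>n. f n + g n"]) (intro conjI allI span_add tendsto_add)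
qed

lemma L2_indicator_approx:
  fixes B :: "'a::euclidean_space set set"
  assumes B: "countable B" "topological_basis B"
    and A: "A \<in> sets borel" "emeasure lborel A < \<infinity>" and e: "0 < e"
  shows "\<exists>F. finite F \<and> F \<subseteq> B \<and> emeasure lborel (\<Union>F) < \<infinity> \<and>
    dist (abs_L2 (indicat_real (\<Union>F))) (abs_L2 (indicat_real A)) < e"
proof -
  define d where "d = e\<^sup>2 / 2"
  have d: "0 < d" using e by (simp add: d_def)
  obtain U where U: "open U" "A \<subseteq> U" "emeasure lborel (U - A) < d"
    using outer_regular_lborel[OF A(1) d] by blast
  have [measurable]: "U \<in> sets borel" "A \<in> sets borel" using U(1) A(1) by auto
  have "A \<union> (U - A) = U" using U(2) by blast
  then have "emeasure lborel U = emeasure lborel A + emeasure lborel (U - A)"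
    using plus_emeasure[of A lborel "U - A"] by simp
  also have "\<dots> < \<infinity>"
    using A(2) less_trans[OF U(3) ennreal_less_top] by simp
  finally have U_fin: "emeasure lborel U < \<infinity>" .
  have "\<exists>B'\<subseteq>B. \<Union>B' = U"
    using B(2) U(1) unfolding topological_basis_def by simp
  then obtain B' where B': "B' \<subseteq> B" "\<Union>B' = U"
    by (elim exE conjE)
  have B'_open: "open b" if "b \<in> B'" for b
    using that B' topological_basis_open[OF B(2)] by auto
  define F where "F n = {b \<in> B'. to_nat_on B' b \<le> n}" for n
  have F_fin: "finite (F n)" for n
  proof (rule finite_imageD)
    show "finite (to_nat_on B' ` F n)" by (rule finite_subset[of _ "{..n}"]) (auto simp: F_def)
    show "inj_on (to_nat_on B') (F n)"
      using inj_on_to_nat_on[OF countable_subset[OF B'(1) B(1)]] by (rule inj_on_subset) (auto simp: F_def)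
  qed
  have F_sub: "F n \<subseteq> B'" for n by (auto simp: F_def)
  have V_open: "open (\<Union>(F n))" for n
    using F_sub B'_open by (intro open_Union) auto
  then have V_meas [measurable]: "\<Union>(F n) \<in> sets borel" for n by auto
  have V_sub: "\<Union>(F n) \<subseteq> U" for n using F_sub B'(2) by auto
  have "(\<lambda>n. measure lborel (U - \<Union>(F n))) \<longlonglongrightarrow> measure lborel (\<Inter>n. U - \<Union>(F n))"
  proof (rule Lim_measure_decseq)
    show "range (\<lambda>n. U - \<Union>(F n)) \<subseteq> sets lborel" by auto
    show "decseq (\<lambda>n. U - \<Union>(F n))"
    proof (rule antimonoI)
      fix m n :: nat assume "m \<le> n"
      then have "F m \<subseteq> F n" by (auto simp: F_def)
      then show "U - \<Union>(F n) \<subseteq> U - \<Union>(F m)" by blast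
    qed
    show "emeasure lborel (U - \<Union>(F n)) \<noteq> \<infinity>" for n
      using le_less_trans[OF emeasure_mono U_fin, of "U - \<Union>(F n)"] by auto
  qed
  moreover have "(\<Inter>n. U - \<Union>(F n)) = {}"
    using B'(2) by (auto simp: F_def)
  ultimately have "(\<lambda>n. measure lborel (U - \<Union>(F n))) \<longlonglongrightarrow> 0"
    by (simp only: measure_empty)
  then have "eventually (\<lambda>n. measure lborel (U - \<Union>(F n)) < d) sequentially"
    using d by (rule order_tendstoD)
  then obtain n where n: "measure lborel (U - \<Union>(F n)) < d"
    using eventually_happens' sequentially_bot by blast
  define V where "V = \<Union>(F n)"
  have [measurable]: "V \<in> sets borel" by (simp add: V_def)
  have VU: "V \<subseteq> U" using V_sub by (simp add: V_def)
  have V_fin: "emeasure lborel V < \<infinity>"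
    using le_less_trans[OF emeasure_mono[OF VU] U_fin] by simp
  have fin: "emeasure lborel (U - A) < \<infinity>" "emeasure lborel (U - V) < \<infinity>"
    using le_less_trans[OF emeasure_mono U_fin, of "U - A"]
      le_less_trans[OF emeasure_mono U_fin, of "U - V"] by auto
  have mA: "measure lborel (U - A) < d"
    using U(3) fin(1) d by (simp add: emeasure_eq_ennreal_measure ennreal_less_iff)
  note sqV = square_integrable_indicator[OF _ V_fin, simplified]
  note sqA = square_integrable_indicator[OF A]
  have "(\<integral>x. (indicat_real V x - indicat_real A x)\<^sup>2 \<partial>lborel) 
      \<le> (\<integral>x. indicat_real (U - A) x + indicat_real (U - V) x \<partial>lborel)"
  proof (rule integral_mono)
    show "integrable lborel (\<lambda>x. (indicat_real V x - indicat_real A x)\<^sup>2)"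
      using square_integrable_diff[OF sqV sqA] by (simp add: square_integrable_def)
    show "integrable lborel (\<lambda>x. indicat_real (U - A) x + indicat_real (U - V) x)"
      using fin by (intro Bochner_Integration.integrable_add integrable_real_indicator) auto
    show "(indicat_real V x - indicat_real A x)\<^sup>2 \<le> indicat_real (U - A) x + indicat_real (U - V) x" for x
      using VU U(2) by (auto simp: indicator_def)
  qed
  also have "\<dots> = measure lborel (U - A) + measure lborel (U - V)"
    using fin by (subst Bochner_Integration.integral_add) auto
  also have "\<dots> < e\<^sup>2"
    using mA n unfolding V_def d_def by linarith
  finally have "sqrt (\<integral>x. (indicat_real V x - indicat_real A x)\<^sup>2 \<partial>lborel) < e"
    using e by (intro real_less_lsqrt) auto
  then have "dist (abs_L2 (indicat_real V)) (abs_L2 (indicat_real A)) < e"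
    by (simp add: dist_abs_L2[OF sqV sqA])
  moreover have "F n \<subseteq> B" using F_sub[of n] B'(1) by (rule subset_trans)
  ultimately show ?thesis
    using F_fin[of n] V_fin unfolding V_def by (intro exI[of _ "F n"] conjI)
qed

lemma L2_closure_span:
  fixes C :: "'a::euclidean_space L2 set"
  assumes ind: "\<And>A. A \<in> sets borel \<Longrightarrow> emeasure lborel A < \<infinity> \<Longrightarrow> abs_L2 (indicat_real A) \<in> closure (span C)"
  shows "closure (span C) = UNIV"
proof (intro equalityI subset_UNIV subsetI)
  fix u :: "'a L2"
  have simple: "square_integrable lborel (\<lambda>x. \<Sum>y\<in>Y. y * indicat_real (A y) x) \<and>
      abs_L2 (\<lambda>x. \<Sum>y\<in>Y. y * indicat_real (A y) x) \<in> closure (span C)"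
    if "finite Y" "\<And>y. y \<in> Y \<Longrightarrow> A y \<in> sets borel \<and> emeasure lborel (A y) < \<infinity>" 
    for Y :: "real set" and A :: "real \<Rightarrow> 'a set"
    using that
  proof (induction Y rule: finite_induct)
    case empty
    have "abs_L2 (\<lambda>x::'a. 0) = 0" by (simp add: zero_L2_def)
    then show ?case
      using span_zero[of C] closure_subset[of "span C"] by (auto simp: square_integrable_zero)
  next
    case (insert y Y)
    have sq: "square_integrable lborel (\<lambda>x. y * indicat_real (A y) x)"
      using insert.prems[of y] by (intro square_integrable_scale square_integrable_indicator) auto
    have "abs_L2 (\<lambda>x. y * indicat_real (A y) x) = y *\<^sub>R abs_L2 (indicat_real (A y))"
      using insert.prems[of y] by (intro abs_L2_scale square_integrable_indicator) auto
    then have "abs_L2 (\<lambda>x. y * indicat_real (A y) x) \<in> closure (span C)"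
      using ind[of "A y"] insert.prems[of y] by (auto intro: closure_span_scale)
    moreover have "square_integrable lborel (\<lambda>x. \<Sum>y\<in>Y. y * indicat_real (A y) x)"
      "abs_L2 (\<lambda>x. \<Sum>y\<in>Y. y * indicat_real (A y) x) \<in> closure (span C)"
      using insert.IH insert.prems by blast+
    moreover have "(\<lambda>x. \<Sum>y\<in>insert y Y. y * indicat_real (A y) x) =
        (\<lambda>x. y * indicat_real (A y) x + (\<Sum>y\<in>Y. y * indicat_real (A y) x))"
      using insert.hyps by (subst sum.insert) auto
    ultimately show ?case
      using sq by (simp only: abs_L2_add square_integrable_add closure_span_add simp_thms)
  qed
  define f where "f = rep_L2 u"
  have sq: "square_integrable lborel f" unfolding f_def by (rule rep_L2_sq)
  then have [measurable]: "f \<in> borel_measurable borel" by (simp add: square_integrable_def)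
  obtain s where s: "\<And>i. simple_function lborel (s i)" "\<And>x. (\<lambda>i. s i x) \<longlonglongrightarrow> f x"
    "\<And>i x. \<bar>s i x\<bar> \<le> 2 * \<bar>f x\<bar>"
    using borel_measurable_implies_sequence_metric[of f lborel 0]
    by (simp add: space_lborel) metis
  have s_meas [measurable]: "s i \<in> borel_measurable borel" for i
    using borel_measurable_simple_function[OF s(1)[of i]] by simp
  have s_le: "(s i x)\<^sup>2 \<le> 4 * (f x)\<^sup>2" for i x
  proof -
    have "\<bar>s i x\<bar>\<^sup>2 \<le> (2 * \<bar>f x\<bar>)\<^sup>2" using s(3) by (intro power_mono) auto
    then show ?thesis by (simp add: power_mult_distrib)
  qed
  have s_sq: "square_integrable lborel (s i)" for i
    unfolding square_integrable_def
  proof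
    show "s i \<in> borel_measurable lborel" by simp
    show "integrable lborel (\<lambda>x. (s i x)\<^sup>2)"
    proof (rule Bochner_Integration.integrable_bound)
      show "integrable lborel (\<lambda>x. 4 * (f x)\<^sup>2)" using sq by (simp add: square_integrable_def)
      show "AE x in lborel. norm ((s i x)\<^sup>2) \<le> norm (4 * (f x)\<^sup>2)"
        using s_le[of i] by (intro AE_I2) simp
    qed simp
  qed
  have s_in: "abs_L2 (s i) \<in> closure (span C)" for i
  proof -
    define Y where "Y = s i ` UNIV - {0}"
    define A where "A y = s i -` {y}" for y
    have Y_fin: "finite Y" using s(1)[of i] by (simp add: Y_def simple_function_def)
    have A_meas: "A y \<in> sets borel" for y
      using measurable_sets[OF s_meas[of i], of "{y}"] by (simp add: A_def)
    have "s i = (\<lambda>x. \<Sum>y\<in>Y. y * indicat_real (A y) x)"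
    proof
      fix x
      have "(\<Sum>y\<in>Y. y * indicat_real (A y) x) = (\<Sum>y\<in>Y. if y = s i x then y else 0)"
        by (intro sum.cong) (auto simp: A_def)
      also have "\<dots> = s i x" using Y_fin by (auto simp: Y_def)
      finally show "s i x = (\<Sum>y\<in>Y. y * indicat_real (A y) x)" by simp
    qed
    moreover have "emeasure lborel (A y) < \<infinity>" if "y \<in> Y" for y
    proof -
      have "integrable lborel (\<lambda>x. (1 / y\<^sup>2) * (s i x)\<^sup>2)"
        using s_sq[of i] by (auto simp: square_integrable_def)
      moreover have "(1 / y\<^sup>2) * (s i x)\<^sup>2 \<ge> indicat_real (A y) x" for x
        using that by (auto simp: A_def Y_def indicator_def)
      ultimately have "integrable lborel (indicat_real (A y))"
        using A_meas[of y] by (elim Bochner_Integration.integrable_bound) auto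
      then show ?thesis using A_meas[of y] by (simp add: integrable_indicator_iff)
    qed
    ultimately show ?thesis
      using simple[OF Y_fin, of A] A_meas by simp
  qed
  have "(\<lambda>i. \<integral>x. (s i x - f x)\<^sup>2 \<partial>lborel) \<longlonglongrightarrow> integral\<^sup>L lborel (\<lambda>x::'a. 0 :: real)"
  proof (rule integral_dominated_convergence)
    show "integrable lborel (\<lambda>x. 10 * (f x)\<^sup>2)" using sq by (simp add: square_integrable_def)
    show "AE x in lborel. (\<lambda>i. (s i x - f x)\<^sup>2) \<longlonglongrightarrow> 0"
    proof (rule AE_I2)
      fix x
      have "(\<lambda>i. (s i x - f x)\<^sup>2) \<longlonglongrightarrow> (f x - f x)\<^sup>2"
        using s(2)[of x] by (intro tendsto_intros)
      then show "(\<lambda>i. (s i x - f x)\<^sup>2) \<longlonglongrightarrow> 0" by simp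
    qed
    show "AE x in lborel. norm ((s i x - f x)\<^sup>2) \<le> 10 * (f x)\<^sup>2" for i
    proof (rule AE_I2)
      fix x
      have "(s i x - f x)\<^sup>2 \<le> 2 * (s i x)\<^sup>2 + 2 * (f x)\<^sup>2"
        using zero_le_power2[of "s i x + f x"] by (simp add: power2_eq_square algebra_simps)
      also have "\<dots> \<le> 10 * (f x)\<^sup>2" using s_le[of i x] by simp
      finally show "norm ((s i x - f x)\<^sup>2) \<le> 10 * (f x)\<^sup>2" by simp
    qed
  qed auto
  then have "(\<lambda>i. sqrt (\<integral>x. (s i x - f x)\<^sup>2 \<partial>lborel)) \<longlonglongrightarrow> sqrt 0"
    by (intro tendsto_real_sqrt) simp
  then have "(\<lambda>i. dist (abs_L2 (s i)) (abs_L2 f)) \<longlonglongrightarrow> 0"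
    by (simp add: dist_abs_L2[OF s_sq sq])
  then have "(\<lambda>i. abs_L2 (s i)) \<longlonglongrightarrow> abs_L2 f"
    by (rule iffD2[OF tendsto_dist_iff])
  from Lim_in_closed_set[OF closed_closure _ sequentially_bot this] s_in
  show "u \<in> closure (span C)" by (simp add: f_def abs_rep_L2)
qed

lemma countable_span_dense:
  fixes C :: "'a::real_normed_vector set"
  assumes "countable C"
  shows "\<exists>Q. countable Q \<and> span C \<subseteq> closure Q"
proof -
  define h :: "(rat \<times> 'a) list \<Rightarrow> 'a" where
    "h l = sum_list (map (\<lambda>(q, c). of_rat q *\<^sub>R c) l)" for l
  define Q where "Q = h ` lists (UNIV \<times> C)"
  have "countable Q" unfolding Q_def using assms by (intro countable_image countable_lists countable_SIGMA) auto
  have Q_add: "x + y \<in> Q" if xy: "x \<in> Q" "y \<in> Q" for x y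
  proof -
    obtain l l' where l: "l \<in> lists (UNIV \<times> C)" "l' \<in> lists (UNIV \<times> C)" "x = h l" "y = h l'"
      using xy by (auto simp: Q_def)
    then have "x + y = h (l @ l')" "l @ l' \<in> lists (UNIV \<times> C)" by (auto simp: h_def)
    then show ?thesis unfolding Q_def by blast
  qed
  have Q_C: "of_rat q *\<^sub>R c \<in> Q" if "c \<in> C" for q c
  proof -
    have "h [(q, c)] = of_rat q *\<^sub>R c" "[(q, c)] \<in> lists (UNIV \<times> C)" using that by (auto simp: h_def)
    then show ?thesis unfolding Q_def by (metis imageI)
  qed
  have cl_add: "x + y \<in> closure Q" if xy: "x \<in> closure Q" "y \<in> closure Q" for x y
  proof -
    obtain f g where "\<And>n::nat. f n \<in> Q" "f \<longlonglongrightarrow> x" "\<And>n::nat. g n \<in> Q" "g \<longlonglongrightarrow> y"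
      using xy unfolding closure_sequential by blast
    then show ?thesis
      unfolding closure_sequential
      by (intro exI[of _ "\<lambda>n. f n + g n"]) (intro conjI allI Q_add tendsto_add)
  qed
  have cl_C: "r *\<^sub>R c \<in> closure Q" if "c \<in> C" for r c
  proof -
    have "r \<in> closure \<rat>" by (simp add: Rats_closure_real)
    then obtain f where f: "\<And>n::nat. f n \<in> \<rat>" "f \<longlonglongrightarrow> r"
      unfolding closure_sequential by metis
    have "f n *\<^sub>R c \<in> Q" for n using f(1)[of n] Q_C[OF that] by (metis Rats_cases)
    moreover have "(\<lambda>n. f n *\<^sub>R c) \<longlonglongrightarrow> r *\<^sub>R c" using f(2) by (intro tendsto_intros)
    ultimately show ?thesis unfolding closure_sequential by (intro exI[of _ "\<lambda>n. f n *\<^sub>R c"]) auto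
  qed
  have zero: "0 \<in> closure Q"
    using closure_subset[of Q] by (force simp: Q_def h_def intro!: image_eqI[of _ _ "[]"])
  have "x \<in> closure Q" if "x \<in> span C" for x
    using that
  proof (induction rule: span_induct_alt)
    case base show ?case by (rule zero)
  next
    case (step r c y) then show ?case by (intro cl_add cl_C) 
  qed
  with \<open>countable Q\<close> show ?thesis by blast
qed

instance L2 :: (euclidean_space) second_countable_topology
proof
  obtain B :: "'a set set" where B: "countable B" "topological_basis B"
    using ex_countable_basis by auto
  define C where "C = (\<lambda>F. abs_L2 (indicat_real (\<Union>F))) ` {F. finite F \<and> F \<subseteq> B}"
  have "countable C" unfolding C_def using B(1)
    by (intro countable_image countable_Collect_finite_subset)
  then obtain Q where Q: "countable Q" "span C \<subseteq> closure Q"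
    using countable_span_dense by metis
  have "closure (span C) = UNIV"
  proof (rule L2_closure_span)
    fix A :: "'a set" assume A: "A \<in> sets borel" "emeasure lborel A < \<infinity>"
    show "abs_L2 (indicat_real A) \<in> closure (span C)"
      unfolding closure_approachable
    proof (intro allI impI)
      fix e :: real assume "0 < e"
      from L2_indicator_approx[OF B A this] 
      show "\<exists>y\<in>span C. dist y (abs_L2 (indicat_real A)) < e"
        by (auto simp: C_def intro!: bexI span_base)
    qed
  qed
  then have Q_dense: "closure Q = UNIV"
    using closure_mono[OF Q(2)] by auto
  define \<B> where "\<B> = (\<lambda>(q, n::nat). ball q (inverse (Suc n))) ` (Q \<times> UNIV)"
  have "topological_basis \<B>"
  proof (rule topological_basisI)
    show "open b" if "b \<in> \<B>" for b using that by (auto simp: \<B>_def)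
    fix U :: "'a L2 set" and x assume "open U" "x \<in> U"
    then obtain e where e: "0 < e" "ball x e \<subseteq> U" by (auto simp: open_contains_ball)
    obtain n where n: "inverse (Suc n) < e / 2" using reals_Archimedean[of "e/2"] e by auto
    have "x \<in> closure Q" by (simp add: Q_dense)
    then obtain q where q: "q \<in> Q" "dist q x < inverse (Suc n)"
      unfolding closure_approachable by (metis inverse_positive_iff_positive of_nat_0_less_iff zero_less_Suc)
    have "ball q (inverse (Suc n)) \<subseteq> ball x e"
    proof
      fix y assume "y \<in> ball q (inverse (Suc n))"
      then show "y \<in> ball x e" using dist_triangle[of x y q] n q(2) by (simp add: dist_commute)
    qed
    then show "\<exists>b\<in>\<B>. x \<in> b \<and> b \<subseteq> U"
      using q e by (intro bexI[of _ "ball q (inverse (Suc n))"]) (auto simp: \<B>_def)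
  qed
  then have "open = generate_topology \<B>" by (rule topological_basis_imp_subbasis)
  moreover have "countable \<B>"  unfolding \<B>_def using Q(1) by auto
  ultimately show "\<exists>B::'a L2 set set. countable B \<and> open = generate_topology B"
    by blast
qed

text \<open>The sort constraint \<^class>\<open>metric_space\<close> is needed because the library's first-countability
  instance for vectors goes through metric spaces. Together with completeness, separability makes the
  library's Bochner integral available for square-integrable functions, their products and vectors.\<close>

instance vec :: ("{metric_space, second_countable_topology}", finite) second_countable_topology
proof
  obtain B :: "'a set set" where B: "countable B" "topological_basis B"
    using ex_countable_basis by auto
  define \<B> :: "('a ^ 'b) set set" where
    "\<B> = (\<lambda>A. {x. \<forall>i. x $ i \<in> A i}) ` (\<Pi>\<^sub>E i\<in>UNIV. B)"
  have "topological_basis \<B>"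
  proof (rule topological_basisI)
    show "open b" if "b \<in> \<B>" for b 
      using that topological_basis_open[OF B(2)] by (auto simp: \<B>_def intro!: open_vector_box)
    fix U :: "('a ^ 'b) set" and x assume "open U" "x \<in> U"
    then have "\<exists>A. (\<forall>i. open (A i) \<and> x $ i \<in> A i) \<and> (\<forall>y. (\<forall>i. y $ i \<in> A i) \<longrightarrow> y \<in> U)"
      unfolding open_vec_def by (rule bspec)
    then obtain A where A: "\<And>i. open (A i)" "\<And>i. x $ i \<in> A i" "\<And>y. (\<forall>i. y $ i \<in> A i) \<Longrightarrow> y \<in> U"
      by blast
    have "\<forall>i. \<exists>b. b \<in> B \<and> x $ i \<in> b \<and> b \<subseteq> A i"
      using topological_basisE[OF B(2) A(1) A(2)] by blast
    from choice[OF this] obtain b where b: "\<And>i. b i \<in> B" "\<And>i. x $ i \<in> b i" "\<And>i. b i \<subseteq> A i"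
      by blast
    have "{x. \<forall>i. x $ i \<in> b i} \<in> \<B>" unfolding \<B>_def using b(1) by (intro imageI) auto
    moreover have "x \<in> {x. \<forall>i. x $ i \<in> b i}" using b(2) by simp
    moreover have "{x. \<forall>i. x $ i \<in> b i} \<subseteq> U"
    proof
      fix y assume "y \<in> {x. \<forall>i. x $ i \<in> b i}"
      then have "y $ i \<in> A i" for i using b(3)[of i] by auto
      then show "y \<in> U" by (intro A(3)) simp
    qed
    ultimately show "\<exists>V\<in>\<B>. x \<in> V \<and> V \<subseteq> U"
      by (intro bexI[of _ "{x. \<forall>i. x $ i \<in> b i}"] conjI)
  qed
  then have "open = generate_topology \<B>" by (rule topological_basis_imp_subbasis)
  moreover have "countable \<B>"  unfolding \<B>_def using B(1) by (intro countable_image countable_PiE) auto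
  ultimately show "\<exists>B::('a ^ 'b) set set. countable B \<and> open = generate_topology B"
    by blast
qed


section \<open>Sobolev spaces on a planar domain\<close>

type_synonym plane = "real^2"

definition partial_deriv :: "2 \<Rightarrow> (plane \<Rightarrow> real) \<Rightarrow> plane \<Rightarrow> real" where
  "partial_deriv j \<phi> x = frechet_derivative \<phi> (at x) (axis j 1)"

primrec C_k :: "nat \<Rightarrow> (plane \<Rightarrow> real) \<Rightarrow> bool" where
  "C_k 0 \<phi> \<longleftrightarrow> continuous_on UNIV \<phi>"
| "C_k (Suc k) \<phi> \<longleftrightarrow> (\<forall>x. \<phi> differentiable (at x)) \<and> (\<forall>j. C_k k (partial_deriv j \<phi>))"

definition test_functions :: "plane set \<Rightarrow> (plane \<Rightarrow> real) set" where
  "test_functions G = {\<phi>. (\<forall>k. C_k k \<phi>) \<and>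
     compact (closure {x. \<phi> x \<noteq> 0}) \<and> closure {x. \<phi> x \<noteq> 0} \<subseteq> G}"

text \<open>An element \<open>(g, D)\<close> of the following type stands for a function \<open>g\<close>, extended by zero outside the
  domain, together with its two first-order partial derivatives \<open>D $ 1\<close> and \<open>D $ 2\<close>.\<close>

type_synonym sobolev = "plane L2 \<times> ((plane L2)^2)"
type_synonym sobolev_field = "sobolev^2"

definition sobolev_of :: "(plane \<Rightarrow> real) \<Rightarrow> sobolev" where
  "sobolev_of \<phi> = (abs_L2 \<phi>, \<chi> j. abs_L2 (partial_deriv j \<phi>))"

definition value_at :: "sobolev \<Rightarrow> plane \<Rightarrow> real" where
  "value_at g = rep_L2 (fst g)"

definition deriv_at :: "2 \<Rightarrow> sobolev \<Rightarrow> plane \<Rightarrow> real" where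
  "deriv_at j g = rep_L2 (snd g $ j)"

text \<open>The closure below is taken for the norm of the function and its gradient in \<open>L\<^sub>2\<close>. For bounded \<open>G\<close> the
  Poincare inequality makes this norm equivalent on test functions to the norm of the gradient alone, so
  that the closure is the completion of the test functions in the latter norm.\<close>

definition H10 :: "plane set \<Rightarrow> sobolev set" where
  "H10 G = closure (sobolev_of ` test_functions G)"

definition H10_field :: "plane set \<Rightarrow> sobolev_field set" where
  "H10_field G = {u. \<forall>i. u $ i \<in> H10 G}"

definition solenoidal_test_fields :: "plane set \<Rightarrow> sobolev_field set" where
  "solenoidal_test_fields G = {(\<chi> i. sobolev_of (\<phi> i)) | \<phi> :: 2 \<Rightarrow> plane \<Rightarrow> real.
     (\<forall>i. \<phi> i \<in> test_functions G) \<and> (\<forall>x. (\<Sum>i\<in>UNIV. partial_deriv i (\<phi> i) x) = 0)}"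

definition H10_solenoidal :: "plane set \<Rightarrow> sobolev_field set" where
  "H10_solenoidal G = closure (solenoidal_test_fields G)"

definition grad_norm :: "plane set \<Rightarrow> sobolev \<Rightarrow> real" where
  "grad_norm G g = sqrt (\<integral>x\<in>G. (\<Sum>j\<in>UNIV. (deriv_at j g x)\<^sup>2) \<partial>lborel)"

definition H1_norm :: "plane set \<Rightarrow> sobolev_field \<Rightarrow> real" where
  "H1_norm G g = sqrt (\<Sum>i\<in>UNIV. \<Sum>j\<in>UNIV. \<integral>x\<in>G. (deriv_at j (g $ i) x)\<^sup>2 \<partial>lborel)"

definition grad_inner :: "plane set \<Rightarrow> sobolev_field \<Rightarrow> sobolev_field \<Rightarrow> real" where
  "grad_inner G f g =
     (\<Sum>i\<in>UNIV. \<Sum>j\<in>UNIV. \<integral>x\<in>G. deriv_at j (f $ i) x * deriv_at j (g $ i) x \<partial>lborel)"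

definition trilinear :: "plane set \<Rightarrow> sobolev_field \<Rightarrow> sobolev_field \<Rightarrow> sobolev_field \<Rightarrow> real" where
  "trilinear G u v w = (\<integral>x\<in>G. (\<Sum>i\<in>UNIV. \<Sum>j\<in>UNIV.
     value_at (u $ j) x * deriv_at j (v $ i) x * value_at (w $ i) x) \<partial>lborel)"

text \<open>A functional is a function on the whole type; only its restriction to \<^term>\<open>H10_field G\<close> matters.\<close>

definition Hm1_field :: "plane set \<Rightarrow> (sobolev_field \<Rightarrow> real) set" where
  "Hm1_field G = {l.
     (\<forall>u\<in>H10_field G. \<forall>v\<in>H10_field G. l (u + v) = l u + l v) \<and>
     (\<forall>c. \<forall>u\<in>H10_field G. l (c *\<^sub>R u) = c * l u) \<and>
     (\<exists>C. \<forall>u\<in>H10_field G. \<bar>l u\<bar> \<le> C * H1_norm G u)}"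

definition dual_norm :: "plane set \<Rightarrow> (sobolev \<Rightarrow> real) \<Rightarrow> real" where
  "dual_norm G l = Sup {\<bar>l \<phi>\<bar> | \<phi>. \<phi> \<in> H10 G \<and> grad_norm G \<phi> \<le> 1}"

text \<open>The \<open>i\<close>-th component of a functional on vector fields is its restriction to the fields whose only
  nonzero component is the \<open>i\<close>-th.\<close>

definition Hm1_norm :: "plane set \<Rightarrow> (sobolev_field \<Rightarrow> real) \<Rightarrow> real" where
  "Hm1_norm G l = sqrt (\<Sum>i\<in>UNIV. (dual_norm G (\<lambda>\<phi>. l (axis i \<phi>)))\<^sup>2)"

definition lipschitz_boundary :: "plane set \<Rightarrow> bool" where
  "lipschitz_boundary G \<longleftrightarrow> (\<forall>z\<in>frontier G. \<exists>r>0. \<exists>(T :: plane \<Rightarrow> plane) (\<gamma> :: real \<Rightarrow> real) L.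
     orthogonal_transformation T \<and> L-lipschitz_on UNIV \<gamma> \<and>
     G \<inter> ball z r = {x \<in> ball z r. \<gamma> (T x $ 1) < T x $ 2})"

definition bounded_lipschitz_domain :: "plane set \<Rightarrow> bool" where
  "bounded_lipschitz_domain G \<longleftrightarrow>
     open G \<and> connected G \<and> G \<noteq> {} \<and> bounded G \<and> lipschitz_boundary G"


section \<open>Random elements and the projections\<close>

text \<open>Elements of \<open>L\<^sub>2(\<Omega>; H)\<close> are given by representatives with values in \<open>H\<close> everywhere, not just almost surely.
  This keeps the scalar random variables formed from them measurable when the probability space is
  not complete.\<close>

definition L2_H10_solenoidal :: "'w measure \<Rightarrow> plane set \<Rightarrow> ('w \<Rightarrow> sobolev_field) set" where
  "L2_H10_solenoidal M G = {u. u \<in> borel_measurable M \<and> (\<forall>\<omega>\<in>space M. u \<omega> \<in> H10_solenoidal G) \<and>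
     integrable M (\<lambda>\<omega>. (H1_norm G (u \<omega>))\<^sup>2)}"

text \<open>Strong measurability with respect to the dual norm.\<close>

definition Hm1_measurable :: "'w measure \<Rightarrow> plane set \<Rightarrow> ('w \<Rightarrow> sobolev_field \<Rightarrow> real) \<Rightarrow> bool" where
  "Hm1_measurable M G f \<longleftrightarrow> (\<exists>s :: nat \<Rightarrow> 'w \<Rightarrow> sobolev_field \<Rightarrow> real.
     (\<forall>n. simple_function M (s n) \<and> (\<forall>\<omega>\<in>space M. s n \<omega> \<in> Hm1_field G)) \<and>
     (\<forall>\<omega>\<in>space M. (\<lambda>n. Hm1_norm G (\<lambda>\<phi>. f \<omega> \<phi> - s n \<omega> \<phi>)) \<longlonglongrightarrow> 0))"

definition L2_Hm1 :: "'w measure \<Rightarrow> plane set \<Rightarrow> ('w \<Rightarrow> sobolev_field \<Rightarrow> real) set" where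
  "L2_Hm1 M G = {f. Hm1_measurable M G f \<and> (\<forall>\<omega>\<in>space M. f \<omega> \<in> Hm1_field G) \<and>
     integrable M (\<lambda>\<omega>. (Hm1_norm G (f \<omega>))\<^sup>2)}"

definition L2_H1_norm :: "'w measure \<Rightarrow> plane set \<Rightarrow> ('w \<Rightarrow> sobolev_field) \<Rightarrow> real" where
  "L2_H1_norm M G g = sqrt (\<integral>\<omega>. (H1_norm G (g \<omega>))\<^sup>2 \<partial>M)"

definition proj :: "'w measure \<Rightarrow> (nat \<Rightarrow> 'w \<Rightarrow> real) \<Rightarrow> nat \<Rightarrow>
    ('w \<Rightarrow> 'b::{banach, second_countable_topology}) \<Rightarrow> 'w \<Rightarrow> 'b" where
  "proj M P N X \<omega> =
     (\<Sum>k\<le>N. P k \<omega> *\<^sub>R ((\<integral>\<omega>'. P k \<omega>' *\<^sub>R X \<omega>' \<partial>M) /\<^sub>R (\<integral>\<omega>'. (P k \<omega>')\<^sup>2 \<partial>M)))"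

text \<open>For functionals the expectations defining the projection are evaluated against each argument.\<close>

definition proj_functional :: "'w measure \<Rightarrow> (nat \<Rightarrow> 'w \<Rightarrow> real) \<Rightarrow> nat \<Rightarrow>
    ('w \<Rightarrow> sobolev_field \<Rightarrow> real) \<Rightarrow> 'w \<Rightarrow> sobolev_field \<Rightarrow> real" where
  "proj_functional M P N f \<omega> = (\<lambda>\<phi>. proj M P N (\<lambda>\<omega>'. f \<omega>' \<phi>) \<omega>)"

definition chaos_basis :: "'w measure \<Rightarrow> (nat \<Rightarrow> 'w \<Rightarrow> real) \<Rightarrow> bool" where
  "chaos_basis M P \<longleftrightarrow>
     (\<forall>n. square_integrable M (P n)) \<and>
     (\<forall>n. (\<integral>\<omega>. (P n \<omega>)\<^sup>2 \<partial>M) \<noteq> 0) \<and>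
     (\<forall>m n. m \<noteq> n \<longrightarrow> (\<integral>\<omega>. P m \<omega> * P n \<omega> \<partial>M) = 0) \<and>
     (\<forall>X. square_integrable M X \<longrightarrow> (\<lambda>N. \<integral>\<omega>. (X \<omega> - proj M P N X \<omega>)\<^sup>2 \<partial>M) \<longlonglongrightarrow> 0) \<and>
     (\<forall>m n. \<exists>L c. finite L \<and> (AE \<omega> in M. P m \<omega> * P n \<omega> = (\<Sum>l\<in>L. c l * P l \<omega>)))"

definition proj_space :: "'w measure \<Rightarrow> (nat \<Rightarrow> 'w \<Rightarrow> real) \<Rightarrow> nat \<Rightarrow> plane set \<Rightarrow>
    ('w \<Rightarrow> sobolev_field) set" where
  "proj_space M P N G = {v. \<exists>c. (\<forall>k\<le>N. c k \<in> H10_solenoidal G) \<and>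
     (\<forall>\<omega>\<in>space M. v \<omega> = (\<Sum>k\<le>N. P k \<omega> *\<^sub>R c k))}"


section \<open>Solutions\<close>

definition NS_solution :: "'w measure \<Rightarrow> plane set \<Rightarrow> real \<Rightarrow>
    ('w \<Rightarrow> sobolev_field \<Rightarrow> real) \<Rightarrow> ('w \<Rightarrow> sobolev_field) \<Rightarrow> bool" where
  "NS_solution M G \<nu> f u \<longleftrightarrow> u \<in> L2_H10_solenoidal M G \<and>
     (\<forall>\<phi>\<in>solenoidal_test_fields G. AE \<omega> in M.
        \<nu> * grad_inner G (u \<omega>) \<phi> + trilinear G (u \<omega>) (u \<omega>) \<phi> = - f \<omega> \<phi>)"

definition Galerkin_solution :: "'w measure \<Rightarrow> (nat \<Rightarrow> 'w \<Rightarrow> real) \<Rightarrow> nat \<Rightarrow> plane set \<Rightarrow> real \<Rightarrow>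
    ('w \<Rightarrow> sobolev_field \<Rightarrow> real) \<Rightarrow> ('w \<Rightarrow> sobolev_field) \<Rightarrow> bool" where
  "Galerkin_solution M P N G \<nu> f v \<longleftrightarrow> v \<in> proj_space M P N G \<and>
     (\<forall>\<phi>\<in>solenoidal_test_fields G. AE \<omega> in M.
        \<nu> * grad_inner G (v \<omega>) \<phi> + proj M P N (\<lambda>\<omega>'. trilinear G (v \<omega>') (v \<omega>') \<phi>) \<omega>
          = - proj_functional M P N f \<omega> \<phi>)"

end

theory Submission
  imports Defs
begin

text \<open>Write \<open>r = u - P\<^sup>N u\<close> and \<open>w = P\<^sup>N u - v\<^sub>N\<close>, so that \<open>u - v\<^sub>N = r + w\<close>. Tested with \<open>w\<close>, which lies in the Galerkin
  space, the two equations lose their forcing terms on subtraction, and since \<open>a(x, w, w) = 0\<close> for solenoidal \<open>x\<close>,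
  \<open>\<nu> E|w|\<^sup>2 = - E[a(u, r, w) + a(r, v\<^sub>N, w) + a(w, v\<^sub>N, w)]\<close>; here \<open>E(\<nabla>r, \<nabla>w) = 0\<close> because \<open>r\<close> is orthogonal to the
  first \<open>N + 1\<close> basis elements. With \<open>|a(x, y, z)| \<le> (sqrt |G| / 2) |x| |y| |z|\<close>, the energy bound on \<open>u\<close> and the assumed
  bound on \<open>v\<^sub>N\<close>, the right-hand side is at most \<open>\<nu>(\<theta> + 1 - \<epsilon>) E|r||w| + \<nu>(1 - \<epsilon>) E|w|\<^sup>2\<close>, and the first estimate follows by
  absorption and the Cauchy-Schwarz inequality. The inequality \<open>4 \<integral>\<psi>\<^sup>2 \<le> \<integral>|\<partial>\<^sub>1\<psi>| \<integral>|\<partial>\<^sub>2\<psi>|\<close> on the plane, applied to a test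
  function and to its square, yields the bound on \<open>a\<close>, even with \<open>sqrt |G| / 4\<close>.\<close>

section \<open>Inequalities for test functions on the plane\<close>

text \<open>The null set off which an equation holds depends on the test field, while
  \<open>w\<close> is random, so \<open>w\<close> cannot simply be inserted. Instead each equation,
  for a fixed field, is multiplied by \<open>P k\<close> and integrated. For \<open>k <= N\<close>
  the projection disappears, both left-hand sides have the same moment, coming from the forcing, and
  equality of moments extends from test fields to their closure by continuity. Since
  \<open>w\<close> is a finite sum of the \<open>P k\<close> times fixed fields, summing these
  identities amounts to testing with \<open>w\<close>. The almost sure bounds on \<open>u\<close>
  and \<open>v\<close> already matter here: they make the quadratic terms grow only linearly in the
  gradient norms, so that products with \<open>P k\<close> are integrable. The energy bound on
  \<open>u\<close> is pathwise and rests on a countable dense family of test fields, which leaves a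
  single null set. With \<open>sqrt |G| / 2\<close> as the constant of \<open>a\<close>, advection
  by \<open>u\<close> costs \<nu> \<theta> and a factor \<open>v\<close> costs \<nu> (1 -
  \<epsilon>), so that absorption leaves exactly \<nu> \<epsilon>. The nonlinear difference is split
  so that the term quadratic in \<open>w\<close> contains \<open>v\<close>: this is the term to be
  absorbed.\<close>

definition plane_point :: "real \<Rightarrow> real \<Rightarrow> plane" where
  "plane_point s t = s *\<^sub>R axis 1 1 + t *\<^sub>R axis 2 1"

lemma plane_point_nth [simp]: "plane_point s t $ 1 = s" "plane_point s t $ 2 = t"
  by (simp_all add: plane_point_def axis_def)

lemma continuous_plane_point: "continuous_on UNIV (\<lambda>(s, t). plane_point s t)"
  unfolding plane_point_def case_prod_beta by (intro continuous_intros)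

lemma measurable_plane_point [measurable]: "(\<lambda>p. plane_point (fst p) (snd p)) \<in> borel \<rightarrow>\<^sub>M borel"
  using borel_measurable_continuous_onI[OF continuous_plane_point] by (simp add: case_prod_unfold)

text \<open>\<open>lborel\<close> is determined by the volumes of open boxes, and the preimage of a
  box of \<open>real^2\<close> is a box of the product type. This opens Tonelli's and Fubini's
  theorems for integrals over \<open>plane\<close>.\<close>

lemma lborel_plane: "(lborel :: plane measure) = distr lborel borel (\<lambda>p. plane_point (fst p) (snd p))"
proof (rule lborel_eqI)
  fix l u :: plane assume lu: "\<And>b. b \<in> Basis \<Longrightarrow> l \<bullet> b \<le> u \<bullet> b"
  have le: "l $ i \<le> u $ i" for i
    using lu[of "axis i 1"] by (simp add: inner_axis axis_in_Basis_iff)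
  have vimage: "(\<lambda>p. plane_point (fst p) (snd p)) -` box l u = box (l $ 1, l $ 2) (u $ 1, u $ 2)"
    by (auto simp: box_def mem_box_cart forall_2 Basis_prod_def inner_prod_def Basis_vec_def inner_axis)
  have "emeasure (distr lborel borel (\<lambda>p. plane_point (fst p) (snd p))) (box l u)
      = emeasure lborel (box (l $ 1, l $ 2) (u $ 1, u $ 2))"
    by (subst emeasure_distr) (auto simp: vimage)
  also have "\<dots> = ennreal ((u $ 1 - l $ 1) * (u $ 2 - l $ 2))"
    using le by (subst emeasure_lborel_box) (auto simp: Basis_prod_def prod.union_disjoint)
  also have "(u $ 1 - l $ 1) * (u $ 2 - l $ 2) = (\<Prod>b\<in>Basis. (u - l) \<bullet> b)"
  proof -
    have Basis: "(Basis :: plane set) = {axis 1 1, axis 2 1}"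
      by (auto simp: Basis_vec_def) (metis exhaust_2)
    have "axis 1 1 \<noteq> (axis 2 1 :: plane)" by (simp add: axis_eq_axis)
    then show ?thesis unfolding Basis by (simp add: inner_axis)
  qed
  finally show "emeasure (distr lborel borel (\<lambda>p. plane_point (fst p) (snd p))) (box l u)
      = ennreal (\<Prod>b\<in>Basis. (u - l) \<bullet> b)" .
qed simp

lemma nn_integral_plane:
  assumes [measurable]: "F \<in> borel_measurable borel"
  shows "(\<integral>\<^sup>+x. F x \<partial>lborel) = (\<integral>\<^sup>+s. \<integral>\<^sup>+t. F (plane_point s t) \<partial>lborel \<partial>lborel)"
    and "(\<integral>\<^sup>+x. F x \<partial>lborel) = (\<integral>\<^sup>+t. \<integral>\<^sup>+s. F (plane_point s t) \<partial>lborel \<partial>lborel)"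
proof -
  have [measurable]: "(\<lambda>p. F (plane_point (fst p) (snd p))) \<in> borel_measurable (lborel \<Otimes>\<^sub>M lborel)"
    by (simp add: lborel_prod)
  have *: "(\<integral>\<^sup>+x. F x \<partial>lborel) = (\<integral>\<^sup>+p. F (plane_point (fst p) (snd p)) \<partial>(lborel \<Otimes>\<^sub>M lborel))"
    by (subst lborel_plane, subst nn_integral_distr) (simp_all add: lborel_prod)
  show "(\<integral>\<^sup>+x. F x \<partial>lborel) = (\<integral>\<^sup>+s. \<integral>\<^sup>+t. F (plane_point s t) \<partial>lborel \<partial>lborel)"
    unfolding * by (subst lborel.nn_integral_fst[symmetric]) simp_all
  show "(\<integral>\<^sup>+x. F x \<partial>lborel) = (\<integral>\<^sup>+t. \<integral>\<^sup>+s. F (plane_point s t) \<partial>lborel \<partial>lborel)"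
    unfolding * by (subst lborel_pair.nn_integral_snd[symmetric]) simp_all
qed

section \<open>Derivatives along coordinate lines and the Gagliardo inequality\<close>

lemma has_real_derivative_line:
  assumes "\<And>x. \<psi> differentiable (at x)"
  shows "((\<lambda>t. \<psi> (x + t *\<^sub>R axis j 1)) has_real_derivative partial_deriv j \<psi> (x + t *\<^sub>R axis j 1)) (at t within A)"
proof -
  define y where "y = x + t *\<^sub>R axis j 1"
  have "(\<psi> has_derivative frechet_derivative \<psi> (at y)) (at (x + t *\<^sub>R axis j 1))"
    using assms[of y] by (simp add: y_def frechet_derivative_works)
  then have "(\<psi> has_derivative frechet_derivative \<psi> (at y)) (at (x + t *\<^sub>R axis j 1) within (\<lambda>t. x + t *\<^sub>R axis j 1) ` A)"
    by (rule has_derivative_at_withinI)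
  moreover have "((\<lambda>t. x + t *\<^sub>R axis j 1) has_derivative (\<lambda>h. h *\<^sub>R axis j 1)) (at t within A)"
    by (auto intro!: derivative_eq_intros)
  ultimately have "((\<lambda>t. \<psi> (x + t *\<^sub>R axis j 1)) has_derivative (\<lambda>h. frechet_derivative \<psi> (at y) (h *\<^sub>R axis j 1))) (at t within A)"
    using diff_chain_within[of "\<lambda>t. x + t *\<^sub>R axis j 1" "\<lambda>h. h *\<^sub>R axis j 1" t A \<psi>] by (simp add: o_def)
  moreover have "frechet_derivative \<psi> (at y) (h *\<^sub>R axis j 1) = partial_deriv j \<psi> y * h" for h
    using linear_frechet_derivative[OF assms[of y]] by (simp add: linear_scale partial_deriv_def)
  ultimately show ?thesis by (simp add: has_field_derivative_def y_def)
qed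

lemma C_1_continuous:
  assumes "C_k (Suc 0) \<psi>"
  shows "continuous_on UNIV \<psi>" "continuous_on UNIV (partial_deriv j \<psi>)"
  using assms by (auto simp: continuous_on_eq_continuous_at intro: differentiable_imp_continuous_within)

text \<open>The factor 2 comes from integrating the derivative from both ends of the line.\<close>

lemma abs_le_integral_line:
  assumes \<psi>: "C_k (Suc 0) \<psi>" and bd: "bounded {x. \<psi> x \<noteq> 0}"
  shows "ennreal (2 * \<bar>\<psi> x\<bar>) \<le> (\<integral>\<^sup>+t. ennreal \<bar>partial_deriv j \<psi> (x + t *\<^sub>R axis j 1)\<bar> \<partial>lborel)"
proof -
  obtain R where R: "\<And>x. \<psi> x \<noteq> 0 \<Longrightarrow> norm x \<le> R" using bd by (auto simp: bounded_iff)
  \<comment> \<open>A point of the line at parameter \<open>T\<close> or \<open>- T\<close> has norm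
    at least \<open>T - norm x\<close>, which exceeds \<open>R\<close>, so \<psi> vanishes
    there.\<close>
  define T where "T = \<bar>R\<bar> + norm x + 1"
  have T: "0 < T" by (simp add: T_def add_nonneg_pos)
  define h where "h t = \<psi> (x + t *\<^sub>R axis j 1)" for t
  define h' where "h' t = partial_deriv j \<psi> (x + t *\<^sub>R axis j 1)" for t
  have h'_cont: "continuous_on A h'" for A
    unfolding h'_def
    by (rule continuous_on_compose2[OF C_1_continuous(2)[OF \<psi>]]) (auto intro!: continuous_intros)
  have [measurable]: "h' \<in> borel_measurable borel"
    by (rule borel_measurable_continuous_onI[OF h'_cont])
  have der: "(h has_vector_derivative h' t) (at t within A)" for t A
    using has_real_derivative_line[of \<psi> x j t A] \<psi>
    by (simp add: h_def[abs_def] h'_def has_real_derivative_iff_has_vector_derivative)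
  have far: "h t = 0" if "\<bar>t\<bar> = T" for t
  proof (rule ccontr)
    assume "h t \<noteq> 0"
    then have "norm (x + t *\<^sub>R axis j 1) \<le> R" using R by (simp add: h_def)
    moreover have "norm (t *\<^sub>R (axis j 1 :: plane)) \<le> norm (x + t *\<^sub>R axis j 1) + norm x"
      using norm_triangle_ineq4[of "x + t *\<^sub>R axis j 1" x] by simp
    ultimately show False using that by (simp add: T_def norm_axis_1)
  qed
  have bound: "ennreal \<bar>h d - h c\<bar> \<le> (\<integral>\<^sup>+t. ennreal \<bar>h' t\<bar> * indicator {c..d} t \<partial>lborel)" if "c \<le> d" for c d
  proof -
    have *: "has_bochner_integral lborel (\<lambda>t. indicator {c..d} t *\<^sub>R h' t) (h d - h c)"
      by (rule has_bochner_integral_FTC_Icc[OF that der h'_cont])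
    then have "ennreal (norm (h d - h c)) \<le> (\<integral>\<^sup>+t. ennreal (norm (indicator {c..d} t *\<^sub>R h' t)) \<partial>lborel)"
      using integral_norm_bound_ennreal[of lborel "\<lambda>t. indicator {c..d} t *\<^sub>R h' t"]
      by (simp add: has_bochner_integral_iff)
    also have "\<dots> = (\<integral>\<^sup>+t. ennreal \<bar>h' t\<bar> * indicator {c..d} t \<partial>lborel)"
      by (intro nn_integral_cong) (auto simp: indicator_def)
    finally show ?thesis by simp
  qed
  have "ennreal (2 * \<bar>\<psi> x\<bar>) = ennreal \<bar>h 0 - h (- T)\<bar> + ennreal \<bar>h T - h 0\<bar>"
    using far[of T] far[of "-T"] T by (simp add: h_def ennreal_plus[symmetric] del: ennreal_plus)
  also have "\<dots> \<le> (\<integral>\<^sup>+t. ennreal \<bar>h' t\<bar> * indicator {-T..0} t \<partial>lborel) + (\<integral>\<^sup>+t. ennreal \<bar>h' t\<bar> * indicator {0..T} t \<partial>lborel)"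
    using T by (intro add_mono bound) auto
  also have "\<dots> = (\<integral>\<^sup>+t. ennreal \<bar>h' t\<bar> * indicator {-T..0} t + ennreal \<bar>h' t\<bar> * indicator {0..T} t \<partial>lborel)"
    by (intro nn_integral_add[symmetric]) measurable
  \<comment> \<open>The two intervals overlap only in 0, a null set.\<close>
  also have "\<dots> \<le> (\<integral>\<^sup>+t. ennreal \<bar>h' t\<bar> \<partial>lborel)"
    using AE_lborel_singleton[of 0] by (intro nn_integral_mono_AE) (auto simp: indicator_def elim!: AE_mp)
  finally show ?thesis by (simp add: h'_def)
qed

lemma nn_integral_lborel_shift:
  fixes h :: "real \<Rightarrow> ennreal"
  assumes [measurable]: "h \<in> borel_measurable borel"
  shows "(\<integral>\<^sup>+t. h (c + t) \<partial>lborel) = (\<integral>\<^sup>+t. h t \<partial>lborel)"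
  using nn_integral_real_affine[of h 1 c] by simp

text \<open>The integral over the horizontal line through a point depends only on \<open>t\<close>,
  the one over the vertical line only on \<open>s\<close>. Multiplying the two bounds for
  \<open>2 * |\<psi>|\<close> therefore dominates \<open>4 * \<psi>^2\<close> by the separated
  product \<open>B s * A t\<close>, whose double integral factors.\<close>

lemma gagliardo_plane:
  assumes \<psi>: "C_k (Suc 0) \<psi>" and bd: "bounded {x. \<psi> x \<noteq> 0}"
  shows "(\<integral>\<^sup>+x. ennreal (4 * (\<psi> x)\<^sup>2) \<partial>lborel) \<le>
    (\<integral>\<^sup>+x. ennreal \<bar>partial_deriv 1 \<psi> x\<bar> \<partial>lborel) * (\<integral>\<^sup>+x. ennreal \<bar>partial_deriv 2 \<psi> x\<bar> \<partial>lborel)"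
proof -
  have [measurable]: "\<psi> \<in> borel_measurable borel" "partial_deriv j \<psi> \<in> borel_measurable borel" for j
    using C_1_continuous[OF \<psi>] by (auto intro: borel_measurable_continuous_onI)
  have pp: "(\<lambda>p. plane_point (fst p) (snd p)) \<in> borel \<Otimes>\<^sub>M borel \<rightarrow>\<^sub>M borel"
    using measurable_plane_point by (simp add: borel_prod)
  note [measurable] = measurable_compose[OF measurable_Pair pp, simplified]
  define A where "A t = (\<integral>\<^sup>+s. ennreal \<bar>partial_deriv 1 \<psi> (plane_point s t)\<bar> \<partial>lborel)" for t
  define B where "B s = (\<integral>\<^sup>+t. ennreal \<bar>partial_deriv 2 \<psi> (plane_point s t)\<bar> \<partial>lborel)" for s
  have [measurable]: "A \<in> borel_measurable borel" "B \<in> borel_measurable borel"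
    unfolding A_def B_def by measurable
  have A: "ennreal (2 * \<bar>\<psi> (plane_point s t)\<bar>) \<le> A t" for s t
  proof -
    have "A t = (\<integral>\<^sup>+r. ennreal \<bar>partial_deriv 1 \<psi> (plane_point (s + r) t)\<bar> \<partial>lborel)"
      unfolding A_def by (rule nn_integral_lborel_shift[symmetric]) measurable
    also have "\<dots> = (\<integral>\<^sup>+r. ennreal \<bar>partial_deriv 1 \<psi> (plane_point s t + r *\<^sub>R axis 1 1)\<bar> \<partial>lborel)"
      by (simp add: plane_point_def algebra_simps)
    finally show ?thesis using abs_le_integral_line[OF \<psi> bd] by simp
  qed
  have B: "ennreal (2 * \<bar>\<psi> (plane_point s t)\<bar>) \<le> B s" for s t
  proof -
    have "B s = (\<integral>\<^sup>+r. ennreal \<bar>partial_deriv 2 \<psi> (plane_point s (t + r))\<bar> \<partial>lborel)"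
      unfolding B_def by (rule nn_integral_lborel_shift[symmetric]) measurable
    also have "\<dots> = (\<integral>\<^sup>+r. ennreal \<bar>partial_deriv 2 \<psi> (plane_point s t + r *\<^sub>R axis 2 1)\<bar> \<partial>lborel)"
      by (simp add: plane_point_def algebra_simps)
    finally show ?thesis using abs_le_integral_line[OF \<psi> bd] by simp
  qed
  have "(\<integral>\<^sup>+x. ennreal (4 * (\<psi> x)\<^sup>2) \<partial>lborel)
      = (\<integral>\<^sup>+s. \<integral>\<^sup>+t. ennreal (4 * (\<psi> (plane_point s t))\<^sup>2) \<partial>lborel \<partial>lborel)"
    by (rule nn_integral_plane) measurable
  also have "\<dots> \<le> (\<integral>\<^sup>+s. \<integral>\<^sup>+t. B s * A t \<partial>lborel \<partial>lborel)"
  proof (intro nn_integral_mono)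
    fix s t
    have "4 * (\<psi> (plane_point s t))\<^sup>2 = (2 * \<bar>\<psi> (plane_point s t)\<bar>) * (2 * \<bar>\<psi> (plane_point s t)\<bar>)"
      by (simp add: power2_eq_square)
    then have "ennreal (4 * (\<psi> (plane_point s t))\<^sup>2)
        = ennreal (2 * \<bar>\<psi> (plane_point s t)\<bar>) * ennreal (2 * \<bar>\<psi> (plane_point s t)\<bar>)"
      by (simp only: ennreal_mult'[OF mult_nonneg_nonneg[OF zero_le_numeral abs_ge_zero]])
    also have "\<dots> \<le> B s * A t" using A B by (intro mult_mono) auto
    finally show "ennreal (4 * (\<psi> (plane_point s t))\<^sup>2) \<le> B s * A t" .
  qed
  also have "\<dots> = (\<integral>\<^sup>+s. B s \<partial>lborel) * (\<integral>\<^sup>+t. A t \<partial>lborel)"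
    by (simp add: nn_integral_cmult nn_integral_multc)
  also have "(\<integral>\<^sup>+s. B s \<partial>lborel) = (\<integral>\<^sup>+x. ennreal \<bar>partial_deriv 2 \<psi> x\<bar> \<partial>lborel)"
    unfolding B_def by (rule nn_integral_plane(1)[symmetric]) measurable
  also have "(\<integral>\<^sup>+t. A t \<partial>lborel) = (\<integral>\<^sup>+x. ennreal \<bar>partial_deriv 1 \<psi> x\<bar> \<partial>lborel)"
    unfolding A_def by (rule nn_integral_plane(2)[symmetric]) measurable
  finally show ?thesis by (simp add: mult.commute)
qed

section \<open>Rules for partial derivatives and supports\<close>

lemma partial_deriv_eqI:
  "(\<psi> has_derivative \<psi>') (at x) \<Longrightarrow> partial_deriv j \<psi> x = \<psi>' (axis j 1)"
  by (simp add: partial_deriv_def frechet_derivative_at[symmetric])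

lemma partial_deriv_outside_support:
  assumes "x \<notin> closure {x. \<psi> x \<noteq> 0}"
  shows "partial_deriv j \<psi> x = 0"
proof -
  have "(\<psi> has_derivative (\<lambda>h. 0)) (at x)"
  proof (rule has_derivative_transform_within_open)
    show "((\<lambda>x. 0) has_derivative (\<lambda>h. 0)) (at x)" by simp
    show "open (- closure {x. \<psi> x \<noteq> 0})" by (simp add: open_Compl)
    show "x \<in> - closure {x. \<psi> x \<noteq> 0}" using assms by simp
    show "0 = \<psi> y" if "y \<in> - closure {x. \<psi> x \<noteq> 0}" for y
      using that closure_subset[of "{x. \<psi> x \<noteq> 0}"] by auto
  qed
  then show ?thesis by (rule partial_deriv_eqI)
qed

lemma partial_deriv_add:
  assumes "\<psi> differentiable (at x)" "\<eta> differentiable (at x)"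
  shows "partial_deriv j (\<lambda>x. \<psi> x + \<eta> x) x = partial_deriv j \<psi> x + partial_deriv j \<eta> x"
  using partial_deriv_eqI[OF has_derivative_add[OF assms[unfolded frechet_derivative_works]]]
  by (simp add: partial_deriv_def)

lemma partial_deriv_cmult:
  assumes "\<psi> differentiable (at x)"
  shows "partial_deriv j (\<lambda>x. c * \<psi> x) x = c * partial_deriv j \<psi> x"
  using partial_deriv_eqI[OF has_derivative_mult_right[OF assms[unfolded frechet_derivative_works], of c]]
  by (simp add: partial_deriv_def)

lemma partial_deriv_mult:
  assumes "\<psi> differentiable (at x)" "\<eta> differentiable (at x)"
  shows "partial_deriv j (\<lambda>x. \<psi> x * \<eta> x) x = \<psi> x * partial_deriv j \<eta> x + partial_deriv j \<psi> x * \<eta> x"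
  using partial_deriv_eqI[OF has_derivative_mult[OF assms[unfolded frechet_derivative_works]]]
  by (simp add: partial_deriv_def)

lemma C_k_add: "C_k k \<psi> \<Longrightarrow> C_k k \<eta> \<Longrightarrow> C_k k (\<lambda>x. \<psi> x + \<eta> x)"
proof (induction k arbitrary: \<psi> \<eta>)
  case (Suc k)
  have "partial_deriv j (\<lambda>x. \<psi> x + \<eta> x) = (\<lambda>x. partial_deriv j \<psi> x + partial_deriv j \<eta> x)" for j
    using Suc.prems by (auto simp: partial_deriv_add)
  then show ?case using Suc by (auto intro: differentiable_add)
qed (auto intro: continuous_on_add)

lemma C_k_cmult: "C_k k \<psi> \<Longrightarrow> C_k k (\<lambda>x. c * \<psi> x)"
proof (induction k arbitrary: \<psi>)
  case (Suc k)
  have "partial_deriv j (\<lambda>x. c * \<psi> x) = (\<lambda>x. c * partial_deriv j \<psi> x)" for j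
    using Suc.prems by (auto simp: partial_deriv_cmult)
  then show ?case using Suc by (auto intro: differentiable_mult)
qed (auto intro: continuous_on_mult)

lemma C_1_mult:
  assumes "C_k (Suc 0) \<psi>" "C_k (Suc 0) \<eta>"
  shows "C_k (Suc 0) (\<lambda>x. \<psi> x * \<eta> x)"
proof -
  have "partial_deriv j (\<lambda>x. \<psi> x * \<eta> x) = (\<lambda>x. \<psi> x * partial_deriv j \<eta> x + partial_deriv j \<psi> x * \<eta> x)" for j
    using assms by (auto simp: partial_deriv_mult)
  then show ?thesis
    using assms C_1_continuous[OF assms(1)] C_1_continuous[OF assms(2)]
    by (auto intro!: continuous_intros differentiable_mult)
qed

lemma integrable_bounded_support:
  fixes h :: "'a::euclidean_space \<Rightarrow> real"
  assumes "continuous_on UNIV h" "bounded {x. h x \<noteq> 0}"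
  shows "integrable lborel h"
proof -
  have "integrable lborel (\<lambda>x. indicator (closure {x. h x \<noteq> 0}) x *\<^sub>R h x)"
    using assms by (intro borel_integrable_compact) (auto intro: continuous_on_subset)
  moreover have "(\<lambda>x. indicator (closure {x. h x \<noteq> 0}) x *\<^sub>R h x) = h"
    using closure_subset[of "{x. h x \<noteq> 0}"] by (auto simp: fun_eq_iff indicator_def)
  ultimately show ?thesis by (rule subst[rotated])
qed

lemma square_integrable_bounded_support:
  fixes h :: "'a::euclidean_space \<Rightarrow> real"
  assumes "continuous_on UNIV h" "bounded {x. h x \<noteq> 0}"
  shows "square_integrable lborel h"
  unfolding square_integrable_def using assms
  by (auto intro!: integrable_bounded_support continuous_intros borel_measurable_continuous_onI)

lemma bounded_support_partial_deriv:
  "bounded {x. \<psi> x \<noteq> 0} \<Longrightarrow> bounded {x. partial_deriv j \<psi> x \<noteq> 0}"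
  by (erule bounded_subset[OF bounded_closure]) (use partial_deriv_outside_support in blast)

section \<open>Integrals of partial derivatives\<close>

lemma integral_plane:
  fixes F :: "plane \<Rightarrow> real"
  assumes F: "integrable lborel F"
  shows "(\<integral>x. F x \<partial>lborel) = (\<integral>s. \<integral>t. F (plane_point s t) \<partial>lborel \<partial>lborel)"
    and "(\<integral>x. F x \<partial>lborel) = (\<integral>t. \<integral>s. F (plane_point s t) \<partial>lborel \<partial>lborel)"
proof -
  have [measurable]: "F \<in> borel_measurable borel" using F by auto
  have [measurable]: "(\<lambda>p. plane_point (fst p) (snd p)) \<in> (lborel \<Otimes>\<^sub>M lborel) \<rightarrow>\<^sub>M borel"
    by (simp add: lborel_prod)
  have int: "integrable (lborel \<Otimes>\<^sub>M lborel) (\<lambda>p. F (plane_point (fst p) (snd p)))"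
    using F unfolding lborel_prod by (subst (asm) lborel_plane, subst (asm) integrable_distr_eq) auto
  have *: "(\<integral>x. F x \<partial>lborel) = (\<integral>p. F (plane_point (fst p) (snd p)) \<partial>(lborel \<Otimes>\<^sub>M lborel))"
    by (subst lborel_plane, subst integral_distr) (simp_all add: lborel_prod)
  show "(\<integral>x. F x \<partial>lborel) = (\<integral>s. \<integral>t. F (plane_point s t) \<partial>lborel \<partial>lborel)"
    unfolding * using lborel_pair.integral_fst'[OF int] by simp
  show "(\<integral>x. F x \<partial>lborel) = (\<integral>t. \<integral>s. F (plane_point s t) \<partial>lborel \<partial>lborel)"
    unfolding * using lborel_pair.integral_snd[of "\<lambda>s t. F (plane_point s t)"] int by (simp add: case_prod_unfold)
qed

lemma integral_partial_deriv_line: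
  assumes \<psi>: "C_k (Suc 0) \<psi>" and bd: "bounded {x. \<psi> x \<noteq> 0}"
  shows "(\<integral>t. partial_deriv j \<psi> (x + t *\<^sub>R axis j 1) \<partial>lborel) = 0"
proof -
  have "bounded (closure {x. \<psi> x \<noteq> 0})" using bd by (rule bounded_closure)
  then obtain R where R: "\<And>x. x \<in> closure {x. \<psi> x \<noteq> 0} \<Longrightarrow> norm x \<le> R" by (auto simp: bounded_iff)
  define T where "T = \<bar>R\<bar> + norm x + 1"
  have T: "0 < T" by (simp add: T_def add_nonneg_pos)
  define h where "h t = \<psi> (x + t *\<^sub>R axis j 1)" for t
  define h' where "h' t = partial_deriv j \<psi> (x + t *\<^sub>R axis j 1)" for t
  have h'_cont: "continuous_on A h'" for A
    unfolding h'_def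
    by (rule continuous_on_compose2[OF C_1_continuous(2)[OF \<psi>]]) (auto intro!: continuous_intros)
  have der: "(h has_vector_derivative h' t) (at t within A)" for t A
    using has_real_derivative_line[of \<psi> x j t A] \<psi>
    by (simp add: h_def[abs_def] h'_def has_real_derivative_iff_has_vector_derivative)
  \<comment> \<open>Leaving the closure of the support, and not just the set where \<psi> is
    nonzero, makes the derivative vanish as well, so that the integral over the line is the one over
    \<open>{-T..T}\<close>.\<close>
  have far: "x + t *\<^sub>R axis j 1 \<notin> closure {x. \<psi> x \<noteq> 0}" if "\<bar>t\<bar> \<ge> T" for t
  proof
    assume "x + t *\<^sub>R axis j 1 \<in> closure {x. \<psi> x \<noteq> 0}"
    then have "norm (x + t *\<^sub>R axis j 1) \<le> R" by (rule R)
    moreover have "norm (t *\<^sub>R (axis j 1 :: plane)) \<le> norm (x + t *\<^sub>R axis j 1) + norm x"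
      using norm_triangle_ineq4[of "x + t *\<^sub>R axis j 1" x] by simp
    ultimately show False using that by (simp add: T_def norm_axis_1)
  qed
  have "h t = 0" if "\<bar>t\<bar> \<ge> T" for t
    using far[OF that] closure_subset[of "{x. \<psi> x \<noteq> 0}"] by (auto simp: h_def)
  then have "h T = 0" "h (-T) = 0" using T by auto
  moreover have "(\<integral>t. indicator {-T..T} t *\<^sub>R h' t \<partial>lborel) = h T - h (-T)"
    using T by (intro integral_FTC_Icc der h'_cont) simp
  moreover have "(\<lambda>t. indicator {-T..T} t *\<^sub>R h' t) = h'"
  proof
    fix t show "indicator {-T..T} t *\<^sub>R h' t = h' t"
    using partial_deriv_outside_support[OF far[of t]] by (cases "\<bar>t\<bar> \<ge> T") (auto simp: indicator_def h'_def)
  qed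
  ultimately have "(\<integral>t. h' t \<partial>lborel) = 0" by simp
  then show ?thesis by (simp add: h'_def)
qed

text \<open>The order of integration is chosen so that the inner variable is the differentiated one.
  This is the integration by parts behind \<open>trilinear_skew\<close>.\<close>

lemma integral_partial_deriv:
  assumes \<psi>: "C_k (Suc 0) \<psi>" and bd: "bounded {x. \<psi> x \<noteq> 0}"
  shows "(\<integral>x. partial_deriv j \<psi> x \<partial>lborel) = 0"
proof -
  have int: "integrable lborel (partial_deriv j \<psi>)" for j
    using C_1_continuous(2)[OF \<psi>] bounded_support_partial_deriv[OF bd] by (rule integrable_bounded_support)
  have "(\<integral>x. partial_deriv 1 \<psi> x \<partial>lborel) = (\<integral>t. \<integral>s. partial_deriv 1 \<psi> (plane_point s t) \<partial>lborel \<partial>lborel)"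
    by (rule integral_plane(2)[OF int])
  also have "\<dots> = (\<integral>t. \<integral>s. partial_deriv 1 \<psi> (plane_point 0 t + s *\<^sub>R axis 1 1) \<partial>lborel \<partial>lborel)"
    by (simp add: plane_point_def add.commute)
  finally have 1: "(\<integral>x. partial_deriv 1 \<psi> x \<partial>lborel) = 0"
    by (simp add: integral_partial_deriv_line[OF \<psi> bd])
  have "(\<integral>x. partial_deriv 2 \<psi> x \<partial>lborel) = (\<integral>s. \<integral>t. partial_deriv 2 \<psi> (plane_point s t) \<partial>lborel \<partial>lborel)"
    by (rule integral_plane(1)[OF int])
  also have "\<dots> = (\<integral>s. \<integral>t. partial_deriv 2 \<psi> (plane_point s 0 + t *\<^sub>R axis 2 1) \<partial>lborel \<partial>lborel)"
    by (simp add: plane_point_def)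
  finally have 2: "(\<integral>x. partial_deriv 2 \<psi> x \<partial>lborel) = 0"
    by (simp add: integral_partial_deriv_line[OF \<psi> bd])
  show ?thesis using 1 2 exhaust_2[of j] by auto
qed

section \<open>Square and fourth-power bounds with explicit constants\<close>

lemma inner_abs_L2:
  "square_integrable lborel f \<Longrightarrow> square_integrable lborel g \<Longrightarrow> abs_L2 f \<bullet> abs_L2 g = (\<integral>x. f x * g x \<partial>lborel)"
  by (rule inner_L2.abs_eq) (simp_all add: L2_rel_refl)

lemma inner_rep_L2: "u \<bullet> v = (\<integral>x. rep_L2 u x * rep_L2 v x \<partial>lborel)"
  using inner_abs_L2[OF rep_L2_sq rep_L2_sq, of u v] by (simp add: abs_rep_L2)

lemma square_integrable_abs: "square_integrable M f \<Longrightarrow> square_integrable M (\<lambda>x. \<bar>f x\<bar>)"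
  unfolding square_integrable_def by (simp add: borel_measurable_abs)

lemma Cauchy_Schwarz_square_integrable:
  assumes f: "square_integrable M f" and g: "square_integrable M g"
  shows "(\<integral>x. \<bar>f x * g x\<bar> \<partial>M) \<le> sqrt (\<integral>x. (f x)\<^sup>2 \<partial>M) * sqrt (\<integral>x. (g x)\<^sup>2 \<partial>M)"
proof -
  have [measurable]: "f \<in> borel_measurable M" "g \<in> borel_measurable M"
    using f g by (auto simp: square_integrable_def)
  define A B C where "A = (\<integral>x. \<bar>f x * g x\<bar> \<partial>M)" and "B = (\<integral>x. (f x)\<^sup>2 \<partial>M)" and "C = (\<integral>x. (g x)\<^sup>2 \<partial>M)"
  have "(\<integral>\<^sup>+x. ennreal \<bar>f x\<bar> * ennreal \<bar>g x\<bar> \<partial>M)\<^sup>2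
      \<le> (\<integral>\<^sup>+x. (ennreal \<bar>f x\<bar>)\<^sup>2 \<partial>M) * (\<integral>\<^sup>+x. (ennreal \<bar>g x\<bar>)\<^sup>2 \<partial>M)"
    by (rule Cauchy_Schwarz_nn_integral) measurable
  also have "(\<integral>\<^sup>+x. ennreal \<bar>f x\<bar> * ennreal \<bar>g x\<bar> \<partial>M) = ennreal (\<integral>x. \<bar>f x * g x\<bar> \<partial>M)"
  proof (subst nn_integral_eq_integral[symmetric])
    show "integrable M (\<lambda>x. \<bar>f x * g x\<bar>)" by (rule integrable_abs[OF square_integrable_mult[OF f g]])
  qed (simp_all add: abs_mult ennreal_mult)
  also have "(\<integral>\<^sup>+x. (ennreal \<bar>f x\<bar>)\<^sup>2 \<partial>M) = ennreal (\<integral>x. (f x)\<^sup>2 \<partial>M)"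
    using f by (subst nn_integral_eq_integral[symmetric]) (simp_all add: square_integrable_def ennreal_power)
  also have "(\<integral>\<^sup>+x. (ennreal \<bar>g x\<bar>)\<^sup>2 \<partial>M) = ennreal (\<integral>x. (g x)\<^sup>2 \<partial>M)"
    using g by (subst nn_integral_eq_integral[symmetric]) (simp_all add: square_integrable_def ennreal_power)
  finally have *: "(ennreal A)\<^sup>2 \<le> ennreal B * ennreal C" by (simp only: A_def B_def C_def)
  have "0 \<le> A" "0 \<le> B" "0 \<le> C" by (simp_all add: A_def B_def C_def)
  with * have "A\<^sup>2 \<le> B * C" by (simp add: ennreal_power flip: ennreal_mult)
  from real_sqrt_le_mono[OF this] show ?thesis
    using \<open>0 \<le> A\<close> by (simp add: real_sqrt_mult A_def B_def C_def)
qed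

lemma gagliardo_plane_real:
  assumes \<psi>: "C_k (Suc 0) \<psi>" and bd: "bounded {x. \<psi> x \<noteq> 0}"
  shows "4 * (\<integral>x. (\<psi> x)\<^sup>2 \<partial>lborel) \<le>
    (\<integral>x. \<bar>partial_deriv 1 \<psi> x\<bar> \<partial>lborel) * (\<integral>x. \<bar>partial_deriv 2 \<psi> x\<bar> \<partial>lborel)"
proof -
  have int: "integrable lborel (\<lambda>x. \<bar>partial_deriv j \<psi> x\<bar>)" for j
    using C_1_continuous(2)[OF \<psi>] bounded_support_partial_deriv[OF bd] integrable_bounded_support
    by (intro integrable_abs) blast
  have int': "integrable lborel (\<lambda>x. 4 * (\<psi> x)\<^sup>2)"
    using square_integrable_bounded_support[OF C_1_continuous(1)[OF \<psi>] bd] by (simp add: square_integrable_def)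
  have "ennreal (\<integral>x. 4 * (\<psi> x)\<^sup>2 \<partial>lborel) \<le>
    ennreal (\<integral>x. \<bar>partial_deriv 1 \<psi> x\<bar> \<partial>lborel) * ennreal (\<integral>x. \<bar>partial_deriv 2 \<psi> x\<bar> \<partial>lborel)"
    using gagliardo_plane[OF assms] int int' by (simp add: nn_integral_eq_integral)
  then show ?thesis
    by (simp add: ennreal_mult[symmetric] ennreal_le_iff)
qed

lemma test_function_C_1: "\<phi> \<in> test_functions G \<Longrightarrow> C_k (Suc 0) \<phi>"
  unfolding test_functions_def by blast

lemma test_function_bounded_support: "\<phi> \<in> test_functions G \<Longrightarrow> bounded {x. \<phi> x \<noteq> 0}"
  unfolding test_functions_def using compact_imp_bounded bounded_subset closure_subset by blast

lemma test_function_outside: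
  assumes "\<phi> \<in> test_functions G" "x \<notin> G"
  shows "\<phi> x = 0" "partial_deriv j \<phi> x = 0"
  using assms closure_subset[of "{x. \<phi> x \<noteq> 0}"] partial_deriv_outside_support[of x \<phi> j]
  by (auto simp: test_functions_def)

lemma test_function_square_integrable:
  assumes "\<phi> \<in> test_functions G"
  shows "square_integrable lborel \<phi>" "square_integrable lborel (partial_deriv j \<phi>)"
  using C_1_continuous[OF test_function_C_1[OF assms]] test_function_bounded_support[OF assms]
    bounded_support_partial_deriv[OF test_function_bounded_support[OF assms]]
  by (auto intro: square_integrable_bounded_support)

lemma sobolev_of_sel:
  "fst (sobolev_of \<phi>) = abs_L2 \<phi>" "snd (sobolev_of \<phi>) $ j = abs_L2 (partial_deriv j \<phi>)"
  by (simp_all add: sobolev_of_def)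

lemma norm_vec2_squared: "(norm (z :: 'a::real_normed_vector ^ 2))\<^sup>2 = (norm (z $ 1))\<^sup>2 + (norm (z $ 2))\<^sup>2"
  by (simp add: norm_vec_def L2_set_def UNIV_2)

text \<open>The support lies in \<open>G\<close>, so Cauchy-Schwarz against its indicator bounds the
  integral of the absolute partial derivative by \<open>sqrt A * d j\<close>. Hence
  \<open>4 * I <= A * d 1 * d 2\<close>, and \<open>d 1 * d 2 <= S / 2\<close> gives the factor 1/8.
  For the square of \<phi> the derivative is 2 \<phi> times that of \<phi>, with integral at most
  \<open>2 * sqrt I * d j\<close>. The product of the two bounds is
  \<open>4 * I * d 1 * d 2\<close>, and inserting the bound on \<open>I\<close> gives
  \<open>A * (S / 2)^2\<close>; dividing by 4 leaves 1/16.\<close>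

lemma test_function_inequalities:
  assumes \<phi>: "\<phi> \<in> test_functions G" and G: "open G" "bounded G"
  shows "(\<integral>x. (\<phi> x)\<^sup>2 \<partial>lborel) \<le> measure lborel G / 8 * (norm (snd (sobolev_of \<phi>)))\<^sup>2"
    and "(\<integral>x. (\<phi> x)^4 \<partial>lborel) \<le> measure lborel G / 16 * (norm (snd (sobolev_of \<phi>)))^4"
proof -
  define A where "A = measure lborel G"
  define d where "d j = norm (abs_L2 (partial_deriv j \<phi>))" for j
  define S where "S = (norm (snd (sobolev_of \<phi>)))\<^sup>2"
  define I where "I = (\<integral>x. (\<phi> x)\<^sup>2 \<partial>lborel)"
  note C1 = test_function_C_1[OF \<phi>] and bd = test_function_bounded_support[OF \<phi>]
  note sq = test_function_square_integrable[OF \<phi>]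
  have fin: "emeasure lborel G < \<infinity>" using emeasure_bounded_finite[OF G(2)] by simp
  have Gm: "G \<in> sets borel" using G(1) by simp
  have A: "0 \<le> A" and d: "0 \<le> d j" and I: "0 \<le> I" for j by (simp_all add: A_def d_def I_def)
  have S: "S = (d 1)\<^sup>2 + (d 2)\<^sup>2"
    by (simp add: S_def norm_vec2_squared sobolev_of_sel d_def)
  have d_eq: "sqrt (\<integral>x. (partial_deriv j \<phi> x)\<^sup>2 \<partial>lborel) = d j" for j
    by (simp add: d_def norm_abs_L2 sq)
  have L1: "(\<integral>x. \<bar>partial_deriv j \<phi> x\<bar> \<partial>lborel) \<le> sqrt A * d j" for j
  proof -
    have "(\<integral>x. \<bar>partial_deriv j \<phi> x\<bar> \<partial>lborel) = (\<integral>x. \<bar>indicator G x * partial_deriv j \<phi> x\<bar> \<partial>lborel)"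
      using test_function_outside(2)[OF \<phi>] by (intro Bochner_Integration.integral_cong) (auto simp: indicator_def)
    also have "\<dots> \<le> sqrt (\<integral>x. (indicator G x)\<^sup>2 \<partial>lborel) * d j"
      using Cauchy_Schwarz_square_integrable[OF square_integrable_indicator[OF Gm fin] sq(2)[of j]]
      by (simp add: d_eq)
    also have "(\<integral>x. (indicator G x)\<^sup>2 \<partial>lborel) = A"
    proof -
    have "(indicator G x :: real)\<^sup>2 = indicator G x" for x by (simp add: indicator_def)
    then show ?thesis using Gm by (simp add: A_def)
  qed
    finally show ?thesis .
  qed
  have "4 * I \<le> (\<integral>x. \<bar>partial_deriv 1 \<phi> x\<bar> \<partial>lborel) * (\<integral>x. \<bar>partial_deriv 2 \<phi> x\<bar> \<partial>lborel)"
    unfolding I_def by (rule gagliardo_plane_real[OF C1 bd])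
  also have "\<dots> \<le> (sqrt A * d 1) * (sqrt A * d 2)"
    using A d by (intro mult_mono L1) auto
  also have "\<dots> = (sqrt A * sqrt A) * (d 1 * d 2)" by (simp only: mult_ac)
  also have "\<dots> = A * (d 1 * d 2)" using A by simp
  finally have I_le: "4 * I \<le> A * (d 1 * d 2)" .
  have dS: "2 * (d 1 * d 2) \<le> S" using sum_squares_bound[of "d 1" "d 2"] by (simp add: S mult.assoc)
  have AdS: "A * (d 1 * d 2) \<le> A * (S / 2)" using dS A by (intro mult_left_mono) auto
  show "(\<integral>x. (\<phi> x)\<^sup>2 \<partial>lborel) \<le> measure lborel G / 8 * (norm (snd (sobolev_of \<phi>)))\<^sup>2"
    using I_le AdS by (simp add: I_def A_def S_def)
  have der2: "partial_deriv j (\<lambda>x. \<phi> x * \<phi> x) x = 2 * (\<phi> x * partial_deriv j \<phi> x)" for j x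
    using C1 by (simp add: partial_deriv_mult)
  have L1': "(\<integral>x. \<bar>partial_deriv j (\<lambda>x. \<phi> x * \<phi> x) x\<bar> \<partial>lborel) \<le> 2 * (sqrt I * d j)" for j
    using Cauchy_Schwarz_square_integrable[OF sq(1) sq(2)[of j]]
    by (simp add: der2 abs_mult d_eq I_def)
  have "4 * (\<integral>x. (\<phi> x)^4 \<partial>lborel) = 4 * (\<integral>x. (\<phi> x * \<phi> x)\<^sup>2 \<partial>lborel)"
    by (simp add: power2_eq_square power4_eq_xxxx mult.assoc)
  also have "\<dots> \<le> (\<integral>x. \<bar>partial_deriv 1 (\<lambda>x. \<phi> x * \<phi> x) x\<bar> \<partial>lborel) * (\<integral>x. \<bar>partial_deriv 2 (\<lambda>x. \<phi> x * \<phi> x) x\<bar> \<partial>lborel)"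
    by (rule gagliardo_plane_real[OF C_1_mult[OF C1 C1]]) (simp add: bd)
  also have "\<dots> \<le> (2 * (sqrt I * d 1)) * (2 * (sqrt I * d 2))"
    using I d by (intro mult_mono L1') auto
  also have "\<dots> = 4 * (sqrt I * sqrt I) * (d 1 * d 2)" by (simp only: mult_ac)
  also have "\<dots> = 4 * I * (d 1 * d 2)" using I by simp
  also have "\<dots> \<le> (A * (d 1 * d 2)) * (d 1 * d 2)"
    using I_le d by (intro mult_right_mono) auto
  also have "\<dots> \<le> (A * (S / 2)) * (S / 2)"
    using AdS dS A d by (intro mult_mono) (auto simp: S)
  finally have "(\<integral>x. (\<phi> x)^4 \<partial>lborel) \<le> A / 16 * S\<^sup>2" by (simp add: power2_eq_square)
  then show "(\<integral>x. (\<phi> x)^4 \<partial>lborel) \<le> measure lborel G / 16 * (norm (snd (sobolev_of \<phi>)))^4"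
    by (simp add: A_def S_def)
qed

section \<open>Sobolev functions and the trilinear form\<close>

lemma test_functions_add:
  assumes "\<phi> \<in> test_functions G" "\<psi> \<in> test_functions G"
  shows "(\<lambda>x. \<phi> x + \<psi> x) \<in> test_functions G"
proof -
  have "{x. \<phi> x + \<psi> x \<noteq> 0} \<subseteq> {x. \<phi> x \<noteq> 0} \<union> {x. \<psi> x \<noteq> 0}" by auto
  then have sub: "closure {x. \<phi> x + \<psi> x \<noteq> 0} \<subseteq> closure {x. \<phi> x \<noteq> 0} \<union> closure {x. \<psi> x \<noteq> 0}"
    unfolding closure_Un[symmetric] by (rule closure_mono)
  have "compact (closure {x. \<phi> x \<noteq> 0} \<union> closure {x. \<psi> x \<noteq> 0})"
    using assms by (intro compact_Un) (simp_all add: test_functions_def)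
  then have "bounded (closure {x. \<phi> x + \<psi> x \<noteq> 0})"
    using sub by (intro bounded_subset[OF compact_imp_bounded])
  then have "compact (closure {x. \<phi> x + \<psi> x \<noteq> 0})"
    unfolding compact_eq_bounded_closed by simp
  then show ?thesis using assms sub unfolding test_functions_def by (auto intro: C_k_add)
qed

lemma test_functions_cmult:
  assumes "\<phi> \<in> test_functions G"
  shows "(\<lambda>x. c * \<phi> x) \<in> test_functions G"
proof -
  have "{x. c * \<phi> x \<noteq> 0} \<subseteq> {x. \<phi> x \<noteq> 0}" by auto
  then have sub: "closure {x. c * \<phi> x \<noteq> 0} \<subseteq> closure {x. \<phi> x \<noteq> 0}"
    by (rule closure_mono)
  then have "bounded (closure {x. c * \<phi> x \<noteq> 0})"
    using assms by (intro bounded_subset[OF compact_imp_bounded]) (auto simp: test_functions_def)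
  then have "compact (closure {x. c * \<phi> x \<noteq> 0})"
    unfolding compact_eq_bounded_closed by simp
  then show ?thesis using assms sub unfolding test_functions_def by (auto intro: C_k_cmult)
qed

lemma test_functions_zero: "(\<lambda>x. 0) \<in> test_functions G"
proof -
  have "C_k k (\<lambda>x. 0)" for k
  proof (induction k)
    case (Suc k)
    have "partial_deriv j (\<lambda>x. 0) = (\<lambda>x. 0)" for j
      using partial_deriv_eqI[OF has_derivative_const] by auto
    with Suc show ?case by simp
  qed simp
  then show ?thesis by (simp add: test_functions_def)
qed

lemma sobolev_of_add:
  assumes "\<phi> \<in> test_functions G" "\<psi> \<in> test_functions G"
  shows "sobolev_of (\<lambda>x. \<phi> x + \<psi> x) = sobolev_of \<phi> + sobolev_of \<psi>"
proof -
  have "partial_deriv j (\<lambda>x. \<phi> x + \<psi> x) = (\<lambda>x. partial_deriv j \<phi> x + partial_deriv j \<psi> x)" for j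
    using test_function_C_1[OF assms(1)] test_function_C_1[OF assms(2)] by (auto simp: partial_deriv_add)
  then show ?thesis
    using test_function_square_integrable[OF assms(1)] test_function_square_integrable[OF assms(2)]
    by (simp add: sobolev_of_def abs_L2_add vec_eq_iff)
qed

lemma sobolev_of_cmult:
  assumes "\<phi> \<in> test_functions G"
  shows "sobolev_of (\<lambda>x. c * \<phi> x) = c *\<^sub>R sobolev_of \<phi>"
proof -
  have "partial_deriv j (\<lambda>x. c * \<phi> x) = (\<lambda>x. c * partial_deriv j \<phi> x)" for j
    using test_function_C_1[OF assms] by (auto simp: partial_deriv_cmult)
  then show ?thesis
    using test_function_square_integrable[OF assms]
    by (simp add: sobolev_of_def abs_L2_scale vec_eq_iff)
qed

lemma sobolev_of_zero: "sobolev_of (\<lambda>x. 0) = 0"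
  using sobolev_of_cmult[OF test_functions_zero, of 0] by simp

lemma subspace_closure:
  fixes S :: "'a::real_normed_vector set"
  assumes "subspace S"
  shows "subspace (closure S)"
proof -
  have S: "span S = S" using assms by (simp add: span_eq_iff)
  show ?thesis
    using closure_span_add[of _ S] closure_span_scale[of _ S] subspace_0[OF assms] closure_subset[of S]
    unfolding S by (auto intro!: subspaceI)
qed

lemma subspace_H10: "subspace (H10 G)"
  unfolding H10_def
proof (intro subspace_closure subspaceI)
  show "0 \<in> sobolev_of ` test_functions G"
    using sobolev_of_zero test_functions_zero by (metis imageI)
next
  fix s t assume "s \<in> sobolev_of ` test_functions G" "t \<in> sobolev_of ` test_functions G"
  then show "s + t \<in> sobolev_of ` test_functions G"
    by (elim imageE) (simp add: test_functions_add flip: sobolev_of_add)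
next
  fix c s assume "s \<in> sobolev_of ` test_functions G"
  then show "c *\<^sub>R s \<in> sobolev_of ` test_functions G"
    by (elim imageE) (simp add: test_functions_cmult flip: sobolev_of_cmult)
qed

lemma subspace_H10_field: "subspace (H10_field G)"
  unfolding H10_field_def
  by (intro subspaceI CollectI allI)
    (simp_all add: subspace_0[OF subspace_H10] subspace_add[OF subspace_H10] subspace_scale[OF subspace_H10])

lemma subspace_solenoidal_test_fields: "subspace (solenoidal_test_fields G)"
proof (rule subspaceI)
  have "(\<chi> i. sobolev_of (\<lambda>x. 0)) \<in> solenoidal_test_fields G"
    unfolding solenoidal_test_fields_def using test_functions_zero
    by (auto intro!: exI[of _ "\<lambda>i x. 0"] simp: partial_deriv_eqI[OF has_derivative_const])
  then show "0 \<in> solenoidal_test_fields G" by (simp add: sobolev_of_zero zero_vec_def)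
next
  fix u v assume "u \<in> solenoidal_test_fields G" "v \<in> solenoidal_test_fields G"
  then obtain \<phi> \<psi> where
    \<phi>: "\<And>i. \<phi> i \<in> test_functions G" "\<And>x. (\<Sum>i\<in>UNIV. partial_deriv i (\<phi> i) x) = 0" "u = (\<chi> i. sobolev_of (\<phi> i))"
    and \<psi>: "\<And>i. \<psi> i \<in> test_functions G" "\<And>x. (\<Sum>i\<in>UNIV. partial_deriv i (\<psi> i) x) = 0" "v = (\<chi> i. sobolev_of (\<psi> i))"
    unfolding solenoidal_test_fields_def by blast
  have "partial_deriv i (\<lambda>x. \<phi> i x + \<psi> i x) x = partial_deriv i (\<phi> i) x + partial_deriv i (\<psi> i) x" for i x
    using test_function_C_1[OF \<phi>(1)] test_function_C_1[OF \<psi>(1)] by (auto simp: partial_deriv_add)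
  moreover have "u + v = (\<chi> i. sobolev_of (\<lambda>x. \<phi> i x + \<psi> i x))"
    by (simp add: \<phi>(3) \<psi>(3) vec_eq_iff sobolev_of_add[OF \<phi>(1) \<psi>(1)])
  ultimately show "u + v \<in> solenoidal_test_fields G"
    unfolding solenoidal_test_fields_def
    by (intro CollectI exI[of _ "\<lambda>i x. \<phi> i x + \<psi> i x"])
      (simp add: \<phi>(1,2) \<psi>(1,2) test_functions_add sum.distrib)
next
  fix c u assume "u \<in> solenoidal_test_fields G"
  then obtain \<phi> where
    \<phi>: "\<And>i. \<phi> i \<in> test_functions G" "\<And>x. (\<Sum>i\<in>UNIV. partial_deriv i (\<phi> i) x) = 0" "u = (\<chi> i. sobolev_of (\<phi> i))"
    unfolding solenoidal_test_fields_def by blast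
  have "partial_deriv i (\<lambda>x. c * \<phi> i x) x = c * partial_deriv i (\<phi> i) x" for i x
    using test_function_C_1[OF \<phi>(1)] by (auto simp: partial_deriv_cmult)
  moreover have "c *\<^sub>R u = (\<chi> i. sobolev_of (\<lambda>x. c * \<phi> i x))"
    by (simp add: \<phi>(3) vec_eq_iff sobolev_of_cmult[OF \<phi>(1)])
  ultimately show "c *\<^sub>R u \<in> solenoidal_test_fields G"
    unfolding solenoidal_test_fields_def
    by (intro CollectI exI[of _ "\<lambda>i x. c * \<phi> i x"])
      (simp add: \<phi>(1,2) test_functions_cmult flip: sum_distrib_left)
qed

section \<open>Passing from test functions to their closure\<close>

lemma closed_H10: "closed (H10 G)"
  by (simp add: H10_def)

lemma closed_H10_field: "closed (H10_field G)"
proof -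
  have "H10_field G = (\<Inter>i. (\<lambda>u. u $ i) -` H10 G)" by (auto simp: H10_field_def)
  then show ?thesis
    by (auto intro!: closed_INT closed_vimage closed_H10 continuous_intros)
qed

lemma H10_solenoidal_subset: "H10_solenoidal G \<subseteq> H10_field G"
  unfolding H10_solenoidal_def
proof (rule closure_minimal[OF _ closed_H10_field])
  show "solenoidal_test_fields G \<subseteq> H10_field G"
    using closure_subset[of "sobolev_of ` test_functions G"]
    by (auto simp: solenoidal_test_fields_def H10_field_def H10_def)
qed

text \<open>A condition on representatives almost everywhere is not visibly closed under limits. It
  becomes so once the set is recognised as the orthogonal complement of the functions vanishing off
  \<open>A\<close>, an intersection of closed hyperplanes.\<close>

lemma closed_L2_vanishing:
  assumes A: "A \<in> sets borel"
  shows "closed {h :: 'a::euclidean_space L2. AE x in lborel. x \<in> A \<longrightarrow> rep_L2 h x = 0}" (is "closed ?S")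
proof -
  let ?T = "{g :: 'a L2. AE x in lborel. x \<notin> A \<longrightarrow> rep_L2 g x = 0}"
  have "?S = (\<Inter>g\<in>?T. {h. g \<bullet> h = 0})"
  proof (intro equalityI subsetI INT_I CollectI)
    fix h g :: "'a L2" assume "h \<in> ?S" "g \<in> ?T"
    then have "AE x in lborel. rep_L2 g x * rep_L2 h x = 0" by (auto elim!: AE_mp)
    then show "g \<bullet> h = 0" unfolding inner_rep_L2 by (rule integral_eq_zero_AE)
  next
    fix h assume h: "h \<in> (\<Inter>g\<in>?T. {h. g \<bullet> h = 0})"
    \<comment> \<open>The truncation of \<open>h\<close> itself is the right test element:
      \<open>g0 * h\<close> is the square of \<open>h\<close> on \<open>A\<close> and 0 elsewhere,
      so a vanishing integral forces it to vanish almost everywhere.\<close>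
    define g0 where "g0 x = indicator A x * rep_L2 h x" for x
    have g0_meas [measurable]: "g0 \<in> borel_measurable borel" unfolding g0_def using A by measurable
    have g0_le: "(g0 x)\<^sup>2 \<le> (rep_L2 h x)\<^sup>2" for x by (simp add: g0_def indicator_def)
    have h2: "integrable lborel (\<lambda>x. (rep_L2 h x)\<^sup>2)" using rep_L2_sq[of h] by (simp add: square_integrable_def)
    have g0: "square_integrable lborel g0"
      unfolding square_integrable_def
    proof
      show "integrable lborel (\<lambda>x. (g0 x)\<^sup>2)"
        by (rule Bochner_Integration.integrable_bound[OF h2]) (use g0_le in simp_all)
    qed (use g0_meas in simp)
    have AE: "AE x in lborel. rep_L2 (abs_L2 g0) x = g0 x" by (rule rep_abs_L2[OF g0])
    then have "abs_L2 g0 \<in> ?T" by (auto simp: g0_def elim!: AE_mp)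
    with h have "0 = abs_L2 g0 \<bullet> h" by auto
    also have "\<dots> = (\<integral>x. g0 x * rep_L2 h x \<partial>lborel)"
      using inner_abs_L2[OF g0 rep_L2_sq, of h] by (simp add: abs_rep_L2)
    finally have "(\<integral>x. g0 x * rep_L2 h x \<partial>lborel) = 0" by simp
    then have "AE x in lborel. g0 x * rep_L2 h x = 0"
      using square_integrable_mult[OF g0 rep_L2_sq[of h]]
      by (subst (asm) integral_nonneg_eq_0_iff_AE) (auto simp: g0_def indicator_def)
    then have "AE x in lborel. x \<in> A \<longrightarrow> rep_L2 h x = 0"
      by (rule AE_mp) (auto simp: g0_def indicator_def)
    then show "AE x in lborel. x \<in> A \<longrightarrow> rep_L2 h x = 0" .
  qed
  then show ?thesis by (auto intro!: closed_INT closed_hyperplane)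
qed

text \<open>True for test functions by their support, and kept in the closure by
  \<open>closed_L2_vanishing\<close>. It lets integrals over \<open>G\<close> of products of
  derivatives be read as inner products over the whole plane.\<close>

lemma deriv_at_outside:
  assumes "open G" and s: "s \<in> H10 G"
  shows "AE x in lborel. x \<notin> G \<longrightarrow> deriv_at j s x = 0"
proof -
  let ?C = "{h :: plane L2. AE x in lborel. x \<in> - G \<longrightarrow> rep_L2 h x = 0}"
  have "H10 G \<subseteq> (\<lambda>s. snd s $ j) -` ?C"
    unfolding H10_def
  proof (rule closure_minimal)
    show "closed ((\<lambda>s. snd s $ j) -` ?C)"
      using assms(1) by (intro closed_vimage closed_L2_vanishing) (auto intro!: continuous_intros)
    show "sobolev_of ` test_functions G \<subseteq> (\<lambda>s. snd s $ j) -` ?C"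
    proof (clarsimp simp: sobolev_of_sel)
      fix \<phi> assume \<phi>: "\<phi> \<in> test_functions G"
      show "AE x in lborel. x \<notin> G \<longrightarrow> rep_L2 (abs_L2 (partial_deriv j \<phi>)) x = 0"
        using rep_abs_L2[OF test_function_square_integrable(2)[OF \<phi>, of j]]
        by (rule AE_mp) (auto simp: test_function_outside[OF \<phi>])
    qed
  qed
  with s show ?thesis by (auto simp: deriv_at_def)
qed

text \<open>Both sides are continuous in the graph norm, so the bound survives the closure.\<close>

lemma poincare_H10:
  assumes "s \<in> H10 G" and G: "open G" "bounded G"
  shows "(norm (fst s))\<^sup>2 \<le> measure lborel G / 8 * (norm (snd s))\<^sup>2"
proof -
  have "H10 G \<subseteq> {s. (norm (fst s))\<^sup>2 \<le> measure lborel G / 8 * (norm (snd s))\<^sup>2}"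
    unfolding H10_def
  proof (rule closure_minimal)
    show "closed {s :: sobolev. (norm (fst s))\<^sup>2 \<le> measure lborel G / 8 * (norm (snd s))\<^sup>2}"
      by (intro closed_Collect_le continuous_intros)
    show "sobolev_of ` test_functions G \<subseteq> {s. (norm (fst s))\<^sup>2 \<le> measure lborel G / 8 * (norm (snd s))\<^sup>2}"
      using test_function_inequalities(1)[OF _ G] test_function_square_integrable(1)
      by (auto simp: sobolev_of_sel(1) norm_abs_L2)
  qed
  with assms(1) show ?thesis by auto
qed

lemma ladyzhenskaya_H10:
  assumes s: "s \<in> H10 G" and G: "open G" "bounded G"
  shows "integrable lborel (\<lambda>x. (value_at s x)^4)"
    and "(\<integral>x. (value_at s x)^4 \<partial>lborel) \<le> measure lborel G / 16 * (norm (snd s))^4"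
proof -
  define K where "K = measure lborel G / 16"
  obtain t where t: "\<And>n. t n \<in> sobolev_of ` test_functions G" "t \<longlonglongrightarrow> s"
    using s unfolding H10_def closure_sequential by blast
  then have "\<forall>n. \<exists>\<phi>. \<phi> \<in> test_functions G \<and> t n = sobolev_of \<phi>" by blast
  then obtain \<phi> where \<phi>: "\<And>n. \<phi> n \<in> test_functions G" "\<And>n. t n = sobolev_of (\<phi> n)"
    by metis
  define h where "h = rep_L2 (fst s)"
  have h_sq: "square_integrable lborel h" unfolding h_def by (rule rep_L2_sq)
  have [measurable]: "h \<in> borel_measurable borel" "\<phi> n \<in> borel_measurable borel" for n
    using C_1_continuous(1)[OF test_function_C_1[OF \<phi>(1)]]
    by (auto simp: h_def intro: borel_measurable_continuous_onI)
  note \<phi>_sq = test_function_square_integrable(1)[OF \<phi>(1)]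
  have "(\<lambda>n. (dist (fst (t n)) (fst s))\<^sup>2) \<longlonglongrightarrow> 0"
    using tendsto_power[OF tendsto_dist[OF tendsto_fst[OF t(2)] tendsto_const], of "fst s" 2] by simp
  moreover have "(dist (fst (t n)) (fst s))\<^sup>2 = (\<integral>x. norm ((\<phi> n x - h x)\<^sup>2) \<partial>lborel)" for n
    using dist_abs_L2[OF \<phi>_sq h_sq] by (simp add: \<phi>(2) sobolev_of_sel h_def abs_rep_L2)
  moreover have "integrable lborel (\<lambda>x. (\<phi> n x - h x)\<^sup>2)" for n
    using square_integrable_diff[OF \<phi>_sq h_sq] by (simp add: square_integrable_def)
  ultimately obtain r where r: "strict_mono r" "AE x in lborel. (\<lambda>n. (\<phi> (r n) x - h x)\<^sup>2) \<longlonglongrightarrow> 0"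
    using tendsto_L1_AE_subseq[of lborel "\<lambda>n x. (\<phi> n x - h x)\<^sup>2"] by auto
  have "(\<integral>\<^sup>+x. ennreal ((h x)^4) \<partial>lborel) = (\<integral>\<^sup>+x. liminf (\<lambda>n. ennreal ((\<phi> (r n) x)^4)) \<partial>lborel)"
  proof (rule nn_integral_cong_AE, use r(2) in \<open>rule AE_mp\<close>, intro AE_I2 impI)
    fix x assume "(\<lambda>n. (\<phi> (r n) x - h x)\<^sup>2) \<longlonglongrightarrow> 0"
    then have "(\<lambda>n. sqrt ((\<phi> (r n) x - h x)\<^sup>2)) \<longlonglongrightarrow> sqrt 0" by (rule tendsto_real_sqrt)
    then have "(\<lambda>n. \<phi> (r n) x - h x) \<longlonglongrightarrow> 0" by (simp add: tendsto_rabs_zero_iff)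
    then have "(\<lambda>n. \<phi> (r n) x) \<longlonglongrightarrow> h x" by (rule LIM_zero_cancel)
    then have "(\<lambda>n. ennreal ((\<phi> (r n) x)^4)) \<longlonglongrightarrow> ennreal ((h x)^4)"
      by (intro tendsto_ennrealI tendsto_intros)
    then show "ennreal ((h x)^4) = liminf (\<lambda>n. ennreal ((\<phi> (r n) x)^4))"
      using lim_imp_Liminf[OF sequentially_bot] by metis
  qed
  also have "\<dots> \<le> liminf (\<lambda>n. \<integral>\<^sup>+x. ennreal ((\<phi> (r n) x)^4) \<partial>lborel)"
    by (rule nn_integral_liminf) measurable
  also have "\<dots> \<le> liminf (\<lambda>n. ennreal (K * (norm (snd (t (r n))))^4))"
  proof (intro Liminf_mono always_eventually allI)
    fix n
    have "integrable lborel (\<lambda>x. (\<phi> (r n) x)^4)"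
      using C_1_continuous(1)[OF test_function_C_1[OF \<phi>(1)]] test_function_bounded_support[OF \<phi>(1)]
      by (intro integrable_bounded_support continuous_intros) auto
    then show "(\<integral>\<^sup>+x. ennreal ((\<phi> (r n) x)^4) \<partial>lborel) \<le> ennreal (K * (norm (snd (t (r n))))^4)"
      using test_function_inequalities(2)[OF \<phi>(1) G]
      by (subst nn_integral_eq_integral) (auto simp: \<phi>(2) K_def intro: ennreal_leI)
  qed
  also have "\<dots> = ennreal (K * (norm (snd s))^4)"
  proof -
    have "(\<lambda>n. t (r n)) \<longlonglongrightarrow> s" using LIMSEQ_subseq_LIMSEQ[OF t(2) r(1)] by (simp add: o_def)
    then have "(\<lambda>n. ennreal (K * (norm (snd (t (r n))))^4)) \<longlonglongrightarrow> ennreal (K * (norm (snd s))^4)"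
      by (intro tendsto_ennrealI tendsto_intros)
    then show ?thesis using lim_imp_Liminf[OF sequentially_bot] by metis
  qed
  finally have *: "(\<integral>\<^sup>+x. ennreal ((h x)^4) \<partial>lborel) \<le> ennreal (K * (norm (snd s))^4)" .
  have int: "integrable lborel (\<lambda>x. (h x)^4)"
    using le_less_trans[OF * ennreal_less_top] by (intro integrableI_nonneg) auto
  then show "integrable lborel (\<lambda>x. (value_at s x)^4)" by (simp add: h_def value_at_def)
  have "0 \<le> K" by (simp add: K_def)
  then have "(\<integral>x. (h x)^4 \<partial>lborel) \<le> K * (norm (snd s))^4"
    using * int by (simp add: nn_integral_eq_integral)
  then show "(\<integral>x. (value_at s x)^4 \<partial>lborel) \<le> measure lborel G / 16 * (norm (snd s))^4"
    by (simp add: h_def value_at_def K_def)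
qed

section \<open>Gradients as elements of a Hilbert space\<close>

lemma rep_L2_add: "AE x in lborel. rep_L2 (a + b) x = rep_L2 a x + rep_L2 b x"
  using rep_abs_L2[OF square_integrable_add[OF rep_L2_sq[of a] rep_L2_sq[of b]]]
  by (simp add: abs_L2_add rep_L2_sq abs_rep_L2)

lemma rep_L2_scaleR: "AE x in lborel. rep_L2 (c *\<^sub>R a) x = c * rep_L2 a x"
  using rep_abs_L2[OF square_integrable_scale[OF rep_L2_sq[of a], of c]]
  by (simp add: abs_L2_scale rep_L2_sq abs_rep_L2)

text \<open>Forgetting the function values turns the norm and the inner product of the problem into
  those of a Hilbert space, pulled back along a bounded linear map. The abstract argument refers to
  nothing else about derivatives.\<close>

definition gradient :: "sobolev_field \<Rightarrow> plane L2 ^ 2 ^ 2" where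
  "gradient u = (\<chi> i. snd (u $ i))"

lemma bounded_linear_gradient: "bounded_linear gradient"
proof (rule bounded_linear_intro)
  fix u :: sobolev_field
  have "norm (gradient u) \<le> norm u"
    using norm_snd_le[of "snd (u $ i)" "fst (u $ i)" for i]
    unfolding norm_vec_def[of "gradient u"] norm_vec_def[of u] by (intro L2_set_mono) (simp_all add: gradient_def)
  then show "norm (gradient u) \<le> norm u * 1" by simp
qed (simp_all add: gradient_def vec_eq_iff)

lemma grad_inner_eq:
  assumes "open G" "u \<in> H10_field G"
  shows "grad_inner G u v = gradient u \<bullet> gradient v"
proof -
  have "(\<integral>x\<in>G. deriv_at j (u $ i) x * deriv_at j (v $ i) x \<partial>lborel) = snd (u $ i) $ j \<bullet> snd (v $ i) $ j" for i j
    unfolding inner_rep_L2 set_lebesgue_integral_def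
  proof (rule integral_cong_AE)
    have "AE x in lborel. x \<notin> G \<longrightarrow> deriv_at j (u $ i) x = 0"
      using deriv_at_outside[OF assms(1)] assms(2) by (simp add: H10_field_def)
    then show "AE x in lborel. indicat_real G x *\<^sub>R (deriv_at j (u $ i) x * deriv_at j (v $ i) x) =
        rep_L2 (snd (u $ i) $ j) x * rep_L2 (snd (v $ i) $ j) x"
      by (rule AE_mp) (auto simp: deriv_at_def indicator_def)
  qed (use assms(1) in \<open>auto simp: deriv_at_def\<close>)
  then show ?thesis by (simp add: grad_inner_def inner_vec_def gradient_def)
qed

lemma H1_norm_eq:
  assumes "open G" "u \<in> H10_field G"
  shows "H1_norm G u = norm (gradient u)"
  using grad_inner_eq[OF assms, of u]
  by (simp add: H1_norm_def grad_inner_def power2_eq_square norm_eq_sqrt_inner)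

lemma grad_norm_eq:
  assumes G: "open G" and s: "s \<in> H10 G"
  shows "grad_norm G s = norm (snd s)"
proof -
  have [measurable]: "G \<in> sets borel" using G by simp
  have "AE x in lborel. x \<notin> G \<longrightarrow> deriv_at j s x = 0" for j
    by (rule deriv_at_outside[OF assms])
  then have "AE x in lborel. \<forall>j. x \<notin> G \<longrightarrow> deriv_at j s x = 0"
    by (subst AE_all_countable) blast
  then have "(\<integral>x\<in>G. (\<Sum>j\<in>UNIV. (deriv_at j s x)\<^sup>2) \<partial>lborel) = (\<integral>x. (\<Sum>j\<in>UNIV. (rep_L2 (snd s $ j) x)\<^sup>2) \<partial>lborel)"
    unfolding set_lebesgue_integral_def
    by (intro integral_cong_AE) (auto simp: deriv_at_def indicator_def elim!: AE_mp)
  also have "\<dots> = (\<Sum>j\<in>UNIV. (norm (snd s $ j))\<^sup>2)"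
    using rep_L2_sq by (subst Bochner_Integration.integral_sum)
      (auto simp: square_integrable_def power2_norm_eq_inner inner_rep_L2 simp flip: power2_eq_square)
  finally show ?thesis by (simp add: grad_norm_def norm_vec_def L2_set_def)
qed

text \<open>The squared graph norm adds the squared gradient to the squared function, whence the 1
  next to the constant of \<open>poincare_H10\<close>.\<close>

lemma poincare_H10_field:
  assumes u: "u \<in> H10_field G" and G: "open G" "bounded G"
  shows "(norm u)\<^sup>2 \<le> (1 + measure lborel G / 8) * (norm (gradient u))\<^sup>2"
proof -
  have "(norm (u $ i))\<^sup>2 \<le> (1 + measure lborel G / 8) * (norm (gradient u $ i))\<^sup>2" for i
    using poincare_H10[OF _ G, of "u $ i"] u
    by (simp add: H10_field_def gradient_def norm_prod_def algebra_simps)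
  from this[of 1] this[of 2] show ?thesis
    by (simp add: norm_vec2_squared algebra_simps)
qed

section \<open>Triple products and the trilinear form\<close>

definition fourth_power_integrable :: "plane L2 \<Rightarrow> bool" where
  "fourth_power_integrable a \<longleftrightarrow> integrable lborel (\<lambda>x. (rep_L2 a x)^4)"

lemma fourth_power_product:
  assumes "fourth_power_integrable a" "fourth_power_integrable c"
  shows "square_integrable lborel (\<lambda>x. rep_L2 a x * rep_L2 c x)"
    and "(\<integral>x. (rep_L2 a x * rep_L2 c x)\<^sup>2 \<partial>lborel)
      \<le> sqrt (\<integral>x. (rep_L2 a x)^4 \<partial>lborel) * sqrt (\<integral>x. (rep_L2 c x)^4 \<partial>lborel)"
proof -
  have sq: "square_integrable lborel (\<lambda>x. (rep_L2 b x)\<^sup>2)" if "fourth_power_integrable b" for b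
    using that by (simp add: square_integrable_def fourth_power_integrable_def)
  show "square_integrable lborel (\<lambda>x. rep_L2 a x * rep_L2 c x)"
    using square_integrable_mult[OF sq[OF assms(1)] sq[OF assms(2)]]
    by (simp add: square_integrable_def power_mult_distrib)
  show "(\<integral>x. (rep_L2 a x * rep_L2 c x)\<^sup>2 \<partial>lborel)
      \<le> sqrt (\<integral>x. (rep_L2 a x)^4 \<partial>lborel) * sqrt (\<integral>x. (rep_L2 c x)^4 \<partial>lborel)"
    using Cauchy_Schwarz_square_integrable[OF sq[OF assms(1)] sq[OF assms(2)]]
    by (simp add: power_mult_distrib)
qed

definition triple :: "plane set \<Rightarrow> plane L2 \<Rightarrow> plane L2 \<Rightarrow> plane L2 \<Rightarrow> real" where
  "triple G a b c = (\<integral>x\<in>G. rep_L2 a x * rep_L2 b x * rep_L2 c x \<partial>lborel)"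

lemma triple_integrable:
  assumes "fourth_power_integrable a" "fourth_power_integrable c" and "open G"
  shows "set_integrable lborel G (\<lambda>x. rep_L2 a x * rep_L2 b x * rep_L2 c x)"
proof -
  have "integrable lborel (\<lambda>x. rep_L2 a x * rep_L2 c x * rep_L2 b x)"
    using fourth_power_product(1)[OF assms(1,2)] rep_L2_sq by (rule square_integrable_mult)
  then have "set_integrable lborel UNIV (\<lambda>x. rep_L2 a x * rep_L2 b x * rep_L2 c x)"
    by (simp add: set_integrable_def mult_ac)
  then show ?thesis by (rule set_integrable_subset) (use assms(3) in auto)
qed

text \<open>Hoelder's inequality with exponents 4, 2, 4, obtained from Cauchy-Schwarz twice: once to
  separate \<open>b\<close> from the product of \<open>a\<close> and \<open>c\<close>, and once, in
  \<open>fourth_power_product\<close>, to separate \<open>a\<close> from \<open>c\<close>.\<close>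

lemma triple_bound:
  assumes ac: "fourth_power_integrable a" "fourth_power_integrable c" and G: "open G"
    and F: "(\<integral>x. (rep_L2 a x)^4 \<partial>lborel) \<le> p^4" "0 \<le> p"
    and H: "(\<integral>x. (rep_L2 c x)^4 \<partial>lborel) \<le> q^4" "0 \<le> q"
  shows "\<bar>triple G a b c\<bar> \<le> p * norm b * q"
proof -
  note sq = fourth_power_product(1)[OF ac]
  have sqrt4: "sqrt (r^4) = r\<^sup>2" for r :: real
    using real_sqrt_abs[of "r\<^sup>2"] by simp
  have "sqrt (\<integral>x. (rep_L2 a x)^4 \<partial>lborel) \<le> p\<^sup>2" "sqrt (\<integral>x. (rep_L2 c x)^4 \<partial>lborel) \<le> q\<^sup>2"
    using real_sqrt_le_mono[OF F(1)] real_sqrt_le_mono[OF H(1)] by (simp_all add: sqrt4)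
  then have "sqrt (\<integral>x. (rep_L2 a x)^4 \<partial>lborel) * sqrt (\<integral>x. (rep_L2 c x)^4 \<partial>lborel) \<le> p\<^sup>2 * q\<^sup>2"
    by (intro mult_mono) auto
  with fourth_power_product(2)[OF ac]
  have "(\<integral>x. (rep_L2 a x * rep_L2 c x)\<^sup>2 \<partial>lborel) \<le> (p * q)\<^sup>2" by (simp add: power_mult_distrib)
  from real_sqrt_le_mono[OF this] have pq: "sqrt (\<integral>x. (rep_L2 a x * rep_L2 c x)\<^sup>2 \<partial>lborel) \<le> p * q"
    using F(2) H(2) by simp
  have "\<bar>triple G a b c\<bar> \<le> (\<integral>x\<in>G. \<bar>rep_L2 a x * rep_L2 b x * rep_L2 c x\<bar> \<partial>lborel)"
    unfolding triple_def using set_integral_norm_bound[OF triple_integrable[OF ac G], of b] by simp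
  also have "\<dots> \<le> (\<integral>x. \<bar>(rep_L2 a x * rep_L2 c x) * rep_L2 b x\<bar> \<partial>lborel)"
    unfolding set_lebesgue_integral_def
  proof (rule integral_mono)
    show "integrable lborel (\<lambda>x. indicat_real G x *\<^sub>R \<bar>rep_L2 a x * rep_L2 b x * rep_L2 c x\<bar>)"
      using set_integrable_abs[OF triple_integrable[OF ac G, of b]] by (simp add: set_integrable_def)
    show "integrable lborel (\<lambda>x. \<bar>(rep_L2 a x * rep_L2 c x) * rep_L2 b x\<bar>)"
      by (intro integrable_abs square_integrable_mult[OF sq rep_L2_sq])
  qed (auto simp: indicator_def abs_mult)
  also have "\<dots> \<le> sqrt (\<integral>x. (rep_L2 a x * rep_L2 c x)\<^sup>2 \<partial>lborel) * sqrt (\<integral>x. (rep_L2 b x)\<^sup>2 \<partial>lborel)"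
    by (rule Cauchy_Schwarz_square_integrable[OF sq rep_L2_sq])
  also have "sqrt (\<integral>x. (rep_L2 b x)\<^sup>2 \<partial>lborel) = norm b"
    by (simp add: norm_eq_sqrt_inner inner_rep_L2 power2_eq_square)
  also have "sqrt (\<integral>x. (rep_L2 a x * rep_L2 c x)\<^sup>2 \<partial>lborel) * norm b \<le> (p * q) * norm b"
    by (intro mult_right_mono pq) simp
  finally show ?thesis by (simp add: mult_ac)
qed

lemma set_integral_eqI_AE:
  fixes f g :: "'a::euclidean_space \<Rightarrow> real"
  assumes "AE x in lborel. f x = g x" "f \<in> borel_measurable borel" "g \<in> borel_measurable borel" "A \<in> sets borel"
  shows "(\<integral>x\<in>A. f x \<partial>lborel) = (\<integral>x\<in>A. g x \<partial>lborel)"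
  unfolding set_lebesgue_integral_def using assms
  by (intro integral_cong_AE) auto

lemma triple_add:
  assumes "fourth_power_integrable c" and G: "open G"
  shows "fourth_power_integrable a \<Longrightarrow> fourth_power_integrable a' \<Longrightarrow>
      triple G (a + a') b c = triple G a b c + triple G a' b c"
    and "fourth_power_integrable a \<Longrightarrow> triple G a (b + b') c = triple G a b c + triple G a b' c"
    and "fourth_power_integrable a \<Longrightarrow> fourth_power_integrable a' \<Longrightarrow>
      triple G c b (a + a') = triple G c b a + triple G c b a'"
proof -
  have [measurable]: "G \<in> sets borel" using G by simp
  note int = triple_integrable[OF _ _ G]
  show "triple G (a + a') b c = triple G a b c + triple G a' b c"
    if "fourth_power_integrable a" "fourth_power_integrable a'"
    unfolding triple_def set_integral_add(2)[OF int[OF that(1) assms(1)] int[OF that(2) assms(1)], symmetric]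
    by (rule set_integral_eqI_AE) (use rep_L2_add[of a a'] in \<open>auto simp: algebra_simps elim!: AE_mp\<close>)
  show "triple G a (b + b') c = triple G a b c + triple G a b' c"
    if "fourth_power_integrable a"
    unfolding triple_def set_integral_add(2)[OF int[OF that(1) assms(1)] int[OF that(1) assms(1)], symmetric]
    by (rule set_integral_eqI_AE) (use rep_L2_add[of b b'] in \<open>auto simp: algebra_simps elim!: AE_mp\<close>)
  show "triple G c b (a + a') = triple G c b a + triple G c b a'"
    if "fourth_power_integrable a" "fourth_power_integrable a'"
    unfolding triple_def set_integral_add(2)[OF int[OF assms(1) that(1)] int[OF assms(1) that(2)], symmetric]
    by (rule set_integral_eqI_AE) (use rep_L2_add[of a a'] in \<open>auto simp: algebra_simps elim!: AE_mp\<close>)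
qed

lemma triple_scaleR:
  assumes G: "open G"
  shows "triple G (r *\<^sub>R a) b c = r * triple G a b c"
    and "triple G a (r *\<^sub>R b) c = r * triple G a b c"
    and "triple G a b (r *\<^sub>R c) = r * triple G a b c"
proof -
  have [measurable]: "G \<in> sets borel" using G by simp
  show "triple G (r *\<^sub>R a) b c = r * triple G a b c"
    unfolding triple_def set_integral_mult_right[symmetric]
    by (rule set_integral_eqI_AE) (use rep_L2_scaleR[of r a] in \<open>auto simp: algebra_simps elim!: AE_mp\<close>)
  show "triple G a (r *\<^sub>R b) c = r * triple G a b c"
    unfolding triple_def set_integral_mult_right[symmetric]
    by (rule set_integral_eqI_AE) (use rep_L2_scaleR[of r b] in \<open>auto simp: algebra_simps elim!: AE_mp\<close>)
  show "triple G a b (r *\<^sub>R c) = r * triple G a b c"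
    unfolding triple_def set_integral_mult_right[symmetric]
    by (rule set_integral_eqI_AE) (use rep_L2_scaleR[of r c] in \<open>auto simp: algebra_simps elim!: AE_mp\<close>)
qed

lemma fourth_power_integrable_H10_field:
  "u \<in> H10_field G \<Longrightarrow> open G \<Longrightarrow> bounded G \<Longrightarrow> fourth_power_integrable (fst (u $ i))"
  using ladyzhenskaya_H10(1)[of "u $ i" G] by (simp add: fourth_power_integrable_def value_at_def H10_field_def)

lemma trilinear_eq_triple:
  assumes G: "open G" "bounded G" and u: "u \<in> H10_field G" and w: "w \<in> H10_field G"
  shows "trilinear G u v w = (\<Sum>i\<in>UNIV. \<Sum>j\<in>UNIV. triple G (fst (u $ j)) (snd (v $ i) $ j) (fst (w $ i)))"
proof -
  note int = triple_integrable[OF fourth_power_integrable_H10_field[OF u G] fourth_power_integrable_H10_field[OF w G] G(1)]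
  then have int': "integrable lborel (\<lambda>x. indicat_real G x * (rep_L2 (fst (u $ j)) x * rep_L2 b x * rep_L2 (fst (w $ i)) x))" for i j b
    by (simp add: set_integrable_def)
  show ?thesis
    unfolding trilinear_def triple_def value_at_def deriv_at_def set_lebesgue_integral_def
    by (simp only: real_scaleR_def sum_distrib_left Bochner_Integration.integral_sum Bochner_Integration.integrable_sum int')
qed

lemma sum_norm_mult_le:
  fixes y :: "'a::real_normed_vector ^ 'n" and z :: "'b::real_normed_vector ^ 'n"
  shows "(\<Sum>i\<in>UNIV. norm (y $ i) * norm (z $ i)) \<le> norm y * norm z"
  using L2_set_mult_ineq[of "\<lambda>i. norm (y $ i)" "\<lambda>i. norm (z $ i)" UNIV] by (simp add: norm_vec_def)

lemma trilinear_bound: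
  assumes G: "open G" "bounded G" and u: "u \<in> H10_field G" and w: "w \<in> H10_field G"
  shows "\<bar>trilinear G u v w\<bar> \<le> sqrt (measure lborel G) / 4 * norm (gradient u) * norm (gradient v) * norm (gradient w)"
proof -
  \<comment> \<open>\<open>k\<close> is the fourth root of the constant in
    \<open>ladyzhenskaya_H10\<close>. The two undifferentiated factors contribute \<open>k\<close>
    each, so that \<open>k^2 = sqrt |G| / 4\<close> is the final constant.\<close>
  define k where "k = sqrt (sqrt (measure lborel G) / 4)"
  have k: "0 \<le> k" and k2: "k\<^sup>2 = sqrt (measure lborel G) / 4" by (simp_all add: k_def)
  have k4: "k^4 = measure lborel G / 16"
  proof -
    have "k^4 = (k\<^sup>2)\<^sup>2" by simp
    also have "\<dots> = measure lborel G / 16" unfolding k2 by (simp add: power_divide)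
    finally show ?thesis .
  qed
  have L4: "(\<integral>x. (rep_L2 (fst (z $ i)) x)^4 \<partial>lborel) \<le> (k * norm (gradient z $ i))^4" if "z \<in> H10_field G" for z i
    using ladyzhenskaya_H10(2)[OF _ G, of "z $ i"] that
    by (simp add: H10_field_def value_at_def gradient_def power_mult_distrib k4)
  have t: "\<bar>triple G (fst (u $ j)) (snd (v $ i) $ j) (fst (w $ i))\<bar>
      \<le> k * norm (gradient u $ j) * norm (gradient v $ i $ j) * (k * norm (gradient w $ i))" for i j
    using triple_bound[OF fourth_power_integrable_H10_field[OF u G] fourth_power_integrable_H10_field[OF w G] G(1)
        L4[OF u] _ L4[OF w], of j i "snd (v $ i) $ j"] k
    by (simp add: gradient_def)
  have "\<bar>trilinear G u v w\<bar> \<le> (\<Sum>i\<in>UNIV. \<Sum>j\<in>UNIV. k * norm (gradient u $ j) * norm (gradient v $ i $ j) * (k * norm (gradient w $ i)))"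
    unfolding trilinear_eq_triple[OF G u w]
    by (intro order_trans[OF sum_abs] sum_mono t)
  also have "\<dots> = k\<^sup>2 * (\<Sum>i\<in>UNIV. (\<Sum>j\<in>UNIV. norm (gradient u $ j) * norm (gradient v $ i $ j)) * norm (gradient w $ i))"
    by (simp add: sum_distrib_left sum_distrib_right power2_eq_square mult_ac)
  \<comment> \<open>Cauchy-Schwarz over the components, in the index \<open>j\<close> shared by
    \<open>u\<close> and the derivative of \<open>v\<close>; the index \<open>i\<close> follows in
    the same way. So no factor counting components appears.\<close>
  also have "\<dots> \<le> k\<^sup>2 * (\<Sum>i\<in>UNIV. (norm (gradient u) * norm (gradient v $ i)) * norm (gradient w $ i))"
    by (intro mult_left_mono sum_mono mult_right_mono sum_norm_mult_le) auto
  also have "\<dots> = k\<^sup>2 * (norm (gradient u) * (\<Sum>i\<in>UNIV. norm (gradient v $ i) * norm (gradient w $ i)))"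
    by (simp add: sum_distrib_left mult_ac)
  also have "\<dots> \<le> k\<^sup>2 * (norm (gradient u) * (norm (gradient v) * norm (gradient w)))"
    by (intro mult_left_mono sum_norm_mult_le) auto
  finally show ?thesis by (simp add: k2 mult_ac)
qed

lemma trilinear_add:
  assumes G: "open G" "bounded G" and u: "u \<in> H10_field G" and w: "w \<in> H10_field G"
  shows "u' \<in> H10_field G \<Longrightarrow> trilinear G (u + u') v w = trilinear G u v w + trilinear G u' v w"
    and "trilinear G u (v + v') w = trilinear G u v w + trilinear G u v' w"
    and "w' \<in> H10_field G \<Longrightarrow> trilinear G u v (w + w') = trilinear G u v w + trilinear G u v w'"
  by (simp_all add: trilinear_eq_triple[OF G] u w subspace_add[OF subspace_H10_field] sum.distrib
      triple_add G fourth_power_integrable_H10_field[OF _ G])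

lemma trilinear_scaleR:
  assumes G: "open G" "bounded G" and u: "u \<in> H10_field G" and w: "w \<in> H10_field G"
  shows "trilinear G (r *\<^sub>R u) v w = r * trilinear G u v w"
    and "trilinear G u (r *\<^sub>R v) w = r * trilinear G u v w"
    and "trilinear G u v (r *\<^sub>R w) = r * trilinear G u v w"
  by (simp_all add: trilinear_eq_triple[OF G] u w subspace_scale[OF subspace_H10_field] sum_distrib_left
      triple_scaleR G)

text \<open>The integrand is half of a divergence: the \<open>j\<close>-th derivative of \<phi>_j
  \<psi>_i^2 is twice the advection term plus the \<open>j\<close>-th derivative of \<phi>_j times
  \<psi>_i^2, and the latter terms sum over \<open>j\<close> to zero because \<phi> is solenoidal. A
  derivative of a function with bounded support has integral zero.\<close>

lemma trilinear_skew:
  assumes u: "u \<in> solenoidal_test_fields G" and v: "v \<in> solenoidal_test_fields G" and "open G"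
  shows "trilinear G u v v = 0"
proof -
  obtain \<phi> where
    \<phi>: "\<And>i. \<phi> i \<in> test_functions G" "\<And>x. (\<Sum>i\<in>UNIV. partial_deriv i (\<phi> i) x) = 0" "u = (\<chi> i. sobolev_of (\<phi> i))"
    using u unfolding solenoidal_test_fields_def by blast
  obtain \<psi> where \<psi>: "\<And>i. \<psi> i \<in> test_functions G" "v = (\<chi> i. sobolev_of (\<psi> i))"
    using v unfolding solenoidal_test_fields_def by blast
  note C1 = test_function_C_1[OF \<phi>(1)] test_function_C_1[OF \<psi>(1)]
  define F where "F i j x = \<phi> j x * (\<psi> i x * \<psi> i x)" for i j x
  have F_C1: "C_k (Suc 0) (F i j)" for i j
    unfolding F_def by (intro C_1_mult C1)
  have F_bd: "bounded {x. F i j x \<noteq> 0}" for i j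
    using test_function_bounded_support[OF \<phi>(1)[of j]] by (rule bounded_subset) (auto simp: F_def)
  have dF: "partial_deriv j (F i j) x
      = 2 * (\<phi> j x * partial_deriv j (\<psi> i) x * \<psi> i x) + partial_deriv j (\<phi> j) x * (\<psi> i x * \<psi> i x)" for i j x
  proof -
    have "\<phi> j differentiable at x" "\<psi> i differentiable at x" using C1 by auto
    then show ?thesis
      unfolding F_def by (simp add: partial_deriv_mult differentiable_mult)
  qed
  have "AE x in lborel. \<forall>j. value_at (u $ j) x = \<phi> j x"
    using rep_abs_L2[OF test_function_square_integrable(1)[OF \<phi>(1)]]
    by (simp add: \<phi>(3) value_at_def sobolev_of_sel AE_all_countable)
  moreover have "AE x in lborel. \<forall>i. value_at (v $ i) x = \<psi> i x"
    using rep_abs_L2[OF test_function_square_integrable(1)[OF \<psi>(1)]]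
    by (simp add: \<psi>(2) value_at_def sobolev_of_sel AE_all_countable)
  moreover have "AE x in lborel. \<forall>i j. deriv_at j (v $ i) x = partial_deriv j (\<psi> i) x"
    using rep_abs_L2[OF test_function_square_integrable(2)[OF \<psi>(1)]]
    by (simp add: \<psi>(2) deriv_at_def sobolev_of_sel AE_all_countable)
  ultimately have AE: "AE x in lborel. indicator G x *\<^sub>R
      (\<Sum>i\<in>UNIV. \<Sum>j\<in>UNIV. value_at (u $ j) x * deriv_at j (v $ i) x * value_at (v $ i) x)
      = (\<Sum>i\<in>UNIV. \<Sum>j\<in>UNIV. partial_deriv j (F i j) x / 2)"
  proof eventually_elim
    case (elim x)
    have "(\<Sum>j\<in>UNIV. partial_deriv j (F i j) x / 2) = (\<Sum>j\<in>UNIV. \<phi> j x * partial_deriv j (\<psi> i) x * \<psi> i x)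
        + (\<Sum>j\<in>UNIV. partial_deriv j (\<phi> j) x) * (\<psi> i x * \<psi> i x) / 2" for i
      by (simp add: dF add_divide_distrib sum.distrib sum_distrib_right flip: sum_divide_distrib)
    then show ?case
      using elim by (cases "x \<in> G") (simp_all add: \<phi>(2) test_function_outside(1)[OF \<psi>(1)])
  qed
  have int: "integrable lborel (partial_deriv j (F i j))" for i j
    using C_1_continuous(2)[OF F_C1] bounded_support_partial_deriv[OF F_bd] by (rule integrable_bounded_support)
  have [measurable]: "G \<in> sets borel" using assms(3) by simp
  have [measurable]: "partial_deriv j (F i j) \<in> borel_measurable borel" for i j
    using int[of j i] by auto
  have "trilinear G u v v = (\<integral>x. (\<Sum>i\<in>UNIV. \<Sum>j\<in>UNIV. partial_deriv j (F i j) x / 2) \<partial>lborel)"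
    unfolding trilinear_def set_lebesgue_integral_def
    by (rule integral_cong_AE[OF _ _ AE]) (simp_all add: value_at_def deriv_at_def)
  also have "\<dots> = 0"
    using integral_partial_deriv[OF F_C1 F_bd] int by (simp add: integrable_divide)
  finally show ?thesis .
qed

text \<open>Rescaling to unit gradient norm brings the argument into the set whose supremum is the
  dual norm. The crude constant \<open>C\<close> guarantees that this set is bounded above, and it
  settles the case of zero norm, where rescaling is impossible.\<close>

lemma dual_norm_bound:
  assumes G: "open G" and C: "\<And>\<phi>. \<phi> \<in> H10 G \<Longrightarrow> \<bar>l \<phi>\<bar> \<le> C * grad_norm G \<phi>"
    and scale: "\<And>c \<phi>. \<phi> \<in> H10 G \<Longrightarrow> l (c *\<^sub>R \<phi>) = c * l \<phi>" and \<phi>: "\<phi> \<in> H10 G"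
  shows "\<bar>l \<phi>\<bar> \<le> dual_norm G l * grad_norm G \<phi>"
proof (cases "grad_norm G \<phi> = 0")
  case True
  then show ?thesis using C[OF \<phi>] by simp
next
  case False
  define n where "n = grad_norm G \<phi>"
  have n: "0 < n" using False by (simp add: n_def grad_norm_eq[OF G \<phi>])
  define \<psi> where "\<psi> = inverse n *\<^sub>R \<phi>"
  have \<psi>: "\<psi> \<in> H10 G" unfolding \<psi>_def using subspace_scale[OF subspace_H10 \<phi>] .
  have "grad_norm G \<psi> = 1"
    unfolding grad_norm_eq[OF G \<psi>] using n by (simp add: \<psi>_def n_def grad_norm_eq[OF G \<phi>])
  moreover have "bdd_above {\<bar>l \<phi>\<bar> | \<phi>. \<phi> \<in> H10 G \<and> grad_norm G \<phi> \<le> 1}"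
  proof (rule bdd_aboveI)
    fix y assume "y \<in> {\<bar>l \<phi>\<bar> | \<phi>. \<phi> \<in> H10 G \<and> grad_norm G \<phi> \<le> 1}"
    then obtain \<eta> where \<eta>: "y = \<bar>l \<eta>\<bar>" "\<eta> \<in> H10 G" "grad_norm G \<eta> \<le> 1" by blast
    have "y \<le> C * grad_norm G \<eta>" using C[OF \<eta>(2)] \<eta>(1) by simp
    also have "\<dots> \<le> \<bar>C\<bar> * 1"
      using \<eta> grad_norm_eq[OF G \<eta>(2)] by (intro mult_mono) auto
    finally show "y \<le> \<bar>C\<bar> * 1" .
  qed
  ultimately have "\<bar>l \<psi>\<bar> \<le> dual_norm G l"
    unfolding dual_norm_def using \<psi> by (intro cSup_upper CollectI exI[of _ \<psi>]) auto
  moreover have "l \<psi> = inverse n * l \<phi>" unfolding \<psi>_def by (rule scale[OF \<phi>])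
  ultimately show ?thesis using n by (simp add: abs_mult n_def[symmetric] field_simps)
qed

text \<open>The dual norm is defined component by component. A field is the sum of its two
  single-component fields, so the scalar bound applies to each, and Cauchy-Schwarz in two dimensions
  recombines them.\<close>

lemma Hm1_norm_bound:
  assumes G: "open G" and l: "l \<in> Hm1_field G" and u: "u \<in> H10_field G"
  shows "\<bar>l u\<bar> \<le> Hm1_norm G l * norm (gradient u)"
proof -
  obtain C where C: "\<And>u. u \<in> H10_field G \<Longrightarrow> \<bar>l u\<bar> \<le> C * H1_norm G u"
    using l unfolding Hm1_field_def by blast
  have ax: "axis i s \<in> H10_field G" if "s \<in> H10 G" for i :: 2 and s
    using that subspace_0[OF subspace_H10] by (auto simp: H10_field_def axis_def)
  have gax: "norm (gradient (axis i s)) = norm (snd s)" for i :: 2 and s :: sobolev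
  proof -
    have "gradient (axis i s) = axis i (snd s)" by (auto simp: gradient_def axis_def vec_eq_iff)
    moreover have "(norm (axis i y))\<^sup>2 = (norm y)\<^sup>2" for y :: "plane L2 ^ 2"
      using exhaust_2[of i] by (auto simp: norm_vec2_squared axis_def)
    ultimately show ?thesis by (metis norm_ge_zero power2_eq_imp_eq)
  qed
  define d where "d i = dual_norm G (\<lambda>\<phi>. l (axis i \<phi>))" for i
  have d: "\<bar>l (axis i s)\<bar> \<le> d i * norm (snd s)" if s: "s \<in> H10 G" for i s
  proof -
    have scale: "l (axis i (c *\<^sub>R \<phi>)) = c * l (axis i \<phi>)" if "\<phi> \<in> H10 G" for c \<phi>
    proof -
      have "axis i (c *\<^sub>R \<phi>) = c *\<^sub>R axis i \<phi>" by (simp add: axis_def vec_eq_iff)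
      then show ?thesis using l ax[OF that] by (simp add: Hm1_field_def)
    qed
    show ?thesis
      unfolding d_def grad_norm_eq[OF G s, symmetric]
    proof (rule dual_norm_bound[OF G _ scale s])
      show "\<bar>l (axis i \<phi>)\<bar> \<le> C * grad_norm G \<phi>" if "\<phi> \<in> H10 G" for \<phi>
        using C[OF ax[OF that]] by (simp add: H1_norm_eq[OF G ax[OF that]] gax grad_norm_eq[OF G that])
    qed
  qed
  have ui: "u $ i \<in> H10 G" for i using u by (simp add: H10_field_def)
  have "u = axis 1 (u $ 1) + axis 2 (u $ 2)"
    by (simp add: vec_eq_iff forall_2 axis_def)
  moreover have "l (axis 1 (u $ 1) + axis 2 (u $ 2)) = l (axis 1 (u $ 1)) + l (axis 2 (u $ 2))"
    using l ax[OF ui] unfolding Hm1_field_def by blast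
  ultimately have "l u = l (axis 1 (u $ 1)) + l (axis 2 (u $ 2))" by metis
  then have "\<bar>l u\<bar> \<le> \<bar>l (axis 1 (u $ 1))\<bar> + \<bar>l (axis 2 (u $ 2))\<bar>" by simp
  also have "\<dots> \<le> d 1 * norm (snd (u $ 1)) + d 2 * norm (snd (u $ 2))" by (intro add_mono d ui)
  also have "\<dots> \<le> \<bar>d 1\<bar> * norm (snd (u $ 1)) + \<bar>d 2\<bar> * norm (snd (u $ 2))"
    by (intro add_mono mult_right_mono) auto
  also have "\<dots> \<le> norm (\<chi> i. d i) * norm (gradient u)"
    using sum_norm_mult_le[of "\<chi> i. d i" "gradient u"] by (simp add: UNIV_2 gradient_def)
  also have "norm (\<chi> i. d i) = Hm1_norm G l"
    by (simp add: Hm1_norm_def d_def norm_vec_def L2_set_def)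
  finally show ?thesis .
qed

section \<open>Random elements of a closed subspace\<close>

text \<open>One point is picked from each basic open set that meets \<open>S\<close>, so the
  sequence lies in \<open>S\<close> itself and not merely in the ambient space. It serves to
  approximate within a subspace and to reduce uncountably many exceptional sets to countably
  many.\<close>

lemma dense_sequence:
  fixes S :: "'a::{metric_space, second_countable_topology} set"
  assumes "S \<noteq> {}"
  obtains q :: "nat \<Rightarrow> 'a" where "\<And>n. q n \<in> S" "S \<subseteq> closure (range q)"
proof -
  obtain B :: "'a set set" where B: "countable B" "topological_basis B"
    using ex_countable_basis by auto
  \<comment> \<open>Basic sets that miss \<open>S\<close> receive an arbitrary point of
    \<open>S\<close>, which keeps the whole sequence in \<open>S\<close>.\<close>
  define p where "p b = (if b \<inter> S \<noteq> {} then SOME x. x \<in> b \<inter> S else SOME x. x \<in> S)" for b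
  have p: "p b \<in> S" "b \<inter> S \<noteq> {} \<Longrightarrow> p b \<in> b" for b
    using some_in_eq[of "b \<inter> S"] some_in_eq[of S] assms by (auto simp: p_def)
  have "B \<noteq> {}"
  proof
    assume "B = {}"
    moreover from assms obtain x where "x \<in> S" by blast
    ultimately show False using topological_basisE[OF B(2) open_UNIV UNIV_I, of x] by blast
  qed
  define q where "q n = p (from_nat_into B n)" for n
  show ?thesis
  proof
    show "q n \<in> S" for n by (simp add: q_def p)
    show "S \<subseteq> closure (range q)"
    proof
      fix x assume x: "x \<in> S"
      show "x \<in> closure (range q)"
        unfolding closure_approachable
      proof (intro allI impI)
        fix e :: real assume "0 < e"
        then obtain b where b: "b \<in> B" "x \<in> b" "b \<subseteq> ball x e"
          using topological_basisE[OF B(2) open_ball, of x x e] by auto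
        then have "p b \<in> ball x e" using x p(2)[of b] by blast
        moreover obtain n where "from_nat_into B n = b"
          using b(1) B(1) from_nat_into_surj by metis
        ultimately show "\<exists>y\<in>range q. dist y x < e" by (auto simp: q_def dist_commute)
      qed
    qed
  qed
qed

text \<open>The approximating simple functions take values in \<open>S\<close>: at stage \<open>n\<close> the value is the nearest one among
  \<open>0\<close> and the first \<open>n\<close> points of a dense sequence in \<open>S\<close>, so that \<open>norm (f x)\<close> bounds the error.\<close>

lemma (in finite_measure) integral_closed_subspace:
  fixes f :: "'a \<Rightarrow> 'b::{banach, second_countable_topology}"
  assumes f: "integrable M f" "\<And>x. x \<in> space M \<Longrightarrow> f x \<in> S" and S: "subspace S" "closed S"
  shows "(\<integral>x. f x \<partial>M) \<in> S"
proof -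
  have [measurable]: "f \<in> borel_measurable M" using f by auto
  obtain q where q: "\<And>n::nat. q n \<in> S" "S \<subseteq> closure (range q)"
    using dense_sequence[of S] subspace_0[OF S(1)] by blast
  define g where "g = rec_nat (\<lambda>x. 0) (\<lambda>n g x. if dist (f x) (q n) < dist (f x) (g x) then q n else g x)"
  have g_0: "g 0 = (\<lambda>x. 0)"
    and g_Suc: "g (Suc n) = (\<lambda>x. if dist (f x) (q n) < dist (f x) (g n x) then q n else g n x)" for n
    by (auto simp: g_def fun_eq_iff)
  have simple: "simple_function M (g n)" for n
  proof (induction n)
    case (Suc n)
    have [measurable]: "g n \<in> borel_measurable M" by (rule borel_measurable_simple_function[OF Suc])
    show ?case unfolding g_Suc by (intro simple_function_If simple_function_const Suc) measurable
  qed (simp add: g_0)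
  have g_S: "g n x \<in> S" for n x
    by (induction n) (auto simp: g_0 g_Suc q subspace_0[OF S(1)])
  have g_int: "integrable M (g n)" "(\<integral>x. g n x \<partial>M) \<in> S" for n
  proof -
    \<comment> \<open>The measure is finite, so every simple function is integrable, and its
      integral is a finite linear combination of values in \<open>S\<close>.\<close>
    have "Bochner_Integration.simple_bochner_integrable M (g n)"
      by (rule simple_bochner_integrable.intros[OF simple]) simp
    from has_bochner_integral_simple_bochner_integrable[OF this]
    show "integrable M (g n)" "(\<integral>x. g n x \<partial>M) \<in> S"
      using g_S by (auto simp: has_bochner_integral_iff Bochner_Integration.simple_bochner_integral_def
          intro!: subspace_sum[OF S(1)] subspace_scale[OF S(1)])
  qed
  have anti: "dist (f x) (g (Suc n) x) \<le> dist (f x) (g n x)" for n x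
    by (simp add: g_Suc)
  have anti': "dist (f x) (g n x) \<le> dist (f x) (g m x)" if "m \<le> n" for m n x
    using that by (rule lift_Suc_antimono_le[rotated]) (rule anti)
  have "(\<lambda>n. \<integral>x. g n x \<partial>M) \<longlonglongrightarrow> (\<integral>x. f x \<partial>M)"
  proof (rule integral_dominated_convergence)
    show "integrable M (\<lambda>x. 2 * norm (f x))" using f by auto
    show "AE x in M. (\<lambda>n. g n x) \<longlonglongrightarrow> f x"
    proof (rule AE_I2, rule metric_LIMSEQ_I)
      fix x and e :: real assume "x \<in> space M" "0 < e"
      then have "f x \<in> closure (range q)" using f(2) q(2) by blast
      then obtain n where n: "dist (q n) (f x) < e"
        using \<open>0 < e\<close> unfolding closure_approachable by blast
      have "dist (g m x) (f x) < e" if "Suc n \<le> m" for m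
      proof -
        have "dist (f x) (g m x) \<le> dist (f x) (g (Suc n) x)" by (rule anti'[OF that])
        also have "\<dots> \<le> dist (f x) (q n)" by (simp add: g_Suc)
        finally show ?thesis using n by (simp add: dist_commute)
      qed
      then show "\<exists>no. \<forall>m\<ge>no. dist (g m x) (f x) < e" by blast
    qed
    show "AE x in M. norm (g n x) \<le> 2 * norm (f x)" for n
    proof (rule AE_I2)
      fix x
      have "dist (f x) (g n x) \<le> norm (f x)" using anti'[of 0 n x] by (simp add: g_0)
      then show "norm (g n x) \<le> 2 * norm (f x)"
        using norm_triangle_ineq4[of "f x" "f x - g n x"] by (simp add: dist_norm)
    qed
  qed (use g_int f in auto)
  from Lim_in_closed_set[OF S(2) _ sequentially_bot this] g_int(2) show ?thesis by simp
qed

section \<open>Integrability from almost sure majorants\<close>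

lemma integrable_AE_bound:
  fixes f :: "'a \<Rightarrow> real"
  assumes "integrable M g" "f \<in> borel_measurable M" "AE x in M. \<bar>f x\<bar> \<le> g x"
  shows "integrable M f"
  using assms(1,2) by (rule Bochner_Integration.integrable_bound) (use assms(3) in \<open>auto elim!: AE_mp\<close>)

lemma square_integrable_AE_bound:
  assumes g: "square_integrable M g" and f: "f \<in> borel_measurable M" "AE x in M. \<bar>f x\<bar> \<le> g x"
  shows "square_integrable M f"
  unfolding square_integrable_def
proof
  have AE: "AE x in M. \<bar>(f x)\<^sup>2\<bar> \<le> (g x)\<^sup>2"
  proof (use f(2) in eventually_elim)
    case (elim x)
    then have "\<bar>f x\<bar>\<^sup>2 \<le> (g x)\<^sup>2" by (intro power_mono) auto
    then show ?case by simp
  qed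
  have "integrable M (\<lambda>x. (g x)\<^sup>2)" using g by (simp add: square_integrable_def)
  from integrable_AE_bound[OF this borel_measurable_power[OF f(1)] AE]
  show "integrable M (\<lambda>x. (f x)\<^sup>2)" .
qed (rule f(1))

lemma square_integrable_sum:
  assumes "\<And>i. i \<in> I \<Longrightarrow> square_integrable M (f i)"
  shows "square_integrable M (\<lambda>x. \<Sum>i\<in>I. f i x)"
  using assms
proof (induction I rule: infinite_finite_induct)
  case (insert i I)
  then have "square_integrable M (\<lambda>x. f i x + (\<Sum>i\<in>I. f i x))"
    by (intro square_integrable_add) blast+
  then show ?case using insert.hyps by simp
qed (simp_all add: square_integrable_zero)

section \<open>The Galerkin error in an abstract setting\<close>

lemma linear_on_sum:
  fixes h :: "'h::real_vector \<Rightarrow> real"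
  assumes "subspace V" and add: "\<And>x y. x \<in> V \<Longrightarrow> y \<in> V \<Longrightarrow> h (x + y) = h x + h y"
    and scale: "\<And>c x. x \<in> V \<Longrightarrow> h (c *\<^sub>R x) = c * h x"
    and "finite I" "\<And>k. k \<in> I \<Longrightarrow> x k \<in> V"
  shows "h (\<Sum>k\<in>I. c k *\<^sub>R x k) = (\<Sum>k\<in>I. c k * h (x k))"
  using assms(4,5)
proof (induction I rule: finite_induct)
  case empty
  show ?case using scale[OF subspace_0[OF assms(1)], of 0] by simp
next
  case (insert i I)
  have "(\<Sum>k\<in>I. c k *\<^sub>R x k) \<in> V"
    using insert.prems by (intro subspace_sum[OF assms(1)] subspace_scale[OF assms(1)]) auto
  then show ?case
    using insert by (simp add: add scale subspace_scale[OF assms(1)])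
qed

text \<open>The model is \<open>solenoidal_test_fields\<close> for \<open>D\<close>,
  \<open>gradient\<close> for \<open>T\<close> and \<open>trilinear\<close> for \<open>a\<close>.
  Bounds and linearity are required on \<open>closure D\<close>, where the solutions live;
  skew-symmetry is required only on \<open>D\<close>, where integration by parts is classical, and
  is extended by continuity.\<close>

locale advection =
  fixes D :: "'h::{banach, second_countable_topology} set"
    and T :: "'h \<Rightarrow> 'g::{real_inner, second_countable_topology}"
    and a :: "'h \<Rightarrow> 'h \<Rightarrow> 'h \<Rightarrow> real" and K C :: real
  assumes subspace_D: "subspace D"
    and bounded_linear_T: "bounded_linear T"
    and poincare: "x \<in> closure D \<Longrightarrow> norm x \<le> K * norm (T x)"
    and C_nonneg: "0 \<le> C"
    and a_bound: "x \<in> closure D \<Longrightarrow> y \<in> closure D \<Longrightarrow> z \<in> closure D \<Longrightarrow>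
      \<bar>a x y z\<bar> \<le> C * norm (T x) * norm (T y) * norm (T z)"
    and a_add: "x \<in> closure D \<Longrightarrow> x' \<in> closure D \<Longrightarrow> y \<in> closure D \<Longrightarrow> z \<in> closure D \<Longrightarrow>
        a (x + x') y z = a x y z + a x' y z"
      "x \<in> closure D \<Longrightarrow> y \<in> closure D \<Longrightarrow> y' \<in> closure D \<Longrightarrow> z \<in> closure D \<Longrightarrow>
        a x (y + y') z = a x y z + a x y' z"
      "x \<in> closure D \<Longrightarrow> y \<in> closure D \<Longrightarrow> z \<in> closure D \<Longrightarrow> z' \<in> closure D \<Longrightarrow>
        a x y (z + z') = a x y z + a x y z'"
    and a_scale: "x \<in> closure D \<Longrightarrow> y \<in> closure D \<Longrightarrow> z \<in> closure D \<Longrightarrow> a x y (c *\<^sub>R z) = c * a x y z"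
    and a_skew_D: "x \<in> D \<Longrightarrow> y \<in> D \<Longrightarrow> a x y y = 0"
begin

abbreviation V :: "'h set" where "V \<equiv> closure D"

lemma subspace_V: "subspace V"
  by (rule subspace_closure[OF subspace_D])

lemmas V_add = subspace_add[OF subspace_V]
  and V_diff = subspace_diff[OF subspace_V]
  and V_scale = subspace_scale[OF subspace_V]
  and V_sum = subspace_sum[OF subspace_V]

sublocale T: bounded_linear T by (rule bounded_linear_T)

lemma a_diff:
  "x \<in> V \<Longrightarrow> x' \<in> V \<Longrightarrow> y \<in> V \<Longrightarrow> z \<in> V \<Longrightarrow> a (x - x') y z = a x y z - a x' y z"
  "x \<in> V \<Longrightarrow> y \<in> V \<Longrightarrow> y' \<in> V \<Longrightarrow> z \<in> V \<Longrightarrow> a x (y - y') z = a x y z - a x y' z"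
  "x \<in> V \<Longrightarrow> y \<in> V \<Longrightarrow> z \<in> V \<Longrightarrow> z' \<in> V \<Longrightarrow> a x y (z - z') = a x y z - a x y z'"
proof -
  show "a (x - x') y z = a x y z - a x' y z" if "x \<in> V" "x' \<in> V" "y \<in> V" "z \<in> V"
    using a_add(1)[OF V_diff[OF that(1,2)] that(2-4)] by simp
  show "a x (y - y') z = a x y z - a x y' z" if "x \<in> V" "y \<in> V" "y' \<in> V" "z \<in> V"
    using a_add(2)[OF that(1) V_diff[OF that(2,3)] that(3,4)] by simp
  show "a x y (z - z') = a x y z - a x y z'" if "x \<in> V" "y \<in> V" "z \<in> V" "z' \<in> V"
    using a_add(3)[OF that(1,2) V_diff[OF that(3,4)] that(4)] by simp
qed

text \<open>One slot is changed at a time, and \<open>a_bound\<close> controls each of the three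
  differences.\<close>

lemma a_tendsto:
  assumes V: "\<And>n. x n \<in> V" "\<And>n. y n \<in> V" "\<And>n. z n \<in> V" "x0 \<in> V" "y0 \<in> V" "z0 \<in> V"
    and lim: "x \<longlonglongrightarrow> x0" "y \<longlonglongrightarrow> y0" "z \<longlonglongrightarrow> z0"
  shows "(\<lambda>n::nat. a (x n) (y n) (z n)) \<longlonglongrightarrow> a x0 y0 z0"
proof (rule LIM_zero_cancel, rule Lim_null_comparison)
  let ?g = "\<lambda>n. C * norm (T (x n - x0)) * norm (T (y n)) * norm (T (z n))
      + C * norm (T x0) * norm (T (y n - y0)) * norm (T (z n))
      + C * norm (T x0) * norm (T y0) * norm (T (z n - z0))"
  have "norm (a (x n) (y n) (z n) - a x0 y0 z0) \<le> ?g n" for n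
  proof -
    have "a (x n) (y n) (z n) - a x0 y0 z0 = a (x n - x0) (y n) (z n) + a x0 (y n - y0) (z n) + a x0 y0 (z n - z0)"
      by (simp add: a_diff V)
    moreover have "\<bar>a (x n - x0) (y n) (z n)\<bar> \<le> C * norm (T (x n - x0)) * norm (T (y n)) * norm (T (z n))"
      by (intro a_bound V_diff V)
    moreover have "\<bar>a x0 (y n - y0) (z n)\<bar> \<le> C * norm (T x0) * norm (T (y n - y0)) * norm (T (z n))"
      by (intro a_bound V_diff V)
    moreover have "\<bar>a x0 y0 (z n - z0)\<bar> \<le> C * norm (T x0) * norm (T y0) * norm (T (z n - z0))"
      by (intro a_bound V_diff V)
    ultimately show ?thesis unfolding real_norm_def by linarith
  qed
  then show "\<forall>\<^sub>F n in sequentially. norm (a (x n) (y n) (z n) - a x0 y0 z0) \<le> ?g n" by simp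
  have "?g \<longlonglongrightarrow> C * norm (T (x0 - x0)) * norm (T y0) * norm (T z0)
      + C * norm (T x0) * norm (T (y0 - y0)) * norm (T z0) + C * norm (T x0) * norm (T y0) * norm (T (z0 - z0))"
    by (intro tendsto_intros T.tendsto lim)
  then show "?g \<longlonglongrightarrow> 0" by (simp add: T.zero)
qed

lemma a_skew:
  assumes "x \<in> V" "y \<in> V"
  shows "a x y y = 0"
proof -
  obtain f g where f: "\<And>n::nat. f n \<in> D" "f \<longlonglongrightarrow> x" and g: "\<And>n::nat. g n \<in> D" "g \<longlonglongrightarrow> y"
    using assms unfolding closure_sequential by blast
  have "(\<lambda>n. a (f n) (g n) (g n)) \<longlonglongrightarrow> a x y y"
    using f g closure_subset[of D] assms by (intro a_tendsto) auto
  then have "(\<lambda>n::nat. 0) \<longlonglongrightarrow> a x y y" by (simp add: a_skew_D f g)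
  then show ?thesis by (simp add: LIMSEQ_const_iff)
qed

text \<open>\<open>a\<close> is continuous only on \<open>V\<close>, so it is measurable only for
  the trace \<sigma>-algebra there. This is enough because the random elements take values in
  \<open>V\<close> everywhere on the space.\<close>

lemma a_measurable:
  assumes [measurable]: "X \<in> borel_measurable M" "Y \<in> borel_measurable M" "Z \<in> borel_measurable M"
    and V: "\<And>\<omega>. \<omega> \<in> space M \<Longrightarrow> X \<omega> \<in> V" "\<And>\<omega>. \<omega> \<in> space M \<Longrightarrow> Y \<omega> \<in> V" "\<And>\<omega>. \<omega> \<in> space M \<Longrightarrow> Z \<omega> \<in> V"
  shows "(\<lambda>\<omega>. a (X \<omega>) (Y \<omega>) (Z \<omega>)) \<in> borel_measurable M"
proof -
  have "continuous_on (V \<times> V \<times> V) (\<lambda>(x, y, z). a x y z)"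
    unfolding continuous_on_sequentially
  proof (intro allI ballI impI)
    fix s :: "nat \<Rightarrow> 'h \<times> 'h \<times> 'h" and p assume p: "p \<in> V \<times> V \<times> V" "(\<forall>n. s n \<in> V \<times> V \<times> V) \<and> s \<longlonglongrightarrow> p"
    then have s: "fst (s n) \<in> V" "fst (snd (s n)) \<in> V" "snd (snd (s n)) \<in> V" for n
      by (metis SigmaE fst_conv snd_conv)+
    have lim: "(\<lambda>n. fst (s n)) \<longlonglongrightarrow> fst p" "(\<lambda>n. fst (snd (s n))) \<longlonglongrightarrow> fst (snd p)"
      "(\<lambda>n. snd (snd (s n))) \<longlonglongrightarrow> snd (snd p)"
      using p(2) by (auto intro!: tendsto_intros)
    have "(\<lambda>n. a (fst (s n)) (fst (snd (s n))) (snd (snd (s n)))) \<longlonglongrightarrow> a (fst p) (fst (snd p)) (snd (snd p))"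
      by (rule a_tendsto[OF s _ _ _ lim]) (use p(1) in auto)
    then show "((\<lambda>(x, y, z). a x y z) \<circ> s) \<longlonglongrightarrow> (\<lambda>(x, y, z). a x y z) p"
      by (simp add: o_def case_prod_unfold)
  qed
  then have a: "(\<lambda>(x, y, z). a x y z) \<in> borel_measurable (restrict_space borel (V \<times> V \<times> V))"
    by (rule borel_measurable_continuous_on_restrict)
  have "(\<lambda>\<omega>. (X \<omega>, Y \<omega>, Z \<omega>)) \<in> measurable M (restrict_space borel (V \<times> V \<times> V))"
    by (rule measurable_restrict_space2) (use V in \<open>auto intro: borel_measurable_Pair\<close>)
  from measurable_compose[OF this a] show ?thesis by simp
qed

lemma T_measurable [measurable (raw)]: "X \<in> borel_measurable M \<Longrightarrow> (\<lambda>\<omega>. T (X \<omega>)) \<in> borel_measurable M"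
  using borel_measurable_continuous_on[OF T.continuous_on[OF continuous_on_id]] .

text \<open>Testing the equation with the solution itself, where the advection term drops out.\<close>

lemma energy_bound:
  assumes L: "0 \<le> L" and x: "x \<in> closure Q" and Q: "Q \<subseteq> D"
    and eq: "\<And>\<phi>. \<phi> \<in> Q \<Longrightarrow> \<nu> * (T x \<bullet> T \<phi>) + a x x \<phi> = - l \<phi>"
    and l_diff: "\<And>\<phi> \<psi>. \<phi> \<in> V \<Longrightarrow> \<psi> \<in> V \<Longrightarrow> l (\<phi> - \<psi>) = l \<phi> - l \<psi>"
    and l_bound: "\<And>\<phi>. \<phi> \<in> V \<Longrightarrow> \<bar>l \<phi>\<bar> \<le> L * norm (T \<phi>)"
  shows "\<nu> * norm (T x) \<le> L"
proof (cases "T x = 0")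
  case True
  then show ?thesis using L by (simp add: T.zero)
next
  case False
  \<comment> \<open>The equation is known only on \<open>Q\<close>, which may be countable. Both of
    its sides are continuous in the test vector, so density carries it to \<open>x\<close>.\<close>
  obtain f where f: "\<And>n::nat. f n \<in> Q" "f \<longlonglongrightarrow> x" using x unfolding closure_sequential by blast
  have fV: "f n \<in> V" for n using f(1) Q closure_subset[of D] by blast
  have xV: "x \<in> V" using x closure_mono[OF Q] by blast
  have "(\<lambda>n. l (f n)) \<longlonglongrightarrow> l x"
  proof (rule LIM_zero_cancel, rule Lim_null_comparison)
    show "\<forall>\<^sub>F n in sequentially. norm (l (f n) - l x) \<le> L * norm (T (f n - x))"
      using l_bound[OF V_diff[OF fV xV]] by (simp add: l_diff[OF fV xV])
    have "(\<lambda>n. L * norm (T (f n - x))) \<longlonglongrightarrow> L * norm (T (x - x))"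
      by (intro tendsto_intros T.tendsto f)
    then show "(\<lambda>n. L * norm (T (f n - x))) \<longlonglongrightarrow> 0" by (simp add: T.zero)
  qed
  then have "(\<lambda>n. - l (f n)) \<longlonglongrightarrow> - l x" by (rule tendsto_minus)
  moreover have "(\<lambda>n. \<nu> * (T x \<bullet> T (f n)) + a x x (f n)) \<longlonglongrightarrow> \<nu> * (T x \<bullet> T x) + a x x x"
    by (intro tendsto_intros T.tendsto f a_tendsto fV xV)
  ultimately have "\<nu> * (T x \<bullet> T x) + a x x x = - l x"
    using eq[OF f(1)] LIMSEQ_unique by simp
  then have "\<nu> * (norm (T x))\<^sup>2 = - l x"
    by (simp add: a_skew[OF xV xV] power2_norm_eq_inner)
  also have "\<dots> \<le> L * norm (T x)" using l_bound[OF xV] by simp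
  finally show ?thesis using False by (simp add: power2_eq_square)
qed

end

section \<open>Chaos expansions, projections and moments\<close>

lemma integral_sum_zero:
  fixes f :: "'k \<Rightarrow> 'w \<Rightarrow> real"
  assumes eq: "\<And>\<omega>. \<omega> \<in> space M \<Longrightarrow> F \<omega> = (\<Sum>k\<in>I. f k \<omega>)"
    and int: "\<And>k. k \<in> I \<Longrightarrow> integrable M (f k)" and zero: "\<And>k. k \<in> I \<Longrightarrow> (\<integral>\<omega>. f k \<omega> \<partial>M) = 0"
  shows "integrable M F" "(\<integral>\<omega>. F \<omega> \<partial>M) = 0"
proof -
  have "integrable M (\<lambda>\<omega>. \<Sum>k\<in>I. f k \<omega>)" by (intro Bochner_Integration.integrable_sum int)
  then show "integrable M F" using eq by (simp cong: Bochner_Integration.integrable_cong)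
  have "(\<integral>\<omega>. F \<omega> \<partial>M) = (\<integral>\<omega>. (\<Sum>k\<in>I. f k \<omega>) \<partial>M)"
    by (intro Bochner_Integration.integral_cong eq refl)
  also have "\<dots> = 0" using int zero by (simp add: Bochner_Integration.integral_sum)
  finally show "(\<integral>\<omega>. F \<omega> \<partial>M) = 0" .
qed

locale random_advection = advection D T a K C + prob_space M
  for D :: "'h::{banach, second_countable_topology} set"
    and T :: "'h \<Rightarrow> 'g::{real_inner, second_countable_topology}"
    and a K C and M :: "'w measure" +
  fixes P :: "nat \<Rightarrow> 'w \<Rightarrow> real"
  assumes P_sq: "square_integrable M (P n)"
    and P_nonzero: "(\<integral>\<omega>. (P n \<omega>)\<^sup>2 \<partial>M) \<noteq> 0"
    and P_orth: "m \<noteq> n \<Longrightarrow> (\<integral>\<omega>. P m \<omega> * P n \<omega> \<partial>M) = 0"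
begin

lemma P_measurable [measurable]: "P n \<in> borel_measurable M"
  using P_sq by (rule square_integrable_measurable)

text \<open>Square integrability is imposed on the gradient norm, as in the problem; by
  \<open>poincare\<close> it also controls the norm of \<open>X\<close>.\<close>

definition L2V :: "('w \<Rightarrow> 'h) set" where
  "L2V = {X. X \<in> borel_measurable M \<and> (\<forall>\<omega>\<in>space M. X \<omega> \<in> V) \<and> square_integrable M (\<lambda>\<omega>. norm (T (X \<omega>)))}"

lemma L2V_D:
  assumes "X \<in> L2V"
  shows "X \<in> borel_measurable M" "\<And>\<omega>. \<omega> \<in> space M \<Longrightarrow> X \<omega> \<in> V" "square_integrable M (\<lambda>\<omega>. norm (T (X \<omega>)))"
  using assms by (auto simp: L2V_def)

lemma L2V_diff:
  assumes X: "X \<in> L2V" and Y: "Y \<in> L2V"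
  shows "(\<lambda>\<omega>. X \<omega> - Y \<omega>) \<in> L2V"
proof -
  note [measurable] = L2V_D(1)[OF X] L2V_D(1)[OF Y]
  have "square_integrable M (\<lambda>\<omega>. norm (T (X \<omega> - Y \<omega>)))"
  proof (rule square_integrable_AE_bound)
    show "square_integrable M (\<lambda>\<omega>. norm (T (X \<omega>)) + norm (T (Y \<omega>)))"
      by (intro square_integrable_add L2V_D(3) X Y)
    show "AE \<omega> in M. \<bar>norm (T (X \<omega> - Y \<omega>))\<bar> \<le> norm (T (X \<omega>)) + norm (T (Y \<omega>))"
      by (intro AE_I2) (simp add: T.diff norm_triangle_ineq4)
  qed measurable
  then show ?thesis
    using L2V_D(2)[OF X] L2V_D(2)[OF Y] by (simp add: L2V_def V_diff)
qed

lemma L2V_chaos: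
  assumes x: "\<And>k. k \<le> N \<Longrightarrow> x k \<in> V"
  shows "(\<lambda>\<omega>. \<Sum>k\<le>N. P k \<omega> *\<^sub>R x k) \<in> L2V"
proof -
  have "square_integrable M (\<lambda>\<omega>. norm (T (\<Sum>k\<le>N. P k \<omega> *\<^sub>R x k)))"
  proof (rule square_integrable_AE_bound)
    show "square_integrable M (\<lambda>\<omega>. \<Sum>k\<le>N. norm (T (x k)) * \<bar>P k \<omega>\<bar>)"
      by (intro square_integrable_sum square_integrable_scale square_integrable_abs P_sq)
    show "AE \<omega> in M. \<bar>norm (T (\<Sum>k\<le>N. P k \<omega> *\<^sub>R x k))\<bar> \<le> (\<Sum>k\<le>N. norm (T (x k)) * \<bar>P k \<omega>\<bar>)"
      by (intro AE_I2) (auto simp: T.sum T.scaleR mult.commute intro!: order_trans[OF norm_sum])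
  qed measurable
  then show ?thesis using x by (auto simp: L2V_def intro!: V_sum V_scale)
qed

text \<open>The Bochner integral lives in the full norm, but only the gradient is assumed square
  integrable. The Poincare constant \<open>K\<close> bridges the two, and then the product with
  \<open>P k\<close> is integrable by Cauchy-Schwarz.\<close>

lemma P_scaleR_integrable:
  assumes X: "X \<in> L2V"
  shows "integrable M (\<lambda>\<omega>. P k \<omega> *\<^sub>R X \<omega>)"
proof (rule Bochner_Integration.integrable_bound)
  show "integrable M (\<lambda>\<omega>. \<bar>P k \<omega>\<bar> * (K * norm (T (X \<omega>))))"
    by (intro square_integrable_mult square_integrable_abs square_integrable_scale P_sq L2V_D(3) X)
  show "AE \<omega> in M. norm (P k \<omega> *\<^sub>R X \<omega>) \<le> norm (\<bar>P k \<omega>\<bar> * (K * norm (T (X \<omega>))))"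
  proof (rule AE_I2)
    fix \<omega> assume "\<omega> \<in> space M"
    then have "norm (X \<omega>) \<le> K * norm (T (X \<omega>))" by (intro poincare L2V_D(2)[OF X])
    then have "\<bar>P k \<omega>\<bar> * norm (X \<omega>) \<le> \<bar>P k \<omega>\<bar> * (K * norm (T (X \<omega>)))"
      by (intro mult_left_mono) auto
    also have "\<dots> \<le> norm (\<bar>P k \<omega>\<bar> * (K * norm (T (X \<omega>))))"
      unfolding real_norm_def by (rule abs_ge_self)
    finally show "norm (P k \<omega> *\<^sub>R X \<omega>) \<le> norm (\<bar>P k \<omega>\<bar> * (K * norm (T (X \<omega>))))" by simp
  qed
qed (use L2V_D(1)[OF X] in measurable)

definition chaos_coeff :: "('w \<Rightarrow> 'h) \<Rightarrow> nat \<Rightarrow> 'h" where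
  "chaos_coeff X k = (\<integral>\<omega>. P k \<omega> *\<^sub>R X \<omega> \<partial>M) /\<^sub>R (\<integral>\<omega>. (P k \<omega>)\<^sup>2 \<partial>M)"

lemma proj_eq: "proj M P N X \<omega> = (\<Sum>k\<le>N. P k \<omega> *\<^sub>R chaos_coeff X k)"
  by (simp add: proj_def chaos_coeff_def)

lemma chaos_coeff_V:
  assumes X: "X \<in> L2V"
  shows "chaos_coeff X k \<in> V"
  unfolding chaos_coeff_def using P_scaleR_integrable[OF X] L2V_D(2)[OF X]
  by (intro V_scale integral_closed_subspace subspace_V) (auto intro: V_scale)

lemma proj_L2V: "X \<in> L2V \<Longrightarrow> proj M P N X \<in> L2V"
  unfolding proj_eq[abs_def] by (intro L2V_chaos chaos_coeff_V)

text \<open>Orthogonality keeps the single term \<open>j = k\<close>, whose coefficient was divided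
  by the second moment of \<open>P k\<close>. The values are in a general Banach space because both
  the random field and the scalar terms of the Galerkin equation are projected.\<close>

lemma integral_P_proj:
  fixes X :: "'w \<Rightarrow> 'b::{banach, second_countable_topology}"
  assumes "k \<le> N"
  shows "(\<integral>\<omega>. P k \<omega> *\<^sub>R proj M P N X \<omega> \<partial>M) = (\<integral>\<omega>. P k \<omega> *\<^sub>R X \<omega> \<partial>M)"
proof -
  define y where "y j = (\<integral>\<omega>. P j \<omega> *\<^sub>R X \<omega> \<partial>M) /\<^sub>R (\<integral>\<omega>. (P j \<omega>)\<^sup>2 \<partial>M)" for j
  have int: "integrable M (\<lambda>\<omega>. P k \<omega> * P j \<omega>)" for j by (rule square_integrable_mult[OF P_sq P_sq])
  have "(\<integral>\<omega>. P k \<omega> *\<^sub>R proj M P N X \<omega> \<partial>M) = (\<integral>\<omega>. (\<Sum>j\<le>N. (P k \<omega> * P j \<omega>) *\<^sub>R y j) \<partial>M)"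
    unfolding proj_def y_def[symmetric] scaleR_sum_right scaleR_scaleR ..
  also have "\<dots> = (\<Sum>j\<le>N. (\<integral>\<omega>. P k \<omega> * P j \<omega> \<partial>M) *\<^sub>R y j)"
    using int by (simp add: Bochner_Integration.integral_sum)
  also have "\<dots> = (\<Sum>j\<le>N. if j = k then (\<integral>\<omega>. (P k \<omega>)\<^sup>2 \<partial>M) *\<^sub>R y k else 0)"
    using P_orth[of k] by (intro sum.cong) (auto simp: power2_eq_square)
  also have "\<dots> = (\<integral>\<omega>. P k \<omega> *\<^sub>R X \<omega> \<partial>M)"
    using assms P_nonzero[of k] by (simp add: y_def)
  finally show ?thesis .
qed

text \<open>Pairing \<open>T\<close> with a fixed \<open>z\<close> is a bounded linear map, so it
  can be pulled out of the Bochner integral; what remains is the difference of two equal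
  moments.\<close>

lemma residual_orthogonal:
  assumes X: "X \<in> L2V" and "k \<le> N"
  shows "(\<integral>\<omega>. P k \<omega> * (T (X \<omega> - proj M P N X \<omega>) \<bullet> z) \<partial>M) = 0"
proof -
  have "(\<integral>\<omega>. T (P k \<omega> *\<^sub>R (X \<omega> - proj M P N X \<omega>)) \<bullet> z \<partial>M)
      = T (\<integral>\<omega>. P k \<omega> *\<^sub>R (X \<omega> - proj M P N X \<omega>) \<partial>M) \<bullet> z"
    using bounded_linear_compose[OF bounded_linear_inner_left bounded_linear_T]
      P_scaleR_integrable[OF L2V_diff[OF X proj_L2V[OF X]]]
    by (rule integral_bounded_linear)
  also have "(\<integral>\<omega>. P k \<omega> *\<^sub>R (X \<omega> - proj M P N X \<omega>) \<partial>M) = 0"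
    using P_scaleR_integrable[OF X] P_scaleR_integrable[OF proj_L2V[OF X]] integral_P_proj[OF assms(2), of X]
    by (simp add: scaleR_diff_right)
  finally show ?thesis by (simp add: T.scaleR T.zero)
qed

definition weak_form :: "real \<Rightarrow> 'h \<Rightarrow> 'h \<Rightarrow> real" where
  "weak_form \<nu> x \<phi> = \<nu> * (T x \<bullet> T \<phi>) + a x x \<phi>"

lemma weak_form_linear:
  assumes "x \<in> V"
  shows "\<phi> \<in> V \<Longrightarrow> \<psi> \<in> V \<Longrightarrow> weak_form \<nu> x (\<phi> + \<psi>) = weak_form \<nu> x \<phi> + weak_form \<nu> x \<psi>"
    and "\<phi> \<in> V \<Longrightarrow> weak_form \<nu> x (c *\<^sub>R \<phi>) = c * weak_form \<nu> x \<phi>"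
  using assms by (simp_all add: weak_form_def a_add(3) a_scale T.add T.scaleR inner_add_right algebra_simps)

text \<open>The advection term is quadratic in \<open>x\<close>, but a deterministic bound on
  \<open>C * norm (T x)\<close> turns one of the two factors into the constant \<gamma>. For random
  \<open>x\<close> in \<open>L2V\<close> the form is then dominated by a square integrable variable
  and can be multiplied by \<open>P k\<close>.\<close>

lemma weak_form_bound:
  assumes "x \<in> V" "\<phi> \<in> V" "0 \<le> \<nu>" "C * norm (T x) \<le> \<gamma>"
  shows "\<bar>weak_form \<nu> x \<phi>\<bar> \<le> (\<nu> + \<gamma>) * norm (T x) * norm (T \<phi>)"
proof -
  have "\<bar>\<nu> * (T x \<bullet> T \<phi>)\<bar> \<le> \<nu> * (norm (T x) * norm (T \<phi>))"
    using mult_left_mono[OF Cauchy_Schwarz_ineq2 assms(3)] assms(3) by (simp add: abs_mult)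
  moreover have "\<bar>a x x \<phi>\<bar> \<le> C * norm (T x) * norm (T x) * norm (T \<phi>)"
    using assms by (intro a_bound)
  moreover have "C * norm (T x) * norm (T x) * norm (T \<phi>) \<le> \<gamma> * norm (T x) * norm (T \<phi>)"
    using assms(4) by (intro mult_right_mono) auto
  ultimately show ?thesis unfolding weak_form_def by (simp add: algebra_simps)
qed

lemma weak_form_measurable:
  assumes X: "X \<in> L2V" and Y: "Y \<in> L2V"
  shows "(\<lambda>\<omega>. weak_form \<nu> (X \<omega>) (Y \<omega>)) \<in> borel_measurable M"
proof -
  note [measurable] = L2V_D(1)[OF X] L2V_D(1)[OF Y]
  have [measurable]: "(\<lambda>\<omega>. a (X \<omega>) (X \<omega>) (Y \<omega>)) \<in> borel_measurable M"
    by (intro a_measurable L2V_D X Y)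
  show ?thesis unfolding weak_form_def by measurable
qed

lemma L2V_const:
  assumes "\<phi> \<in> V"
  shows "(\<lambda>\<omega>. \<phi>) \<in> L2V"
  using assms by (simp add: L2V_def square_integrable_def)

lemma P_weak_form_integrable:
  assumes Y: "Y \<in> L2V" and \<phi>: "\<phi> \<in> V" and \<nu>: "0 \<le> \<nu>" and bound: "AE \<omega> in M. C * norm (T (Y \<omega>)) \<le> \<gamma>"
  shows "integrable M (\<lambda>\<omega>. P k \<omega> * weak_form \<nu> (Y \<omega>) \<phi>)"
proof (rule integrable_AE_bound)
  show "integrable M (\<lambda>\<omega>. \<bar>P k \<omega>\<bar> * (((\<nu> + \<gamma>) * norm (T \<phi>)) * norm (T (Y \<omega>))))"
    by (intro square_integrable_mult square_integrable_abs square_integrable_scale P_sq L2V_D Y)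
  show "(\<lambda>\<omega>. P k \<omega> * weak_form \<nu> (Y \<omega>) \<phi>) \<in> borel_measurable M"
    by (intro borel_measurable_times P_measurable weak_form_measurable L2V_const Y \<phi>)
  show "AE \<omega> in M. \<bar>P k \<omega> * weak_form \<nu> (Y \<omega>) \<phi>\<bar> \<le> \<bar>P k \<omega>\<bar> * (((\<nu> + \<gamma>) * norm (T \<phi>)) * norm (T (Y \<omega>)))"
    using bound AE_space
  proof eventually_elim
    case (elim \<omega>)
    then have "\<bar>weak_form \<nu> (Y \<omega>) \<phi>\<bar> \<le> (\<nu> + \<gamma>) * norm (T (Y \<omega>)) * norm (T \<phi>)"
      using \<nu> \<phi> by (intro weak_form_bound L2V_D(2)[OF Y]) auto
    then have "\<bar>P k \<omega>\<bar> * \<bar>weak_form \<nu> (Y \<omega>) \<phi>\<bar> \<le> \<bar>P k \<omega>\<bar> * ((\<nu> + \<gamma>) * norm (T (Y \<omega>)) * norm (T \<phi>))"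
      by (intro mult_left_mono) auto
    then show ?case by (simp add: abs_mult mult_ac)
  qed
qed

text \<open>A moment against \<open>P k\<close> with \<open>k <= N\<close> does not see the
  difference between a variable and its projection. The projected equation thereby yields a moment
  identity in the unprojected form, comparable with that of the Navier-Stokes solution.\<close>

lemma galerkin_moment:
  assumes v: "v \<in> L2V" and \<phi>: "\<phi> \<in> V" and \<nu>: "0 \<le> \<nu>" and bound: "AE \<omega> in M. C * norm (T (v \<omega>)) \<le> \<gamma>"
    and "k \<le> N"
    and eq: "AE \<omega> in M. \<nu> * (T (v \<omega>) \<bullet> T \<phi>) + proj M P N (\<lambda>\<omega>. a (v \<omega>) (v \<omega>) \<phi>) \<omega> = - proj M P N X \<omega>"
  shows "(\<integral>\<omega>. P k \<omega> * weak_form \<nu> (v \<omega>) \<phi> \<partial>M) = - (\<integral>\<omega>. P k \<omega> * X \<omega> \<partial>M)"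
proof -
  let ?A = "\<lambda>\<omega>. a (v \<omega>) (v \<omega>) \<phi>"
  note [measurable] = L2V_D(1)[OF v]
  have proj_sq: "square_integrable M (proj M P N Y)" for Y :: "'w \<Rightarrow> real"
    unfolding proj_def[abs_def] real_scaleR_def
    by (subst mult.commute) (intro square_integrable_sum square_integrable_scale P_sq)
  have proj_meas [measurable]: "proj M P N Y \<in> borel_measurable M" for Y :: "'w \<Rightarrow> real"
    by (rule square_integrable_measurable[OF proj_sq])
  have proj_int: "integrable M (\<lambda>\<omega>. P k \<omega> * proj M P N Y \<omega>)" for Y :: "'w \<Rightarrow> real"
    by (rule square_integrable_mult[OF P_sq proj_sq])
  \<comment> \<open>With zero viscosity the weak form is the advection term alone.\<close>
  have A_int: "integrable M (\<lambda>\<omega>. P k \<omega> * ?A \<omega>)"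
    using P_weak_form_integrable[OF v \<phi> _ bound, of 0] by (simp add: weak_form_def)
  have "integrable M (\<lambda>\<omega>. P k \<omega> * weak_form \<nu> (v \<omega>) \<phi> - P k \<omega> * ?A \<omega>)"
    by (intro Bochner_Integration.integrable_diff P_weak_form_integrable[OF v \<phi> \<nu> bound] A_int)
  then have T_int: "integrable M (\<lambda>\<omega>. P k \<omega> * (\<nu> * (T (v \<omega>) \<bullet> T \<phi>)))"
    by (simp add: weak_form_def algebra_simps)
  have "(\<integral>\<omega>. P k \<omega> * weak_form \<nu> (v \<omega>) \<phi> \<partial>M)
      = (\<integral>\<omega>. P k \<omega> * (\<nu> * (T (v \<omega>) \<bullet> T \<phi>)) \<partial>M) + (\<integral>\<omega>. P k \<omega> * ?A \<omega> \<partial>M)"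
    using T_int A_int by (simp add: weak_form_def distrib_left)
  also have "(\<integral>\<omega>. P k \<omega> * ?A \<omega> \<partial>M) = (\<integral>\<omega>. P k \<omega> * proj M P N ?A \<omega> \<partial>M)"
    using integral_P_proj[OF \<open>k \<le> N\<close>, of ?A] by simp
  also have "(\<integral>\<omega>. P k \<omega> * (\<nu> * (T (v \<omega>) \<bullet> T \<phi>)) \<partial>M) + \<dots>
      = (\<integral>\<omega>. P k \<omega> * (\<nu> * (T (v \<omega>) \<bullet> T \<phi>) + proj M P N ?A \<omega>) \<partial>M)"
    using T_int proj_int by (simp add: distrib_left)
  also have "\<dots> = (\<integral>\<omega>. - (P k \<omega> * proj M P N X \<omega>) \<partial>M)"
  proof (rule integral_cong_AE)
    show "AE \<omega> in M. P k \<omega> * (\<nu> * (T (v \<omega>) \<bullet> T \<phi>) + proj M P N ?A \<omega>) = - (P k \<omega> * proj M P N X \<omega>)"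
      using eq by eventually_elim simp
  qed measurable
  also have "\<dots> = - (\<integral>\<omega>. P k \<omega> * X \<omega> \<partial>M)"
    using integral_P_proj[OF \<open>k \<le> N\<close>, of X] by simp
  finally show ?thesis .
qed

text \<open>Minkowski's inequality, by expanding the square and applying Cauchy-Schwarz to the mixed
  term.\<close>

lemma L2V_triangle:
  assumes X: "X \<in> L2V" and Y: "Y \<in> L2V"
  shows "sqrt (\<integral>\<omega>. (norm (T (X \<omega> + Y \<omega>)))\<^sup>2 \<partial>M)
    \<le> sqrt (\<integral>\<omega>. (norm (T (X \<omega>)))\<^sup>2 \<partial>M) + sqrt (\<integral>\<omega>. (norm (T (Y \<omega>)))\<^sup>2 \<partial>M)"
proof -
  define p q where "p \<omega> = norm (T (X \<omega>))" and "q \<omega> = norm (T (Y \<omega>))" for \<omega>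
  define A B where "A = sqrt (\<integral>\<omega>. (p \<omega>)\<^sup>2 \<partial>M)" and "B = sqrt (\<integral>\<omega>. (q \<omega>)\<^sup>2 \<partial>M)"
  note [measurable] = L2V_D(1)[OF X] L2V_D(1)[OF Y]
  have sq: "square_integrable M p" "square_integrable M q"
    using L2V_D(3)[OF X] L2V_D(3)[OF Y] by (simp_all add: p_def[abs_def] q_def[abs_def])
  have int: "integrable M (\<lambda>\<omega>. (p \<omega>)\<^sup>2)" "integrable M (\<lambda>\<omega>. (q \<omega>)\<^sup>2)" "integrable M (\<lambda>\<omega>. p \<omega> * q \<omega>)"
    using sq square_integrable_mult[OF sq] by (simp_all add: square_integrable_def)
  have le: "(norm (T (X \<omega> + Y \<omega>)))\<^sup>2 \<le> (p \<omega>)\<^sup>2 + (q \<omega>)\<^sup>2 + 2 * (p \<omega> * q \<omega>)" for \<omega>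
  proof -
    have "(norm (T (X \<omega> + Y \<omega>)))\<^sup>2 \<le> (p \<omega> + q \<omega>)\<^sup>2"
      unfolding p_def q_def T.add by (intro power_mono norm_triangle_ineq norm_ge_zero)
    then show ?thesis by (simp add: power2_sum)
  qed
  have "(\<integral>\<omega>. (norm (T (X \<omega> + Y \<omega>)))\<^sup>2 \<partial>M) \<le> (\<integral>\<omega>. (p \<omega>)\<^sup>2 + (q \<omega>)\<^sup>2 + 2 * (p \<omega> * q \<omega>) \<partial>M)"
  proof (rule integral_mono[OF _ _ le])
    show sum_int: "integrable M (\<lambda>\<omega>. (p \<omega>)\<^sup>2 + (q \<omega>)\<^sup>2 + 2 * (p \<omega> * q \<omega>))"
      by (intro Bochner_Integration.integrable_add integrable_mult_right int)
    show "integrable M (\<lambda>\<omega>. (norm (T (X \<omega> + Y \<omega>)))\<^sup>2)"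
      by (rule integrable_AE_bound[OF sum_int]) (use le in simp_all)
  qed
  also have "\<dots> = A\<^sup>2 + B\<^sup>2 + 2 * (\<integral>\<omega>. p \<omega> * q \<omega> \<partial>M)"
    using int by (simp add: A_def B_def)
  also have "(\<integral>\<omega>. p \<omega> * q \<omega> \<partial>M) \<le> A * B"
    using Cauchy_Schwarz_square_integrable[OF sq] by (simp add: A_def B_def p_def q_def abs_mult)
  finally have "(\<integral>\<omega>. (norm (T (X \<omega> + Y \<omega>)))\<^sup>2 \<partial>M) \<le> (A + B)\<^sup>2" by (simp add: power2_sum)
  from real_sqrt_le_mono[OF this] show ?thesis by (simp add: A_def B_def p_def q_def)
qed

text \<open>\<alpha> and \<beta> are the costs of a factor \<open>u\<close> or \<open>v\<close> in
  the trilinear form, with \<open>C\<close> already included; \<beta> < \<nu> makes room for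
  absorption. The hypothesis on moments concerns fixed vectors of \<open>D\<close> only, and the
  first half of the argument upgrades it to the random vector \<open>w\<close>.\<close>

lemma galerkin_estimate:
  fixes u v :: "'w \<Rightarrow> 'h"
  assumes u: "u \<in> L2V" and v: "\<And>\<omega>. \<omega> \<in> space M \<Longrightarrow> v \<omega> = (\<Sum>k\<le>N. P k \<omega> *\<^sub>R c k)"
    and c: "\<And>k. k \<le> N \<Longrightarrow> c k \<in> V"
    and \<nu>: "0 < \<nu>" and \<alpha>: "0 \<le> \<alpha>" and \<beta>: "0 \<le> \<beta>" "\<beta> < \<nu>"
    and u_bound: "AE \<omega> in M. C * norm (T (u \<omega>)) \<le> \<alpha>"
    and v_bound: "AE \<omega> in M. C * norm (T (v \<omega>)) \<le> \<beta>"
    and eq: "\<And>\<phi> k. \<phi> \<in> D \<Longrightarrow> k \<le> N \<Longrightarrow>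
      (\<integral>\<omega>. P k \<omega> * weak_form \<nu> (u \<omega>) \<phi> \<partial>M) = (\<integral>\<omega>. P k \<omega> * weak_form \<nu> (v \<omega>) \<phi> \<partial>M)"
  shows "(\<nu> - \<beta>) * sqrt (\<integral>\<omega>. (norm (T (proj M P N u \<omega> - v \<omega>)))\<^sup>2 \<partial>M)
      \<le> (\<alpha> + \<beta>) * sqrt (\<integral>\<omega>. (norm (T (u \<omega> - proj M P N u \<omega>)))\<^sup>2 \<partial>M)"
proof -
  have vL: "v \<in> L2V"
  proof -
    have "(\<lambda>\<omega>. \<Sum>k\<le>N. P k \<omega> *\<^sub>R c k) \<in> L2V" by (rule L2V_chaos[OF c])
    then show ?thesis unfolding L2V_def square_integrable_def
      using v by (simp cong: measurable_cong Bochner_Integration.integrable_cong)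
  qed
  define r where "r \<omega> = u \<omega> - proj M P N u \<omega>" for \<omega>
  define w where "w \<omega> = proj M P N u \<omega> - v \<omega>" for \<omega>
  have r: "r \<in> L2V" and w: "w \<in> L2V"
    unfolding r_def[abs_def] w_def[abs_def] by (intro L2V_diff u vL proj_L2V)+
  define x where "x k = chaos_coeff u k - c k" for k
  have x: "x k \<in> V" if "k \<le> N" for k
    unfolding x_def by (intro V_diff chaos_coeff_V u c that)
  have w_eq: "w \<omega> = (\<Sum>k\<le>N. P k \<omega> *\<^sub>R x k)" if "\<omega> \<in> space M" for \<omega>
    by (simp add: w_def proj_eq v[OF that] x_def scaleR_diff_right sum_subtractf)
  define E where "E \<omega> \<phi> = weak_form \<nu> (u \<omega>) \<phi> - weak_form \<nu> (v \<omega>) \<phi>" for \<omega> \<phi>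
  \<comment> \<open>A square integrable majorant for the difference \<open>E\<close> of the two weak
    forms, independent of the test vector.\<close>
  define g where "g \<omega> = (\<nu> + \<alpha>) * norm (T (u \<omega>)) + (\<nu> + \<beta>) * norm (T (v \<omega>))" for \<omega>
  have g_sq: "square_integrable M g"
    unfolding g_def[abs_def] by (intro square_integrable_add square_integrable_scale L2V_D u vL)
  have E_add: "E \<omega> (\<phi> + \<psi>) = E \<omega> \<phi> + E \<omega> \<psi>" and E_scale: "E \<omega> (s *\<^sub>R \<phi>) = s * E \<omega> \<phi>"
    if "\<omega> \<in> space M" "\<phi> \<in> V" "\<psi> \<in> V" for \<omega> \<phi> \<psi> s
    using that by (simp_all add: E_def weak_form_linear L2V_D(2)[OF u] L2V_D(2)[OF vL] algebra_simps)
  \<comment> \<open>The exceptional set is that of the bounds on \<open>u\<close> and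
    \<open>v\<close>, so it is the same for all test vectors.\<close>
  have E_bound: "AE \<omega> in M. \<forall>\<phi>\<in>V. \<bar>E \<omega> \<phi>\<bar> \<le> g \<omega> * norm (T \<phi>)"
    using u_bound v_bound AE_space
  proof eventually_elim
    case (elim \<omega>)
    show ?case
    proof
      fix \<phi> assume \<phi>: "\<phi> \<in> V"
      have "\<bar>weak_form \<nu> (u \<omega>) \<phi>\<bar> \<le> (\<nu> + \<alpha>) * norm (T (u \<omega>)) * norm (T \<phi>)"
        using elim \<nu> \<phi> by (intro weak_form_bound L2V_D(2)[OF u]) auto
      moreover have "\<bar>weak_form \<nu> (v \<omega>) \<phi>\<bar> \<le> (\<nu> + \<beta>) * norm (T (v \<omega>)) * norm (T \<phi>)"
        using elim \<nu> \<phi> by (intro weak_form_bound L2V_D(2)[OF vL]) auto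
      ultimately show "\<bar>E \<omega> \<phi>\<bar> \<le> g \<omega> * norm (T \<phi>)"
        unfolding E_def g_def distrib_right by linarith
    qed
  qed
  have E_meas: "(\<lambda>\<omega>. E \<omega> (Y \<omega>)) \<in> borel_measurable M" if "Y \<in> L2V" for Y
    unfolding E_def by (intro borel_measurable_diff weak_form_measurable u vL that)
  note E_meas_const [measurable] = E_meas[OF L2V_const]
  have Pg: "integrable M (\<lambda>\<omega>. \<bar>P k \<omega>\<bar> * g \<omega>)" for k
    by (intro square_integrable_mult square_integrable_abs P_sq g_sq)
  have PE_bound: "AE \<omega> in M. \<bar>P k \<omega> * E \<omega> \<phi>\<bar> \<le> (\<bar>P k \<omega>\<bar> * g \<omega>) * norm (T \<phi>)" if "\<phi> \<in> V" for k \<phi>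
    using E_bound
  proof eventually_elim
    case (elim \<omega>)
    then have "\<bar>P k \<omega>\<bar> * \<bar>E \<omega> \<phi>\<bar> \<le> \<bar>P k \<omega>\<bar> * (g \<omega> * norm (T \<phi>))"
      using that by (intro mult_left_mono) auto
    then show ?case by (simp add: abs_mult mult.assoc)
  qed
  have PE_int: "integrable M (\<lambda>\<omega>. P k \<omega> * E \<omega> \<phi>)" if "\<phi> \<in> V" for k \<phi>
  proof (rule integrable_AE_bound[OF _ _ PE_bound[OF that]])
    show "integrable M (\<lambda>\<omega>. (\<bar>P k \<omega>\<bar> * g \<omega>) * norm (T \<phi>))" by (intro integrable_mult_left Pg)
    show "(\<lambda>\<omega>. P k \<omega> * E \<omega> \<phi>) \<in> borel_measurable M"
      by (intro borel_measurable_times P_measurable E_meas_const that)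
  qed
  have PE_D: "(\<integral>\<omega>. P k \<omega> * E \<omega> \<phi> \<partial>M) = 0" if "\<phi> \<in> D" "k \<le> N" for \<phi> k
  proof -
    have "\<phi> \<in> V" using that(1) closure_subset[of D] by blast
    then show ?thesis
      using eq[OF that] P_weak_form_integrable[OF u _ _ u_bound, of \<phi> \<nu> k]
        P_weak_form_integrable[OF vL _ _ v_bound, of \<phi> \<nu> k] \<nu>
      by (simp add: E_def right_diff_distrib)
  qed
  \<comment> \<open>The moment of \<open>E\<close> is Lipschitz in the test vector with the constant
    \<open>B\<close>, so it vanishes on the closure of \<open>D\<close> as well.\<close>
  have PE_V: "(\<integral>\<omega>. P k \<omega> * E \<omega> \<phi> \<partial>M) = 0" if \<phi>: "\<phi> \<in> V" and k: "k \<le> N" for \<phi> k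
  proof -
    obtain d where d: "\<And>n::nat. d n \<in> D" "d \<longlonglongrightarrow> \<phi>"
      using \<phi> unfolding closure_sequential by blast
    have dV: "d n \<in> V" for n using d(1) closure_subset[of D] by blast
    define B where "B = (\<integral>\<omega>. \<bar>P k \<omega>\<bar> * g \<omega> \<partial>M)"
    have le: "\<bar>\<integral>\<omega>. P k \<omega> * E \<omega> \<phi> \<partial>M\<bar> \<le> B * norm (T (\<phi> - d n))" for n
    proof -
      have diff: "\<phi> - d n \<in> V" by (intro V_diff \<phi> dV)
      have "(\<integral>\<omega>. P k \<omega> * E \<omega> \<phi> \<partial>M) = (\<integral>\<omega>. P k \<omega> * E \<omega> (\<phi> - d n) + P k \<omega> * E \<omega> (d n) \<partial>M)"
        using E_add[OF _ diff dV[of n]]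
        by (intro Bochner_Integration.integral_cong) (auto simp flip: distrib_left)
      also have "\<dots> = (\<integral>\<omega>. P k \<omega> * E \<omega> (\<phi> - d n) \<partial>M)"
        using PE_int[OF diff] PE_int[OF dV] PE_D[OF d(1) k] by simp
      finally have "\<bar>\<integral>\<omega>. P k \<omega> * E \<omega> \<phi> \<partial>M\<bar> \<le> (\<integral>\<omega>. \<bar>P k \<omega> * E \<omega> (\<phi> - d n)\<bar> \<partial>M)"
        by (simp only: integral_abs_bound)
      also have "\<dots> \<le> (\<integral>\<omega>. (\<bar>P k \<omega>\<bar> * g \<omega>) * norm (T (\<phi> - d n)) \<partial>M)"
        using PE_int[OF diff] Pg PE_bound[OF diff] by (intro integral_mono_AE integrable_abs integrable_mult_left) auto
      finally show ?thesis by (simp add: B_def)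
    qed
    have "(\<lambda>n. B * norm (T (\<phi> - d n))) \<longlonglongrightarrow> B * norm (T (\<phi> - \<phi>))"
      by (intro tendsto_intros T.tendsto d)
    then have "(\<lambda>n. B * norm (T (\<phi> - d n))) \<longlonglongrightarrow> 0" by (simp add: T.zero)
    then have "\<bar>\<integral>\<omega>. P k \<omega> * E \<omega> \<phi> \<partial>M\<bar> \<le> 0"
      using le by (intro LIMSEQ_le_const) auto
    then show ?thesis by simp
  qed
  \<comment> \<open>For fixed \<omega> the \<open>P k\<close> are mere numbers, so linearity in the
    test vector reduces testing with \<open>w\<close> to the fixed vectors
    \<open>x k\<close>.\<close>
  have E_w: "E \<omega> (w \<omega>) = (\<Sum>k\<le>N. P k \<omega> * E \<omega> (x k))" if "\<omega> \<in> space M" for \<omega>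
    unfolding w_eq[OF that] using that
    by (intro linear_on_sum[OF subspace_V]) (auto intro: E_add E_scale x)
  have Ew_int: "integrable M (\<lambda>\<omega>. E \<omega> (w \<omega>))"
    and Ew_0: "(\<integral>\<omega>. E \<omega> (w \<omega>) \<partial>M) = 0"
    by (rule integral_sum_zero[where M=M, OF E_w]; use PE_int[OF x] PE_V[OF x] in simp)+
  have rw_eq: "T (r \<omega>) \<bullet> T (w \<omega>) = (\<Sum>k\<le>N. P k \<omega> * (T (r \<omega>) \<bullet> T (x k)))" if "\<omega> \<in> space M" for \<omega>
    by (simp add: w_eq[OF that] T.sum T.scaleR inner_sum_right)
  have Prx_int: "integrable M (\<lambda>\<omega>. P k \<omega> * (T (r \<omega>) \<bullet> T (x k)))" for k
  proof -
    have "integrable M (\<lambda>\<omega>. T (P k \<omega> *\<^sub>R r \<omega>) \<bullet> T (x k))"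
      using bounded_linear_compose[OF bounded_linear_inner_left bounded_linear_T] P_scaleR_integrable[OF r]
      by (rule integrable_bounded_linear)
    then show ?thesis by (simp add: T.scaleR)
  qed
  have rw_int: "integrable M (\<lambda>\<omega>. T (r \<omega>) \<bullet> T (w \<omega>))"
    and rw_0: "(\<integral>\<omega>. T (r \<omega>) \<bullet> T (w \<omega>) \<partial>M) = 0"
    by (rule integral_sum_zero[where M=M, OF rw_eq];
        use Prx_int residual_orthogonal[OF u, of _ N] in \<open>simp add: r_def\<close>)+
  define R W where "R = sqrt (\<integral>\<omega>. (norm (T (r \<omega>)))\<^sup>2 \<partial>M)" and "W = sqrt (\<integral>\<omega>. (norm (T (w \<omega>)))\<^sup>2 \<partial>M)"
  have W2: "(\<integral>\<omega>. (norm (T (w \<omega>)))\<^sup>2 \<partial>M) = W\<^sup>2" and W: "0 \<le> W" by (simp_all add: W_def)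
  have w2_int: "integrable M (\<lambda>\<omega>. (norm (T (w \<omega>)))\<^sup>2)"
    using L2V_D(3)[OF w] by (simp add: square_integrable_def)
  have nn_int: "integrable M (\<lambda>\<omega>. norm (T (r \<omega>)) * norm (T (w \<omega>)))"
    by (intro square_integrable_mult L2V_D r w)
  have pointwise: "AE \<omega> in M. \<nu> * (norm (T (w \<omega>)))\<^sup>2 + \<nu> * (T (r \<omega>) \<bullet> T (w \<omega>))
      \<le> E \<omega> (w \<omega>) + (\<alpha> + \<beta>) * (norm (T (r \<omega>)) * norm (T (w \<omega>))) + \<beta> * (norm (T (w \<omega>)))\<^sup>2"
    using u_bound v_bound AE_space
  proof eventually_elim
    case (elim \<omega>)
    define u' v' r' w' where "u' = u \<omega>" and "v' = v \<omega>" and "r' = r \<omega>" and "w' = w \<omega>"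
    have V: "u' \<in> V" "v' \<in> V" "r' \<in> V" "w' \<in> V"
      using elim L2V_D(2)[OF u] L2V_D(2)[OF vL] L2V_D(2)[OF r] L2V_D(2)[OF w]
      by (simp_all add: u'_def v'_def r'_def w'_def)
    have uv: "u' = v' + (r' + w')" by (simp add: u'_def v'_def r'_def w'_def r_def w_def)
    \<comment> \<open>The middle slot is expanded first: its \<open>w\<close> part is
      \<open>a u' w' w'\<close>, which vanishes. Expanding the first slot of what remains pairs
      every other \<open>w\<close> with \<open>v\<close>, whose bound \<beta> is the one below
      \<nu>.\<close>
    have "a u' u' w' - a v' v' w' = a u' r' w' + a r' v' w' + a w' v' w'"
    proof -
      have "a u' u' w' = a u' v' w' + a u' r' w' + a u' w' w'"
        by (subst (2) uv) (simp add: a_add(2) V V_add)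
      moreover have "a u' v' w' = a v' v' w' + a r' v' w' + a w' v' w'"
        by (subst uv) (simp add: a_add(1) V V_add)
      ultimately show ?thesis by (simp add: a_skew V)
    qed
    moreover have "T u' \<bullet> T w' - T v' \<bullet> T w' = T r' \<bullet> T w' + (norm (T w'))\<^sup>2"
      by (simp add: uv T.add inner_add_left power2_norm_eq_inner)
    ultimately have "E \<omega> (w \<omega>) = \<nu> * (norm (T w'))\<^sup>2 + \<nu> * (T r' \<bullet> T w') + (a u' r' w' + a r' v' w' + a w' v' w')"
      unfolding E_def weak_form_def u'_def[symmetric] v'_def[symmetric] w'_def[symmetric]
      by (simp add: algebra_simps)
    moreover have "\<bar>a u' r' w'\<bar> \<le> \<alpha> * (norm (T r') * norm (T w'))"
    proof -
      have "\<bar>a u' r' w'\<bar> \<le> (C * norm (T u')) * (norm (T r') * norm (T w'))"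
        using a_bound[OF V(1,3,4)] by (simp add: mult_ac)
      also have "\<dots> \<le> \<alpha> * (norm (T r') * norm (T w'))"
        using elim by (intro mult_right_mono) (auto simp: u'_def)
      finally show ?thesis .
    qed
    moreover have v_le: "\<bar>a z v' w'\<bar> \<le> \<beta> * (norm (T z) * norm (T w'))" if "z \<in> V" for z
    proof -
      have "\<bar>a z v' w'\<bar> \<le> (C * norm (T v')) * (norm (T z) * norm (T w'))"
        using a_bound[OF that V(2,4)] by (simp add: mult_ac)
      also have "\<dots> \<le> \<beta> * (norm (T z) * norm (T w'))"
        using elim by (intro mult_right_mono) (auto simp: v'_def)
      finally show ?thesis .
    qed
    ultimately show ?case
      using v_le[OF V(3)] v_le[OF V(4)]
      unfolding r'_def[symmetric] w'_def[symmetric] distrib_right power2_eq_square by linarith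
  qed
  \<comment> \<open>The mixed term may be added freely, having expectation zero; it makes the
    integrand match the pointwise inequality.\<close>
  have "\<nu> * W\<^sup>2 = (\<integral>\<omega>. \<nu> * (norm (T (w \<omega>)))\<^sup>2 + \<nu> * (T (r \<omega>) \<bullet> T (w \<omega>)) \<partial>M)"
    using w2_int rw_int by (simp add: W2 rw_0)
  also have "\<dots> \<le> (\<integral>\<omega>. E \<omega> (w \<omega>) + (\<alpha> + \<beta>) * (norm (T (r \<omega>)) * norm (T (w \<omega>))) + \<beta> * (norm (T (w \<omega>)))\<^sup>2 \<partial>M)"
    by (intro integral_mono_AE pointwise Bochner_Integration.integrable_add integrable_mult_right w2_int rw_int nn_int Ew_int)
  also have "\<dots> = (\<alpha> + \<beta>) * (\<integral>\<omega>. norm (T (r \<omega>)) * norm (T (w \<omega>)) \<partial>M) + \<beta> * W\<^sup>2"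
    using w2_int nn_int Ew_int by (simp add: Ew_0 W2)
  also have "\<dots> \<le> (\<alpha> + \<beta>) * (R * W) + \<beta> * W\<^sup>2"
    using Cauchy_Schwarz_square_integrable[OF L2V_D(3)[OF r] L2V_D(3)[OF w]] \<alpha> \<beta>
    by (intro add_right_mono mult_left_mono) (simp_all add: R_def W_def abs_mult)
  finally have "((\<nu> - \<beta>) * W) * W \<le> ((\<alpha> + \<beta>) * R) * W"
    by (simp add: algebra_simps power2_eq_square)
  moreover have "0 \<le> (\<alpha> + \<beta>) * R" using \<alpha> \<beta> by (simp add: R_def)
  \<comment> \<open>One factor \<open>W\<close> is cancelled; for \<open>W = 0\<close> the claim is
    the nonnegativity of the right-hand side.\<close>
  ultimately have "(\<nu> - \<beta>) * W \<le> (\<alpha> + \<beta>) * R"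
    using W by (cases "W = 0") (auto simp: mult_le_cancel_right)
  then show ?thesis by (simp add: R_def W_def r_def w_def)
qed

end

section \<open>The Navier-Stokes system\<close>

lemma Hm1_field_diff:
  assumes l: "l \<in> Hm1_field G" and m: "m \<in> Hm1_field G"
  shows "(\<lambda>\<phi>. l \<phi> - m \<phi>) \<in> Hm1_field G"
proof -
  obtain B where B: "\<And>u. u \<in> H10_field G \<Longrightarrow> \<bar>l u\<bar> \<le> B * H1_norm G u"
    using l unfolding Hm1_field_def by blast
  obtain C where C: "\<And>u. u \<in> H10_field G \<Longrightarrow> \<bar>m u\<bar> \<le> C * H1_norm G u"
    using m unfolding Hm1_field_def by blast
  have "\<bar>l u - m u\<bar> \<le> (B + C) * H1_norm G u" if "u \<in> H10_field G" for u
    using B[OF that] C[OF that] by (simp add: distrib_right)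
  moreover have "l (u + v) - m (u + v) = (l u - m u) + (l v - m v)" if "u \<in> H10_field G" "v \<in> H10_field G" for u v
    using l m that unfolding Hm1_field_def by simp
  moreover have "l (c *\<^sub>R u) - m (c *\<^sub>R u) = c * (l u - m u)" if "u \<in> H10_field G" for c u
    using l m that unfolding Hm1_field_def by (simp add: right_diff_distrib)
  ultimately show ?thesis unfolding Hm1_field_def by blast
qed

lemma Hm1_field_apply_diff:
  assumes l: "l \<in> Hm1_field G" and u: "u \<in> H10_field G" and v: "v \<in> H10_field G"
  shows "l (u - v) = l u - l v"
proof -
  have "l (u + (- 1) *\<^sub>R v) = l u + l ((- 1) *\<^sub>R v)"
    using l u subspace_scale[OF subspace_H10_field v, of "-1"] unfolding Hm1_field_def by blast
  moreover have "l ((- 1) *\<^sub>R v) = (- 1) * l v"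
    using l v unfolding Hm1_field_def by blast
  ultimately show ?thesis by simp
qed

text \<open>By \<open>Hm1_norm_bound\<close>, evaluation at a fixed field is continuous for the dual
  norm, so \<open>f\<close> evaluated there is a pointwise limit of simple functions.\<close>

lemma L2_Hm1_apply_measurable:
  assumes G: "open G" and f: "f \<in> L2_Hm1 M G" and \<phi>: "\<phi> \<in> H10_field G"
  shows "(\<lambda>\<omega>. f \<omega> \<phi>) \<in> borel_measurable M"
proof -
  obtain s where s: "\<And>n::nat. simple_function M (s n)" "\<And>n \<omega>. \<omega> \<in> space M \<Longrightarrow> s n \<omega> \<in> Hm1_field G"
    "\<And>\<omega>. \<omega> \<in> space M \<Longrightarrow> (\<lambda>n. Hm1_norm G (\<lambda>\<phi>. f \<omega> \<phi> - s n \<omega> \<phi>)) \<longlonglongrightarrow> 0"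
    using f unfolding L2_Hm1_def Hm1_measurable_def by blast
  have f_dual: "f \<omega> \<in> Hm1_field G" if "\<omega> \<in> space M" for \<omega>
    using f that by (simp add: L2_Hm1_def)
  show ?thesis
  proof (rule borel_measurable_LIMSEQ_real)
    show "(\<lambda>\<omega>. s n \<omega> \<phi>) \<in> borel_measurable M" for n
      using simple_function_compose[OF s(1), of "\<lambda>l. l \<phi>" n]
      by (intro borel_measurable_simple_function) (simp add: o_def)
    fix \<omega> assume \<omega>: "\<omega> \<in> space M"
    have "(\<lambda>n. s n \<omega> \<phi> - f \<omega> \<phi>) \<longlonglongrightarrow> 0"
    proof (rule Lim_null_comparison)
      have "\<bar>f \<omega> \<phi> - s n \<omega> \<phi>\<bar> \<le> Hm1_norm G (\<lambda>\<phi>. f \<omega> \<phi> - s n \<omega> \<phi>) * norm (gradient \<phi>)" for n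
        by (rule Hm1_norm_bound[OF G Hm1_field_diff[OF f_dual[OF \<omega>] s(2)[OF \<omega>]] \<phi>])
      then show "\<forall>\<^sub>F n in sequentially.
          norm (s n \<omega> \<phi> - f \<omega> \<phi>) \<le> Hm1_norm G (\<lambda>\<phi>. f \<omega> \<phi> - s n \<omega> \<phi>) * norm (gradient \<phi>)"
        by (simp add: abs_minus_commute)
      show "(\<lambda>n. Hm1_norm G (\<lambda>\<phi>. f \<omega> \<phi> - s n \<omega> \<phi>) * norm (gradient \<phi>)) \<longlonglongrightarrow> 0"
        using tendsto_mult_left_zero[OF s(3)[OF \<omega>]] .
    qed
    then show "(\<lambda>n. s n \<omega> \<phi>) \<longlonglongrightarrow> f \<omega> \<phi>" by (rule LIM_zero_cancel)
  qed
qed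

text \<open>The constant 1/4 of \<open>trilinear_bound\<close> is relaxed to 1/2 so that it cancels
  the factor \<open>2 / sqrt |G|\<close> in the bounds on the two solutions.\<close>

lemma advection_trilinear:
  assumes G: "open G" "bounded G"
  shows "advection (solenoidal_test_fields G) gradient (trilinear G)
    (sqrt (1 + measure lborel G / 8)) (sqrt (measure lborel G) / 2)"
proof -
  have H10: "x \<in> H10_field G" if "x \<in> closure (solenoidal_test_fields G)" for x
    using that H10_solenoidal_subset by (auto simp: H10_solenoidal_def)
  show ?thesis
  proof (rule advection.intro)
    show "subspace (solenoidal_test_fields G)" by (rule subspace_solenoidal_test_fields)
    show "bounded_linear gradient" by (rule bounded_linear_gradient)
    show "0 \<le> sqrt (measure lborel G) / 2" by simp
    show "trilinear G x y y = 0" if "x \<in> solenoidal_test_fields G" "y \<in> solenoidal_test_fields G" for x y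
      by (rule trilinear_skew[OF that G(1)])
  next
    fix x assume "x \<in> closure (solenoidal_test_fields G)"
    from real_sqrt_le_mono[OF poincare_H10_field[OF H10[OF this] G]]
    show "norm x \<le> sqrt (1 + measure lborel G / 8) * norm (gradient x)"
      by (simp add: real_sqrt_mult)
  next
    fix x y z assume V: "x \<in> closure (solenoidal_test_fields G)" "y \<in> closure (solenoidal_test_fields G)"
      "z \<in> closure (solenoidal_test_fields G)"
    have "\<bar>trilinear G x y z\<bar> \<le> sqrt (measure lborel G) / 4 * (norm (gradient x) * norm (gradient y) * norm (gradient z))"
      using trilinear_bound[OF G H10[OF V(1)] H10[OF V(3)], of y] by (simp add: mult_ac)
    also have "\<dots> \<le> sqrt (measure lborel G) / 2 * (norm (gradient x) * norm (gradient y) * norm (gradient z))"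
      by (intro mult_right_mono) auto
    finally show "\<bar>trilinear G x y z\<bar>
        \<le> sqrt (measure lborel G) / 2 * norm (gradient x) * norm (gradient y) * norm (gradient z)"
      by (simp add: mult_ac)
  qed (intro trilinear_add trilinear_scaleR G H10; assumption)+
qed

theorem theorem3p5:
  fixes G :: "plane set" and M :: "'w measure" and P :: "nat \<Rightarrow> 'w \<Rightarrow> real"
    and \<nu> \<theta> \<epsilon> :: real and N :: nat
    and f :: "'w \<Rightarrow> sobolev_field \<Rightarrow> real" and u v :: "'w \<Rightarrow> sobolev_field"
  assumes "bounded_lipschitz_domain G" and "0 < \<nu>"
    and "prob_space M" and "chaos_basis M P" and "1 \<le> N"
    and "f \<in> L2_Hm1 M G"
    and "0 < \<theta>" and "\<theta> < 1"
    and "AE \<omega> in M. Hm1_norm G (f \<omega>) \<le> 2 * \<theta> * \<nu>\<^sup>2 / sqrt (measure lborel G)"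
    and "NS_solution M G \<nu> f u"
    and "Galerkin_solution M P N G \<nu> f v"
    and "0 < \<epsilon>" and "\<epsilon> < 1"
    and "AE \<omega> in M. H1_norm G (v \<omega>) \<le> 2 * \<nu> * (1 - \<epsilon>) / sqrt (measure lborel G)"
  shows "L2_H1_norm M G (\<lambda>\<omega>. proj M P N u \<omega> - v \<omega>)
           \<le> (\<theta> + 1 - \<epsilon>) / \<epsilon> * L2_H1_norm M G (\<lambda>\<omega>. u \<omega> - proj M P N u \<omega>) \<and>
         L2_H1_norm M G (\<lambda>\<omega>. u \<omega> - v \<omega>)
           \<le> (1 + (\<theta> + 1 - \<epsilon>) / \<epsilon>) * L2_H1_norm M G (\<lambda>\<omega>. u \<omega> - proj M P N u \<omega>)"
proof -
  have G: "open G" "bounded G" using assms(1) by (simp_all add: bounded_lipschitz_domain_def)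
  define D where "D = solenoidal_test_fields G"
  define A where "A = measure lborel G"
  interpret prob_space M by (rule assms(3))
  interpret advection D gradient "trilinear G" "sqrt (1 + A / 8)" "sqrt A / 2"
    unfolding D_def A_def by (rule advection_trilinear[OF G])
  interpret random_advection D gradient "trilinear G" "sqrt (1 + A / 8)" "sqrt A / 2" M P
    by unfold_locales (use assms(4) in \<open>auto simp: chaos_basis_def\<close>)
  have V_eq: "H10_solenoidal G = V" by (simp add: H10_solenoidal_def D_def)
  have V_H10: "x \<in> H10_field G" if "x \<in> V" for x using that H10_solenoidal_subset V_eq by blast
  have D_V: "x \<in> V" if "x \<in> D" for x using that closure_subset[of D] by blast
  have H1: "H1_norm G x = norm (gradient x)" if "x \<in> V" for x
    by (rule H1_norm_eq[OF G(1) V_H10[OF that]])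
  have inner: "grad_inner G x y = gradient x \<bullet> gradient y" if "x \<in> V" for x y
    by (rule grad_inner_eq[OF G(1) V_H10[OF that]])
  have u: "u \<in> L2V"
  proof -
    have *: "u \<in> borel_measurable M" "\<And>\<omega>. \<omega> \<in> space M \<Longrightarrow> u \<omega> \<in> V" "integrable M (\<lambda>\<omega>. (H1_norm G (u \<omega>))\<^sup>2)"
      using assms(10) by (auto simp: NS_solution_def L2_H10_solenoidal_def V_eq)
    note [measurable] = *(1)
    have "integrable M (\<lambda>\<omega>. (norm (gradient (u \<omega>)))\<^sup>2)"
      using *(3) by (simp add: H1 *(2) cong: Bochner_Integration.integrable_cong)
    with * show ?thesis by (simp add: L2V_def square_integrable_def)
  qed
  obtain c where c: "\<And>k. k \<le> N \<Longrightarrow> c k \<in> V"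
    and v_eq: "\<And>\<omega>. \<omega> \<in> space M \<Longrightarrow> v \<omega> = (\<Sum>k\<le>N. P k \<omega> *\<^sub>R c k)"
    using assms(11) unfolding Galerkin_solution_def proj_space_def V_eq by blast
  have v: "v \<in> L2V"
    using L2V_chaos[OF c] v_eq unfolding L2V_def square_integrable_def
    by (simp cong: measurable_cong Bochner_Integration.integrable_cong)
  have f_dual: "f \<omega> \<in> Hm1_field G" if "\<omega> \<in> space M" for \<omega>
    using assms(6) that by (simp add: L2_Hm1_def)
  have NS: "AE \<omega> in M. \<nu> * (gradient (u \<omega>) \<bullet> gradient \<phi>) + trilinear G (u \<omega>) (u \<omega>) \<phi> = - f \<omega> \<phi>"
    if "\<phi> \<in> D" for \<phi>
  proof -
    have "AE \<omega> in M. \<nu> * grad_inner G (u \<omega>) \<phi> + trilinear G (u \<omega>) (u \<omega>) \<phi> = - f \<omega> \<phi>"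
      using assms(10) that by (simp add: NS_solution_def D_def)
    then show ?thesis using AE_space by eventually_elim (simp add: inner L2V_D(2)[OF u])
  qed
  have scale: "sqrt A / 2 * t \<le> \<nu> * s" if "t \<le> 2 * \<nu> * s / sqrt A" "0 \<le> s" for s t
  proof -
    have "sqrt A / 2 * t \<le> sqrt A / 2 * (2 * \<nu> * s / sqrt A)"
      using that by (intro mult_left_mono) (auto simp: A_def)
    \<comment> \<open>Equality unless \<open>A = 0\<close>; there division by zero makes the left
      side 0.\<close>
    also have "\<dots> \<le> \<nu> * s" using that assms(2) by (cases "A = 0") auto
    finally show ?thesis .
  qed
  have u_bound: "AE \<omega> in M. sqrt A / 2 * norm (gradient (u \<omega>)) \<le> \<nu> * \<theta>"
  proof -
    \<comment> \<open>The equation is used along a dense sequence, so that countably many null sets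
      combine into one. Off it, \<open>energy_bound\<close> applies to each realisation.\<close>
    obtain q where q: "\<And>n::nat. q n \<in> D" "D \<subseteq> closure (range q)"
      using dense_sequence[of D] subspace_0[OF subspace_D] by blast
    have "AE \<omega> in M. \<forall>n. \<nu> * (gradient (u \<omega>) \<bullet> gradient (q n)) + trilinear G (u \<omega>) (u \<omega>) (q n) = - f \<omega> (q n)"
      using NS[OF q(1)] by (simp add: AE_all_countable)
    then show ?thesis
      using assms(9) AE_space
    proof eventually_elim
      case (elim \<omega>)
      note f\<omega> = f_dual[OF elim(3)]
      have "u \<omega> \<in> closure (range q)"
        using L2V_D(2)[OF u elim(3)] closure_mono[OF q(2)] by auto
      then have "\<nu> * norm (gradient (u \<omega>)) \<le> Hm1_norm G (f \<omega>)"
      proof (rule energy_bound[rotated])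
        show "0 \<le> Hm1_norm G (f \<omega>)" by (simp add: Hm1_norm_def sum_nonneg)
        show "range q \<subseteq> D" using q(1) by blast
        show "\<nu> * (gradient (u \<omega>) \<bullet> gradient \<phi>) + trilinear G (u \<omega>) (u \<omega>) \<phi> = - f \<omega> \<phi>" if "\<phi> \<in> range q" for \<phi>
          using elim(1) that by blast
        show "f \<omega> (\<phi> - \<psi>) = f \<omega> \<phi> - f \<omega> \<psi>" if "\<phi> \<in> V" "\<psi> \<in> V" for \<phi> \<psi>
          by (rule Hm1_field_apply_diff[OF f\<omega> V_H10[OF that(1)] V_H10[OF that(2)]])
        show "\<bar>f \<omega> \<phi>\<bar> \<le> Hm1_norm G (f \<omega>) * norm (gradient \<phi>)" if "\<phi> \<in> V" for \<phi>
          by (rule Hm1_norm_bound[OF G(1) f\<omega> V_H10[OF that]])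
      qed
      also have "\<dots> \<le> \<nu> * (2 * \<nu> * \<theta> / sqrt A)"
        using elim(2) by (simp add: A_def power2_eq_square mult_ac)
      finally have "norm (gradient (u \<omega>)) \<le> 2 * \<nu> * \<theta> / sqrt A"
        using assms(2) by (rule mult_left_le_imp_le)
      then show ?case using assms(7) by (intro scale) auto
    qed
  qed
  have v_bound: "AE \<omega> in M. sqrt A / 2 * norm (gradient (v \<omega>)) \<le> \<nu> * (1 - \<epsilon>)"
    using assms(14) AE_space
  proof eventually_elim
    case (elim \<omega>)
    then show ?case using assms(13) L2V_D(2)[OF v] by (intro scale) (auto simp: H1 A_def)
  qed
  \<comment> \<open>Both sides are minus the \<open>k\<close>-th moment of the forcing evaluated at
    \<phi>: directly for \<open>u\<close>, and after removing the projections for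
    \<open>v\<close>.\<close>
  have eq: "(\<integral>\<omega>. P k \<omega> * weak_form \<nu> (u \<omega>) \<phi> \<partial>M) = (\<integral>\<omega>. P k \<omega> * weak_form \<nu> (v \<omega>) \<phi> \<partial>M)"
    if \<phi>: "\<phi> \<in> D" and k: "k \<le> N" for \<phi> k
  proof -
    have "(\<integral>\<omega>. P k \<omega> * weak_form \<nu> (u \<omega>) \<phi> \<partial>M) = (\<integral>\<omega>. - (P k \<omega> * f \<omega> \<phi>) \<partial>M)"
    proof (rule integral_cong_AE)
      show "(\<lambda>\<omega>. P k \<omega> * weak_form \<nu> (u \<omega>) \<phi>) \<in> borel_measurable M"
        by (intro borel_measurable_times P_measurable weak_form_measurable L2V_const u D_V \<phi>)
      show "(\<lambda>\<omega>. - (P k \<omega> * f \<omega> \<phi>)) \<in> borel_measurable M"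
        by (intro borel_measurable_uminus borel_measurable_times P_measurable
            L2_Hm1_apply_measurable[OF G(1) assms(6)] V_H10 D_V \<phi>)
      show "AE \<omega> in M. P k \<omega> * weak_form \<nu> (u \<omega>) \<phi> = - (P k \<omega> * f \<omega> \<phi>)"
        using NS[OF \<phi>] by eventually_elim (simp add: weak_form_def)
    qed
    also have "\<dots> = - (\<integral>\<omega>. P k \<omega> * f \<omega> \<phi> \<partial>M)" by simp
    also have "\<dots> = (\<integral>\<omega>. P k \<omega> * weak_form \<nu> (v \<omega>) \<phi> \<partial>M)"
    proof (rule galerkin_moment[OF v D_V[OF \<phi>] _ v_bound k, symmetric])
      have "AE \<omega> in M. \<nu> * grad_inner G (v \<omega>) \<phi> + proj M P N (\<lambda>\<omega>. trilinear G (v \<omega>) (v \<omega>) \<phi>) \<omega>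
          = - proj M P N (\<lambda>\<omega>. f \<omega> \<phi>) \<omega>"
        using assms(11) \<phi> by (simp add: Galerkin_solution_def proj_functional_def D_def)
      then show "AE \<omega> in M. \<nu> * (gradient (v \<omega>) \<bullet> gradient \<phi>) + proj M P N (\<lambda>\<omega>. trilinear G (v \<omega>) (v \<omega>) \<phi>) \<omega>
          = - proj M P N (\<lambda>\<omega>. f \<omega> \<phi>) \<omega>"
        using AE_space by eventually_elim (simp add: inner L2V_D(2)[OF v])
    qed (use assms(2) in simp)
    finally show ?thesis .
  qed
  have norm_eq: "L2_H1_norm M G X = sqrt (\<integral>\<omega>. (norm (gradient (X \<omega>)))\<^sup>2 \<partial>M)" if "X \<in> L2V" for X
    unfolding L2_H1_norm_def using L2V_D(2)[OF that]
    by (intro arg_cong[where f=sqrt] Bochner_Integration.integral_cong) (auto simp: H1)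
  define R W where "R = L2_H1_norm M G (\<lambda>\<omega>. u \<omega> - proj M P N u \<omega>)"
    and "W = L2_H1_norm M G (\<lambda>\<omega>. proj M P N u \<omega> - v \<omega>)"
  have r: "(\<lambda>\<omega>. u \<omega> - proj M P N u \<omega>) \<in> L2V" and w: "(\<lambda>\<omega>. proj M P N u \<omega> - v \<omega>) \<in> L2V"
    by (intro L2V_diff u v proj_L2V)+
  \<comment> \<open>Here \<alpha> = \<nu> \<theta> and \<beta> = \<nu> (1 - \<epsilon>), so the left
    factor is \<nu> \<epsilon>, and the viscosity cancels.\<close>
  have "(\<nu> - \<nu> * (1 - \<epsilon>)) * W \<le> (\<nu> * \<theta> + \<nu> * (1 - \<epsilon>)) * R"
    unfolding R_def W_def norm_eq[OF r] norm_eq[OF w]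
    by (rule galerkin_estimate[OF u v_eq c assms(2) _ _ _ u_bound v_bound eq])
      (use assms(2,7,12,13) in \<open>simp_all add: algebra_simps\<close>)
  then have "\<nu> * (\<epsilon> * W) \<le> \<nu> * ((\<theta> + 1 - \<epsilon>) * R)" by (simp add: algebra_simps)
  then have "\<epsilon> * W \<le> (\<theta> + 1 - \<epsilon>) * R" using assms(2) by (rule mult_left_le_imp_le)
  then have W: "W \<le> (\<theta> + 1 - \<epsilon>) / \<epsilon> * R" using assms(12) by (simp add: field_simps)
  have "L2_H1_norm M G (\<lambda>\<omega>. u \<omega> - v \<omega>) \<le> R + W"
    using L2V_triangle[OF r w] unfolding R_def W_def norm_eq[OF r] norm_eq[OF w] norm_eq[OF L2V_diff[OF u v]]
    by simp
  with W show ?thesis by (simp add: R_def W_def distrib_right)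
qed

end
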